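(* Let $B>0$. A family $\{\mathfrak h_l\}_{l\ge0}\subset H^+_{\mathbb C^2}$, with coefficient vectors $\Psi_i\in\mathbb C^2$ ($i\ge1$) defined by $\mathfrak h_0(\omega)=\sum_{k\ge0}\omega^k\Psi_{2^k}$ and $\mathfrak h_l(\omega)=\sum_{k\ge0}\omega^k\Psi_{2^{p+k+1}+l}$ ($l\ge1$, $2^p\le l<2^{p+1}$), satisfies the orthogonality conditions (H) of the context if and only if it is of one of the following five types. Type 1. For some $u_0\in\mathbb C^2$ with $\|u_0\|=1$ and $B_0\in\mathbb C$ with $|B_0|^2=B$: $\mathfrak h_0(\omega)=\Psi_1=B_0u_0$ and $\mathfrak h_l=0$ for $l\ge1$. Type 2. For some orthonormal basis $\{u_0,u_1\}$ of $\mathbb C^2$ and $B_0,C_1\in\mathbb C$ with $|B_0|^2=|C_1|^2=B$: $\mathfrak h_0(\omega)=\omega\Psi_2=\omega B_0u_0$, $\mathfrak h_1(\omega)=\Psi_3=C_1u_1$, $\mathfrak h_l=0$ for $l\ge2$. Type 3. For some orthonormal basis $\{u_0,u_1\}$ of $\mathbb C^2$, $0<\rho<1$, $B_0,C_1\in\mathbb C$ with $|B_0|^2=B$, $|C_1|^2=B(1-\rho^2)$, and $\theta\in\mathbb R$: $$\mathfrak h_0(\omega)=\Psi_1+\omega\Psi_2=B_0\big(\rho u_0+\omega(1-\rho^2)^{1/2}u_1\big),$$ $$\mathfrak h_1(\omega)=\Psi_3+\omega\Psi_5=C_1e^{i\theta}\big[(1-\rho^2)^{1/2}u_0-\omega\rho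 u_1\big],$$ $$\mathfrak h_{2^p-1}(\omega)=\Psi_{2^p+2^p-1}+\omega\Psi_{2^{p+1}+2^p-1}=\Big(-\frac{\overline{B_0}\,\rho(1-\rho^2)^{1/2}e^{i\theta}}{\overline{C_1}}\Big)^{p-1}C_1e^{i\theta}\big[(1-\rho^2)^{1/2}u_0-\omega\rho u_1\big]\quad(p>1),$$ and $\mathfrak h_l=0$ for all other $l$. Type 4. For some orthonormal basis $\{u_0,u_1\}$ of $\mathbb C^2$, $0<\rho<1$, $B_0,C_1\in\mathbb C$ with $|B_0|^2=B$, $|C_1|^2=B(1-\rho^2)$, and $\theta\in\mathbb R$: $$\mathfrak h_0(\omega)=\sum_{k\ge0}\omega^k\Psi_{2^k}=B_0\Big(1+\frac{1-\rho^2}{\rho}e^{i\theta}\sum_{k=1}^\infty\omega^k(-\rho e^{i\theta})^{k-1}\Big)\rho u_0,\qquad \mathfrak h_1(\omega)=\Psi_3=C_1u_1,$$ $$\mathfrak h_{2^p}(\omega)=\Psi_{2^{p+1}+2^p}=\frac{B}{\overline{C_1}}(-\rho e^{i\theta})^p(1-\rho^2)u_1\quad(p>0),$$ and $\mathfrak h_l=0$ for all other $l$. Type 5. For some $\rho_0\in\mathbb C$ with $0<|\rho_0|<1$, unit vectors $u_0,u_1,v\in\mathbb C^2$ with $\langle v,u_0\rangle\ne0$, $\langle u_1,u_0\rangle\ne0$ and $$\frac{|\rho_0|^2}{1-|\rho_0|^2}\langle u_0,u_1\rangle\langle v,u_0\rangle+\langle v,u_1\rangle=0,$$ complex numbers $\rho_1,\tau_0$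 of arbitrary argument with $$|\rho_1|^2=\frac{1-|\rho_0|^2}{1+\frac{|\rho_0|^2}{1-|\rho_0|^2}|\langle v,u_0\rangle|^2},\qquad|\tau_0|^2=\frac1{1+\frac{|\rho_0|^2}{1-|\rho_0|^2}|\langle u_1,u_0\rangle|^2},$$ and $B_0,C_1\in\mathbb C$ of arbitrary argument with $|B_0|^2=B$, $|C_1|^2=B(1-|\rho_0|^2)$, setting $$r=-\frac{\overline{\rho_0}}{\overline{\rho_1}}\,\frac{\langle v,u_0\rangle}{1+\frac{|\rho_0|^2}{1-|\rho_0|^2}|\langle v,u_0\rangle|^2},\qquad\tau_1=\tau_0\,\frac{\rho_1\langle u_1,v\rangle}{\rho_0\langle u_0,v\rangle},$$ one has $$\mathfrak h_0(\omega)=B_0\Big(\rho_0u_0+\rho_1v\sum_{k=1}^\infty\omega^kr^{k-1}\Big),\qquad\mathfrak h_1(\omega)=C_1\Big(\tau_0u_1+\tau_1v\sum_{k=1}^\infty\omega^kr^{k-1}\Big),\qquad\mathfrak h_l(\omega)=\frac{C_l}{C_1}\mathfrak h_1(\omega)\quad(l\ge1),$$ where, for $p>0$, $$C_{2^p}=\frac{B}{\overline{C_1}}(1-|\rho_0|^2)r^p,\qquad C_{2^p+1}=\frac{C_1\overline{B_0}}{\overline{C_1}}\,\frac{\tau_1}{\rho_1}(1-|\rho_0|^2)r^{p-1},$$ and the remaining $C_l$ are given by the product rule (P) of the context.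
   Context: Inner products are linear in the first argument. $\partial\mathbb D$ is the unit circle. $H^+_{\mathbb C^2}=H^+(\partial\mathbb D;\mathbb C^2)$ is the Hardy space of functions $\sum_{k\ge0}\omega^kh_k$, $h_k\in\mathbb C^2$, $\sum\|h_k\|^2<\infty$, with $\langle\sum\omega^kf_k,\sum\omega^kg_k\rangle=\sum_k\langle f_k,g_k\rangle$. Every index $i\ge1$ occurs exactly once among the coefficients of the $\mathfrak h_l$, so a family $\{\mathfrak h_l\}$ and the vectors $\{\Psi_i\}_{i\ge1}$ determine each other. $\delta_n=1$ if $n=0$, and $0$ otherwise. For $l\ge1$ write $l=2^p+\sum_{t=0}^{p-1}l_t2^t$ with $l_t\in\{0,1\}$ and $l_p:=1$ (similarly for $l'$, with $p'$); empty sums are $0$. (H): $\langle\omega^m\mathfrak h_{l'},\omega^n\mathfrak h_l\rangle=\delta_{m-n}\beta_{l,l'}$ for all $l,l',m,n\in\mathbb N\cup\{0\}$, where $\beta_{0,0}=B$; $\beta_{l,l'}=0$ if exactly one of $l,l'$ is $0$; for $l\ge1$, $$\beta_{l,l}=B-\sum_{k=-p}^0\big\|\Psi_{2^{p+k}+\sum_{t=0}^{p+k-1}l_t2^t}\big\|^2;$$ and for $l,l'\ge1$, $l\ne l'$, $$\beta_{l,l'}=-\sum_{k=\sup\{-p,-p'\}}^0\delta_{(\sum_{t=0}^{-k}l_{p+k+t}2^t)-(\sum_{t=0}^{-k}l'_{p'+k+t}2^t)}\big\langle\Psi_{2^{p'+k}+\sum_{t=0}^{p'+k-1}l'_t2^t},\Psi_{2^{p+k}+\sum_{t=0}^{p+k-1}l_t2^t}\big\rangle.$$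 (P): for $l\ge2$ not of the form $2^k$ or $2^k+1$, $l=2^p+2^{p_1}+\cdots+2^{p_s}$ with $p>p_1>\cdots>p_s\ge0$, $$C_l=C_1^{-(s-1)}C_{2^{p-p_1}+1}C_{2^{p_1-p_2}+1}\cdots C_{2^{p_{s-2}-p_{s-1}}+1}C_{2^{p_{s-1}}+1}\ \text{ if }p_s=0,$$ $$C_l=C_1^{-s}C_{2^{p-p_1}+1}C_{2^{p_1-p_2}+1}\cdots C_{2^{p_{s-1}-p_s}+1}C_{2^{p_s}}\ \text{ if }p_s>0$$ (with $p_0:=p$). *)

theory Defs
  imports "HOL-Analysis.Analysis" "HOL-Library.Discrete_Functions"
begin

section \<open>The Hardy space on the unit circle\<close>

text \<open>Linear in the first argument. For this inner product
  \<open>cinner x x = of_real ((norm x)\<^sup>2)\<close> with the library norm of \<open>complex ^ 'n\<close>.\<close>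

definition cinner :: "complex ^ 'n \<Rightarrow> complex ^ 'n \<Rightarrow> complex" where
  "cinner x y = (\<Sum>i\<in>UNIV. x $ i * cnj (y $ i))"

lemma cinner_self: "cinner x x = of_real ((norm x)\<^sup>2)"
  unfolding cinner_def norm_vec_def L2_set_def
  by (simp add: sum_nonneg flip: complex_norm_square)

definition orthonormal_basis2 :: "complex ^ 2 \<Rightarrow> complex ^ 2 \<Rightarrow> bool" where
  "orthonormal_basis2 u v \<longleftrightarrow>
     norm u = 1 \<and> norm v = 1 \<and> cinner u v = 0 \<and> vec.span {u, v} = UNIV"

text \<open>Normalised arc length. Its space is the unit circle, so values of functions off the
  circle are irrelevant for measurability and for almost-everywhere statements.\<close>

definition circle :: "complex measure" where
  "circle = distr (uniform_measure lborel {0..2 * pi}) (restrict_space borel (sphere 0 1)) cis"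

text \<open>\<open>hardy_series f c\<close> says that \<open>f(\<omega>) = (\<Sum>k\<ge>0. \<omega>^k c\<^sub>k)\<close> with square-summable
  coefficients, the series converging to \<open>f\<close> in \<open>L\<^sup>2\<close> of the circle. As usual, functions on the
  circle are identified when they agree almost everywhere; this identification is made
  explicit below by \<open>AE \<omega> in circle\<close>.\<close>

definition hardy_series :: "(complex \<Rightarrow> complex ^ 2) \<Rightarrow> (nat \<Rightarrow> complex ^ 2) \<Rightarrow> bool" where
  "hardy_series f c \<longleftrightarrow>
     f \<in> borel_measurable circle \<and>
     summable (\<lambda>k. (norm (c k))\<^sup>2) \<and>
     (\<lambda>n. \<integral>\<^sup>+ \<omega>. ennreal ((norm (f \<omega> - (\<Sum>k<n. \<omega> ^ k *s c k)))\<^sup>2) \<partial>circle) \<longlonglongrightarrow> 0"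

definition hardy_space :: "(complex \<Rightarrow> complex ^ 2) set" where
  "hardy_space = {f. \<exists>c. hardy_series f c}"

text \<open>The coefficients are unique, see \<open>hardy_series_unique\<close>.\<close>

definition hardy_coeff :: "(complex \<Rightarrow> complex ^ 2) \<Rightarrow> nat \<Rightarrow> complex ^ 2" where
  "hardy_coeff f = (THE c. hardy_series f c)"

definition hardy_inner :: "(complex \<Rightarrow> complex ^ 2) \<Rightarrow> (complex \<Rightarrow> complex ^ 2) \<Rightarrow> complex" where
  "hardy_inner f g = (\<Sum>k. cinner (hardy_coeff f k) (hardy_coeff g k))"

lemma circle_cis_measurable:
  "cis \<in> uniform_measure lborel {0..2 * pi} \<rightarrow>\<^sub>M restrict_space borel (sphere 0 1)"
proof -
  have "cis \<in> borel_measurable borel"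
    by (intro borel_measurable_continuous_onI continuous_intros)
  then show ?thesis
    by (intro measurable_restrict_space2) (auto simp: measurable_def)
qed

lemma space_circle: "space circle = sphere 0 1"
  by (simp add: circle_def space_restrict_space)

lemma borel_measurable_circleI: "f \<in> borel_measurable borel \<Longrightarrow> f \<in> borel_measurable circle"
  unfolding circle_def by (simp add: measurable_restrict_space1)

lemma emeasure_circle_space: "emeasure circle (space circle) = 1"
proof -
  have cis: "cis -` sphere 0 1 = (UNIV :: real set)"
    by auto
  have "sphere 0 1 \<in> sets (restrict_space borel (sphere (0::complex) 1))"
    by (simp add: sets_restrict_space_iff)
  then have "emeasure circle (space circle) = emeasure (uniform_measure lborel {0..2 * pi}) UNIV"
    unfolding space_circle unfolding circle_def
    by (subst emeasure_distr[OF circle_cis_measurable]) (simp_all add: cis)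
  also have "\<dots> = 1"
    by (subst emeasure_uniform_measure) (auto intro!: ennreal_divide_self)
  finally show ?thesis .
qed

lemma integral_circle:
  fixes f :: "complex \<Rightarrow> complex"
  assumes "f \<in> borel_measurable borel"
  shows "(LINT \<omega>|circle. f \<omega>) = (LBINT x:{0..2*pi}. f (cis x)) / (2 * pi)"
proof -
  have cis: "cis \<in> borel_measurable borel"
    by (intro borel_measurable_continuous_onI continuous_intros)
  have dens: "uniform_measure lborel {0..2 * pi}
      = density lborel (\<lambda>x. ennreal (indicator {0..2*pi} x / (2*pi)))"
    unfolding uniform_measure_def
    by (intro arg_cong2[where f=density] ext)
       (auto simp: indicator_def divide_ennreal[symmetric])
  have "(LINT \<omega>|circle. f \<omega>) = (LINT x|uniform_measure lborel {0..2 * pi}. f (cis x))"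
    unfolding circle_def
    by (rule integral_distr[OF circle_cis_measurable measurable_restrict_space1[OF assms]])
  also have "\<dots> = (LBINT x. (indicator {0..2*pi} x / (2*pi)) *\<^sub>R f (cis x))"
    unfolding dens using measurable_compose[OF cis assms]
    by (subst integral_density) auto
  also have "\<dots> = (LBINT x. (indicator {0..2*pi} x *\<^sub>R f (cis x)) / (2 * pi))"
    by (intro Bochner_Integration.integral_cong) (auto simp: scaleR_conv_of_real)
  finally show ?thesis
    by (simp add: set_lebesgue_integral_def)
qed

lemma circle_orthogonal:
  "(LINT \<omega>|circle. cnj \<omega> ^ j * \<omega> ^ k) = (if j = k then 1 else 0)"
proof -
  define m where "m = int k - int j"
  have pow: "cnj (cis x) ^ j * cis x ^ k = cis (of_int m * x)" for x
  proof -
    have "cnj (cis x) ^ j * cis x ^ k = cis (real j * (- x)) * cis (real k * x)"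
      by (simp only: cis_cnj Complex.DeMoivre)
    then show ?thesis
      by (simp add: m_def cis_mult algebra_simps)
  qed
  have "(LINT \<omega>|circle. cnj \<omega> ^ j * \<omega> ^ k) = (LBINT x:{0..2*pi}. cis (of_int m * x)) / (2 * pi)"
    by (subst integral_circle)
       (auto simp: pow intro!: borel_measurable_continuous_onI continuous_intros)
  moreover have "(LBINT x:{0..2*pi}. cis (of_int m * x)) = 0" if "m \<noteq> 0"
  proof -
    define F where "F x = cis (of_int m * x) / (\<i> * of_int m)" for x :: real
    have der: "(F has_vector_derivative cis (of_int m * x)) (at x within {0..2*pi})" for x
      unfolding F_def using that
      by (auto intro!: derivative_eq_intros simp: has_vector_derivative_def scaleR_conv_of_real fun_eq_iff field_simps)
    have "(LBINT x:{0..2*pi}. cis (of_int m * x)) = F (2*pi) - F 0"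
      unfolding set_lebesgue_integral_def
      by (rule integral_FTC_Icc) (auto intro!: der continuous_intros)
    also have "cis (of_int m * (2 * pi)) = 1"
      by (metis cis_multiple_2pi Ints_of_int mult.commute)
    then have "F (2*pi) - F 0 = 0"
      by (simp add: F_def)
    finally show ?thesis .
  qed
  moreover have "(LBINT x:{0..2*pi}. cis (of_int m * x)) = 2 * pi" if "m = 0"
    using that by (simp add: set_lebesgue_integral_def scaleR_conv_of_real)
  ultimately show ?thesis
    by (auto simp: m_def)
qed

lemma hardy_series_unique:
  assumes c: "hardy_series f c" and d: "hardy_series f d"
  shows "c = d"
proof -
  define g where "g n \<omega> = (\<Sum>k<n. \<omega> ^ k *s (c k - d k))" for n \<omega>
  define I where "I a n = (\<integral>\<^sup>+ \<omega>. ennreal ((norm (f \<omega> - (\<Sum>k<n. \<omega> ^ k *s a k)))\<^sup>2) \<partial>circle)" for a n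
  have f: "f \<in> borel_measurable circle"
    using c by (simp add: hardy_series_def)
  have vec: "(\<lambda>\<omega>. \<omega> ^ k *s a) \<in> borel_measurable borel" for k and a :: "complex^2"
    unfolding vector_scalar_mult_def
    by (intro borel_measurable_continuous_onI continuous_intros)
  have part: "(\<lambda>\<omega>. \<Sum>k<n. \<omega> ^ k *s a k) \<in> borel_measurable circle" for n and a :: "nat \<Rightarrow> complex^2"
    by (intro borel_measurable_circleI borel_measurable_sum vec)
  have g_le: "(\<integral>\<^sup>+ \<omega>. ennreal ((norm (g n \<omega>))\<^sup>2) \<partial>circle) \<le> 2 * I c n + 2 * I d n" for n
  proof -
    have "(norm (g n \<omega>))\<^sup>2 \<le> 2 * (norm (f \<omega> - (\<Sum>k<n. \<omega> ^ k *s c k)))\<^sup>2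
                         + 2 * (norm (f \<omega> - (\<Sum>k<n. \<omega> ^ k *s d k)))\<^sup>2" for \<omega>
    proof -
      let ?x = "f \<omega> - (\<Sum>k<n. \<omega> ^ k *s c k)" and ?y = "f \<omega> - (\<Sum>k<n. \<omega> ^ k *s d k)"
      have "g n \<omega> = ?y - ?x"
        by (simp add: g_def vec.scale_right_diff_distrib sum_subtractf)
      then have "norm (g n \<omega>) \<le> norm ?x + norm ?y"
        using norm_triangle_ineq4[of ?y ?x] by (simp only: add.commute)
      then have "(norm (g n \<omega>))\<^sup>2 \<le> (norm ?x + norm ?y)\<^sup>2"
        by (intro power_mono) auto
      also have "\<dots> \<le> 2 * (norm ?x)\<^sup>2 + 2 * (norm ?y)\<^sup>2"
        using sum_squares_bound[of "norm ?x" "norm ?y"] by (simp add: power2_sum)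
      finally show ?thesis .
    qed
    then have "ennreal ((norm (g n \<omega>))\<^sup>2)
        \<le> 2 * ennreal ((norm (f \<omega> - (\<Sum>k<n. \<omega> ^ k *s c k)))\<^sup>2)
           + 2 * ennreal ((norm (f \<omega> - (\<Sum>k<n. \<omega> ^ k *s d k)))\<^sup>2)" for \<omega>
      by (subst (1 2) ennreal_numeral[symmetric], subst (1 2) ennreal_mult[symmetric])
         (simp_all only: ennreal_plus[symmetric] ennreal_leI zero_le_numeral zero_le_power2 mult_nonneg_nonneg)
    then have "(\<integral>\<^sup>+ \<omega>. ennreal ((norm (g n \<omega>))\<^sup>2) \<partial>circle)
        \<le> (\<integral>\<^sup>+ \<omega>. 2 * ennreal ((norm (f \<omega> - (\<Sum>k<n. \<omega> ^ k *s c k)))\<^sup>2)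
                 + 2 * ennreal ((norm (f \<omega> - (\<Sum>k<n. \<omega> ^ k *s d k)))\<^sup>2) \<partial>circle)"
      by (rule nn_integral_mono)
    also have "\<dots> = 2 * I c n + 2 * I d n"
      unfolding I_def using f part[of c n] part[of d n]
      by (simp add: nn_integral_add nn_integral_cmult)
    finally show ?thesis .
  qed
  have "(\<lambda>n. 2 * I c n + 2 * I d n) \<longlonglongrightarrow> 2 * 0 + 2 * 0"
    using c d unfolding I_def hardy_series_def
    by (intro tendsto_add ennreal_tendsto_cmult) auto
  then have lim: "(\<lambda>n. 2 * I c n + 2 * I d n) \<longlonglongrightarrow> 0"
    by simp
  have "(c j - d j) $ i = 0" for i j
  proof -
    have "(ennreal (cmod ((c j - d j) $ i)))\<^sup>2 \<le> 2 * I c n + 2 * I d n" if "n > j" for n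
    proof -
      have int: "integrable circle (\<lambda>\<omega>. cnj \<omega> ^ j * \<omega> ^ k)" for k
      proof (rule Bochner_Integration.integrable_bound)
        show "integrable circle (\<lambda>_. 1 :: real)"
          by (intro finite_measure.integrable_const finite_measureI)
             (simp add: emeasure_circle_space)
      qed (auto simp: space_circle norm_mult norm_power intro!: AE_I2 borel_measurable_circleI
            borel_measurable_continuous_onI continuous_intros)
      have gm: "g n \<in> borel_measurable circle"
        unfolding g_def by (rule part)
      have "(LINT \<omega>|circle. cnj \<omega> ^ j * g n \<omega> $ i)
          = (LINT \<omega>|circle. (\<Sum>k<n. (c k - d k) $ i * (cnj \<omega> ^ j * \<omega> ^ k)))"
        by (simp add: g_def sum_distrib_left algebra_simps)
      also have "\<dots> = (\<Sum>k<n. (c k - d k) $ i * (LINT \<omega>|circle. cnj \<omega> ^ j * \<omega> ^ k))"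
        using int by (subst Bochner_Integration.integral_sum) auto
      also have "\<dots> = (c j - d j) $ i"
        using that unfolding circle_orthogonal by (simp add: if_distrib sum.delta cong: if_cong)
      finally have eq: "(c j - d j) $ i = (LINT \<omega>|circle. cnj \<omega> ^ j * g n \<omega> $ i)" ..
      have "ennreal (cmod ((c j - d j) $ i)) \<le> (\<integral>\<^sup>+ \<omega>. ennreal (norm (cnj \<omega> ^ j * g n \<omega> $ i)) \<partial>circle)"
        unfolding eq
        using integral_norm_bound_ennreal[of circle "\<lambda>\<omega>. cnj \<omega> ^ j * g n \<omega> $ i"]
        by (cases "integrable circle (\<lambda>\<omega>. cnj \<omega> ^ j * g n \<omega> $ i)")
           (auto simp: not_integrable_integral_eq)
      also have "\<dots> \<le> (\<integral>\<^sup>+ \<omega>. ennreal (norm (g n \<omega>)) * 1 \<partial>circle)"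
        by (intro nn_integral_mono)
           (auto simp: norm_mult norm_power space_circle intro!: ennreal_leI Finite_Cartesian_Product.norm_nth_le)
      finally have "(ennreal (cmod ((c j - d j) $ i)))\<^sup>2 \<le> (\<integral>\<^sup>+ \<omega>. ennreal (norm (g n \<omega>)) * 1 \<partial>circle)\<^sup>2"
        by (intro power_mono) auto
      also have "\<dots> \<le> (\<integral>\<^sup>+ \<omega>. (ennreal (norm (g n \<omega>)))\<^sup>2 \<partial>circle) * (\<integral>\<^sup>+ \<omega>. 1\<^sup>2 \<partial>circle)"
        using gm by (intro Cauchy_Schwarz_nn_integral) auto
      also have "\<dots> = (\<integral>\<^sup>+ \<omega>. ennreal ((norm (g n \<omega>))\<^sup>2) \<partial>circle)"
        by (simp add: emeasure_circle_space ennreal_power)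
      finally show ?thesis
        using g_le[of n] by (rule order_trans)
    qed
    then have "(ennreal (cmod ((c j - d j) $ i)))\<^sup>2 \<le> 0"
      by (intro LIMSEQ_le_const[OF lim] exI[of _ "Suc j"]) auto
    then show ?thesis
      by (simp add: ennreal_power ennreal_eq_0_iff)
  qed
  then show ?thesis
    by (auto simp: fun_eq_iff vec_eq_iff)
qed

lemma hardy_coeff_eq: "hardy_series f c \<Longrightarrow> hardy_coeff f = c"
  unfolding hardy_coeff_def by (blast intro: hardy_series_unique)

section \<open>The orthogonality conditions\<close>

definition delta :: "int \<Rightarrow> complex" where
  "delta n = (if n = 0 then 1 else 0)"

text \<open>For \<open>l \<ge> 1\<close> the top binary position \<open>p\<close> of \<open>l\<close> is \<open>floor_log l\<close>, and \<open>digit l p = 1\<close>.\<close>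

definition digit :: "nat \<Rightarrow> nat \<Rightarrow> nat" where
  "digit l t = of_bool (bit l t)"

text \<open>The summation index \<open>k \<in> {-p..0}\<close> of the conditions is written \<open>k = - j\<close> with
  \<open>j \<in> {0..p}\<close>; correspondingly \<open>k\<close> from \<open>sup {-p, -p'}\<close> to \<open>0\<close> becomes \<open>j \<le> min p p'\<close>.
  \<open>psi_index l j\<close> is \<open>2^(p+k) + (\<Sum>t=0..p+k-1. l\<^sub>t 2^t)\<close> and
  \<open>leading l j\<close> is \<open>(\<Sum>t=0..-k. l\<^bsub>p+k+t\<^esub> 2^t)\<close>.\<close>

definition psi_index :: "nat \<Rightarrow> nat \<Rightarrow> nat" where
  "psi_index l j = 2 ^ (floor_log l - j) + (\<Sum>t<floor_log l - j. digit l t * 2 ^ t)"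

definition leading :: "nat \<Rightarrow> nat \<Rightarrow> nat" where
  "leading l j = (\<Sum>t\<le>j. digit l (floor_log l - j + t) * 2 ^ t)"

definition beta :: "real \<Rightarrow> (nat \<Rightarrow> complex ^ 2) \<Rightarrow> nat \<Rightarrow> nat \<Rightarrow> complex" where
  "beta B \<Psi> l l' =
    (if l = 0 \<and> l' = 0 then of_real B
     else if l = 0 \<or> l' = 0 then 0
     else if l = l' then of_real (B - (\<Sum>j\<le>floor_log l. (norm (\<Psi> (psi_index l j)))\<^sup>2))
     else - (\<Sum>j\<le>min (floor_log l) (floor_log l').
               delta (int (leading l j) - int (leading l' j))
               * cinner (\<Psi> (psi_index l' j)) (\<Psi> (psi_index l j))))"

definition orthogonality_conditions ::
  "real \<Rightarrow> (nat \<Rightarrow> complex \<Rightarrow> complex ^ 2) \<Rightarrow> (nat \<Rightarrow> complex ^ 2) \<Rightarrow> bool" where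
  "orthogonality_conditions B \<hh> \<Psi> \<longleftrightarrow>
     (\<forall>l l' m n. hardy_inner (\<lambda>\<omega>. \<omega> ^ m *s \<hh> l' \<omega>) (\<lambda>\<omega>. \<omega> ^ n *s \<hh> l \<omega>)
                 = delta (int m - int n) * beta B \<Psi> l l')"


section \<open>The five types\<close>

definition type1 ::
  "real \<Rightarrow> (nat \<Rightarrow> complex \<Rightarrow> complex ^ 2) \<Rightarrow> (nat \<Rightarrow> complex ^ 2) \<Rightarrow> bool" where
  "type1 B \<hh> \<Psi> \<longleftrightarrow>
    (\<exists>u0 B0. norm u0 = 1 \<and> (cmod B0)\<^sup>2 = B \<and>
       (AE \<omega> in circle. \<hh> 0 \<omega> = \<Psi> 1 \<and> \<Psi> 1 = B0 *s u0) \<and>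
       (\<forall>l\<ge>1. AE \<omega> in circle. \<hh> l \<omega> = 0))"

definition type2 ::
  "real \<Rightarrow> (nat \<Rightarrow> complex \<Rightarrow> complex ^ 2) \<Rightarrow> (nat \<Rightarrow> complex ^ 2) \<Rightarrow> bool" where
  "type2 B \<hh> \<Psi> \<longleftrightarrow>
    (\<exists>u0 u1 B0 C1. orthonormal_basis2 u0 u1 \<and> (cmod B0)\<^sup>2 = B \<and> (cmod C1)\<^sup>2 = B \<and>
       (AE \<omega> in circle. \<hh> 0 \<omega> = \<omega> *s \<Psi> 2 \<and> \<omega> *s \<Psi> 2 = \<omega> *s (B0 *s u0)) \<and>
       (AE \<omega> in circle. \<hh> 1 \<omega> = \<Psi> 3 \<and> \<Psi> 3 = C1 *s u1) \<and>
       (\<forall>l\<ge>2. AE \<omega> in circle. \<hh> l \<omega> = 0))"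

definition type3 ::
  "real \<Rightarrow> (nat \<Rightarrow> complex \<Rightarrow> complex ^ 2) \<Rightarrow> (nat \<Rightarrow> complex ^ 2) \<Rightarrow> bool" where
  "type3 B \<hh> \<Psi> \<longleftrightarrow>
    (\<exists>u0 u1 (\<rho>::real) B0 C1 (\<theta>::real).
       orthonormal_basis2 u0 u1 \<and> 0 < \<rho> \<and> \<rho> < 1 \<and>
       (cmod B0)\<^sup>2 = B \<and> (cmod C1)\<^sup>2 = B * (1 - \<rho>\<^sup>2) \<and>
       (AE \<omega> in circle. \<hh> 0 \<omega> = \<Psi> 1 + \<omega> *s \<Psi> 2 \<and>
          \<Psi> 1 + \<omega> *s \<Psi> 2
            = B0 *s (of_real \<rho> *s u0 + (\<omega> * of_real (sqrt (1 - \<rho>\<^sup>2))) *s u1)) \<and>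
       (AE \<omega> in circle. \<hh> 1 \<omega> = \<Psi> 3 + \<omega> *s \<Psi> 5 \<and>
          \<Psi> 3 + \<omega> *s \<Psi> 5
            = (C1 * cis \<theta>) *s (of_real (sqrt (1 - \<rho>\<^sup>2)) *s u0 - (\<omega> * of_real \<rho>) *s u1)) \<and>
       (\<forall>p>1. AE \<omega> in circle.
          \<hh> (2 ^ p - 1) \<omega> = \<Psi> (2 ^ p + 2 ^ p - 1) + \<omega> *s \<Psi> (2 ^ (p + 1) + 2 ^ p - 1) \<and>
          \<Psi> (2 ^ p + 2 ^ p - 1) + \<omega> *s \<Psi> (2 ^ (p + 1) + 2 ^ p - 1)
            = ((- (cnj B0 * of_real \<rho> * of_real (sqrt (1 - \<rho>\<^sup>2)) * cis \<theta> / cnj C1)) ^ (p - 1)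
                 * C1 * cis \<theta>)
              *s (of_real (sqrt (1 - \<rho>\<^sup>2)) *s u0 - (\<omega> * of_real \<rho>) *s u1)) \<and>
       (\<forall>l. l \<noteq> 0 \<and> l \<noteq> 1 \<and> (\<forall>p>1. l \<noteq> 2 ^ p - 1) \<longrightarrow> (AE \<omega> in circle. \<hh> l \<omega> = 0)))"

text \<open>In types 4 and 5 a series over \<open>k \<ge> 1\<close> is written as a series over \<open>k \<ge> 0\<close>
  with \<open>k\<close> shifted by one. Its ratio has modulus less than 1 in both types.\<close>

definition type4 ::
  "real \<Rightarrow> (nat \<Rightarrow> complex \<Rightarrow> complex ^ 2) \<Rightarrow> (nat \<Rightarrow> complex ^ 2) \<Rightarrow> bool" where
  "type4 B \<hh> \<Psi> \<longleftrightarrow>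
    (\<exists>u0 u1 (\<rho>::real) B0 C1 (\<theta>::real).
       orthonormal_basis2 u0 u1 \<and> 0 < \<rho> \<and> \<rho> < 1 \<and>
       (cmod B0)\<^sup>2 = B \<and> (cmod C1)\<^sup>2 = B * (1 - \<rho>\<^sup>2) \<and>
       hardy_series (\<hh> 0) (\<lambda>k. \<Psi> (2 ^ k)) \<and>
       (AE \<omega> in circle. \<hh> 0 \<omega>
          = (B0 * (1 + of_real ((1 - \<rho>\<^sup>2) / \<rho>) * cis \<theta>
                        * (\<Sum>k. \<omega> ^ (k + 1) * (- of_real \<rho> * cis \<theta>) ^ k)) * of_real \<rho>) *s u0) \<and>
       (AE \<omega> in circle. \<hh> 1 \<omega> = \<Psi> 3 \<and> \<Psi> 3 = C1 *s u1) \<and>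
       (\<forall>p>0. AE \<omega> in circle.
          \<hh> (2 ^ p) \<omega> = \<Psi> (2 ^ (p + 1) + 2 ^ p) \<and>
          \<Psi> (2 ^ (p + 1) + 2 ^ p)
            = (of_real B / cnj C1 * (- of_real \<rho> * cis \<theta>) ^ p * of_real (1 - \<rho>\<^sup>2)) *s u1) \<and>
       (\<forall>l. l \<noteq> 0 \<and> l \<noteq> 1 \<and> (\<forall>p>0. l \<noteq> 2 ^ p) \<longrightarrow> (AE \<omega> in circle. \<hh> l \<omega> = 0)))"

text \<open>Here \<open>l = 2^(q 0) + 2^(q 1) + \<dots> + 2^(q s)\<close> with \<open>p = q 0 > q 1 > \<dots> > q s\<close>.
  If \<open>s = 1\<close> and \<open>q s = 0\<close>, then \<open>l\<close> has the form \<open>2^k + 1\<close>.\<close>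

definition product_rule :: "(nat \<Rightarrow> complex) \<Rightarrow> bool" where
  "product_rule C \<longleftrightarrow>
    (\<forall>l (s::nat) (q :: nat \<Rightarrow> nat).
       l \<ge> 2 \<and> (\<forall>k. l \<noteq> 2 ^ k \<and> l \<noteq> 2 ^ k + 1) \<and>
       (\<forall>i<s. q (i + 1) < q i) \<and> l = (\<Sum>i\<le>s. 2 ^ q i) \<longrightarrow>
       (q s = 0 \<longrightarrow>
          C l = C 1 powi (- (int s - 1))
                * (\<Prod>i=1..s-1. C (2 ^ (q (i - 1) - q i) + 1)) * C (2 ^ q (s - 1) + 1)) \<and>
       (q s > 0 \<longrightarrow>
          C l = C 1 powi (- int s)
                * (\<Prod>i=1..s. C (2 ^ (q (i - 1) - q i) + 1)) * C (2 ^ q s)))"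

definition type5 ::
  "real \<Rightarrow> (nat \<Rightarrow> complex \<Rightarrow> complex ^ 2) \<Rightarrow> bool" where
  "type5 B \<hh> \<longleftrightarrow>
    (\<exists>(\<rho>0::complex) u0 u1 v \<rho>1 \<tau>0 B0 C1 r \<tau>1 (C :: nat \<Rightarrow> complex) (\<kappa>::real).
       0 < cmod \<rho>0 \<and> cmod \<rho>0 < 1 \<and>
       norm u0 = 1 \<and> norm u1 = 1 \<and> norm v = 1 \<and>
       cinner v u0 \<noteq> 0 \<and> cinner u1 u0 \<noteq> 0 \<and>
       \<kappa> = (cmod \<rho>0)\<^sup>2 / (1 - (cmod \<rho>0)\<^sup>2) \<and>
       of_real \<kappa> * cinner u0 u1 * cinner v u0 + cinner v u1 = 0 \<and>
       (cmod \<rho>1)\<^sup>2 = (1 - (cmod \<rho>0)\<^sup>2) / (1 + \<kappa> * (cmod (cinner v u0))\<^sup>2) \<and>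
       (cmod \<tau>0)\<^sup>2 = 1 / (1 + \<kappa> * (cmod (cinner u1 u0))\<^sup>2) \<and>
       (cmod B0)\<^sup>2 = B \<and> (cmod C1)\<^sup>2 = B * (1 - (cmod \<rho>0)\<^sup>2) \<and>
       r = - (cnj \<rho>0 / cnj \<rho>1)
             * (cinner v u0 / of_real (1 + \<kappa> * (cmod (cinner v u0))\<^sup>2)) \<and>
       \<tau>1 = \<tau>0 * (\<rho>1 * cinner u1 v / (\<rho>0 * cinner u0 v)) \<and>
       C 1 = C1 \<and>
       (\<forall>p>0. C (2 ^ p) = of_real B / cnj C1 * of_real (1 - (cmod \<rho>0)\<^sup>2) * r ^ p) \<and>
       (\<forall>p>0. C (2 ^ p + 1)
          = C1 * cnj B0 / cnj C1 * (\<tau>1 / \<rho>1) * of_real (1 - (cmod \<rho>0)\<^sup>2) * r ^ (p - 1)) \<and>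
       product_rule C \<and>
       (AE \<omega> in circle. \<hh> 0 \<omega>
          = B0 *s (\<rho>0 *s u0 + (\<rho>1 * (\<Sum>k. \<omega> ^ (k + 1) * r ^ k)) *s v)) \<and>
       (AE \<omega> in circle. \<hh> 1 \<omega>
          = C1 *s (\<tau>0 *s u1 + (\<tau>1 * (\<Sum>k. \<omega> ^ (k + 1) * r ^ k)) *s v)) \<and>
       (\<forall>l\<ge>1. AE \<omega> in circle. \<hh> l \<omega> = (C l / C1) *s \<hh> 1 \<omega>))"

end

theory Submission
  imports Defs
begin

text \<open>Write an index in binary, drop the leading 1 and regard the remaining digits as a word;
  \<open>P y\<close> denotes the vector \<open>\<Psi>\<close> at the index \<open>1y\<close>. Then \<open>\<hh> 0\<close> has the coefficients \<open>P (0^k)\<close>, and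
  \<open>\<hh> l\<close> with \<open>l = 1y\<close> has the coefficients \<open>P (0^k 1 y)\<close>. In these terms the constant \<open>\<beta>\<close> of the
  orthogonality conditions is a kernel \<open>K y y'\<close> on words with a recursion in the first letter
  (\<open>beta_word_num\<close>): \<open>K (e z) (e z') = K z z' - \<langle>P (e z'), P (e z)\<rangle>\<close>, while for distinct words
  without a common first letter only the inner product \<open>- \<langle>P y', P y\<rangle>\<close> survives.

  Suppose the conditions hold and let \<open>D = B - \<parallel>P []\<parallel>\<^sup>2\<close>, which is the squared norm of \<open>\<hh> 1\<close>. If
  \<open>D = 0\<close>, every \<open>\<hh> l\<close> with \<open>l \<ge> 1\<close> vanishes, which is type 1. Let \<open>D > 0\<close>. The conditions make
  \<open>\<hh> 0\<close>, \<open>\<hh> 1\<close> and the part of \<open>\<hh> l\<close> orthogonal to \<open>\<hh> 1\<close> generate mutually orthogonal copies of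
  a scalar Hardy space, and functions with values in \<open>\<complex>\<^sup>2\<close> leave room for two such copies only
  (\<open>card_wandering_le\<close>, a trace count). Hence \<open>\<hh> l = \<gamma> y \<hh> 1\<close> with scalars \<open>\<gamma> y\<close>
  (\<open>fiber_proportional\<close>), and \<open>K y y' = D \<gamma>(y') cnj (\<gamma> y)\<close>.

  The vectors \<open>V y = (sqrt D \<gamma> y, P y)\<close> of \<open>\<complex>\<^sup>3\<close> therefore satisfy
  \<open>\<langle>V (e z'), V (e z)\<rangle> = D \<gamma>(z') cnj (\<gamma> z)\<close> for each letter \<open>e\<close>. This Gram matrix has rank one,
  so \<open>V (e z) = \<gamma> z V [e]\<close>: the scalar \<open>\<gamma>\<close> is multiplicative in the letters, and all data are
  determined by the three vectors \<open>V [] = (sqrt D, a)\<close>, \<open>V [0] = (sqrt D r, b)\<close> and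
  \<open>V [1] = (sqrt D s, c)\<close>. What remains of the conditions is that these three vectors are
  orthogonal with squared norms \<open>B\<close>, \<open>D\<close>, \<open>D\<close>. Conversely, such a frame of \<open>\<complex>\<^sup>3\<close> gives geometric
  coefficient sequences, whose inner products can be summed in closed form
  (\<open>word_orth_iff_frame\<close>).

  The types are the normal forms of the frames: type 1 is \<open>D = 0\<close>, type 2 is \<open>a = 0\<close>, type 3 is
  \<open>r = 0\<close>, type 4 is \<open>s = 0\<close>, and type 5 is the case where \<open>r\<close> and \<open>s\<close> are both nonzero. The
  parameters of a type are obtained by normalising \<open>a\<close>, \<open>b\<close> and \<open>c\<close> to unit vectors; the product
  rule of type 5 says that \<open>\<gamma>\<close> is multiplicative, read off at the gaps between binary digits 1.\<close>

section \<open>Square-summable sequences and their shifts\<close>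

lemma cinner_add_left: "cinner (x + y) z = cinner x z + cinner y z"
  by (simp add: cinner_def sum.distrib algebra_simps)

lemma cinner_diff_left: "cinner (x - y) z = cinner x z - cinner y z"
  by (simp add: cinner_def sum_subtractf algebra_simps)

lemma cinner_diff_right: "cinner z (x - y) = cinner z x - cinner z y"
  by (simp add: cinner_def sum_subtractf algebra_simps)

lemma cinner_scale_left: "cinner (a *s x) y = a * cinner x y"
  by (simp add: cinner_def sum_distrib_left algebra_simps)

lemma cinner_scale_right: "cinner x (a *s y) = cnj a * cinner x y"
  by (simp add: cinner_def sum_distrib_left algebra_simps)

lemma cinner_0_left [simp]: "cinner 0 y = 0"
  and cinner_0_right [simp]: "cinner y 0 = 0"
  by (simp_all add: cinner_def)

lemma cinner_commute: "cinner y x = cnj (cinner x y)"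
  by (simp add: cinner_def mult.commute)

lemma cinner_sum_left: "cinner (\<Sum>t\<in>T. f t) y = (\<Sum>t\<in>T. cinner (f t) y)"
  by (induction T rule: infinite_finite_induct) (auto simp: cinner_add_left)

lemma cinner_sum_right: "cinner y (\<Sum>t\<in>T. f t) = (\<Sum>t\<in>T. cinner y (f t))"
  by (subst (1 2) cinner_commute) (simp add: cinner_sum_left)

lemma cinner_self_eq_0: "cinner x x = 0 \<longleftrightarrow> x = 0"
  by (simp add: cinner_self)

lemma norm_square_vec: "(norm x)\<^sup>2 = (\<Sum>i\<in>UNIV. (cmod (x $ i))\<^sup>2)"
  for x :: "complex ^ 'n"
  by (simp add: norm_vec_def L2_set_def sum_nonneg)

lemma norm_scale: "norm (a *s x) = cmod a * norm x" for x :: "complex ^ 'n"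
proof -
  have "(norm (a *s x))\<^sup>2 = (cmod a * norm x)\<^sup>2"
    by (simp add: norm_square_vec norm_mult power_mult_distrib sum_distrib_left)
  then show ?thesis
    by (rule power2_eq_imp_eq) auto
qed

lemma cmod_cinner_le: "cmod (cinner x y) \<le> (norm x)\<^sup>2 + (norm y)\<^sup>2"
proof -
  have "cmod (x $ i * cnj (y $ i)) \<le> (cmod (x $ i))\<^sup>2 + (cmod (y $ i))\<^sup>2" for i
    using sum_squares_bound[of "cmod (x $ i)" "cmod (y $ i)"]
      mult_nonneg_nonneg[OF norm_ge_zero norm_ge_zero, of "x $ i" "y $ i"]
    unfolding norm_mult complex_mod_cnj by linarith
  then show ?thesis
    unfolding cinner_def norm_square_vec sum.distrib[symmetric]
    by (intro order_trans[OF norm_sum] sum_mono)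
qed

definition square_summable :: "(nat \<Rightarrow> complex ^ 'n) \<Rightarrow> bool" where
  "square_summable f \<longleftrightarrow> summable (\<lambda>k. (norm (f k))\<^sup>2)"

definition seq_inner :: "(nat \<Rightarrow> complex ^ 'n) \<Rightarrow> (nat \<Rightarrow> complex ^ 'n) \<Rightarrow> complex" where
  "seq_inner f g = (\<Sum>k. cinner (f k) (g k))"

definition shift :: "nat \<Rightarrow> (nat \<Rightarrow> complex ^ 'n) \<Rightarrow> nat \<Rightarrow> complex ^ 'n" where
  "shift m f k = (if k < m then 0 else f (k - m))"

lemma seq_inner_sums:
  assumes "square_summable f" "square_summable g"
  shows "(\<lambda>k. cinner (f k) (g k)) sums seq_inner f g"
  unfolding seq_inner_def
proof (rule summable_sums, rule summable_comparison_test')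
  show "summable (\<lambda>k. (norm (f k))\<^sup>2 + (norm (g k))\<^sup>2)"
    using assms by (intro summable_add) (auto simp: square_summable_def)
qed (auto intro: cmod_cinner_le)

lemma seq_inner_commute:
  assumes "square_summable f" "square_summable g"
  shows "seq_inner g f = cnj (seq_inner f g)"
proof (rule sums_unique2[OF seq_inner_sums])
  show "(\<lambda>k. cinner (g k) (f k)) sums cnj (seq_inner f g)"
    using seq_inner_sums[OF assms] by (subst cinner_commute) (simp add: sums_cnj)
qed (use assms in auto)

lemma square_summable_scale: "square_summable f \<Longrightarrow> square_summable (\<lambda>k. a *s f k)"
  by (simp add: square_summable_def norm_scale power_mult_distrib summable_mult)

lemma square_summable_diff:
  assumes "square_summable f" "square_summable g"
  shows "square_summable (\<lambda>k. f k - g k)"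
  unfolding square_summable_def
proof (rule summable_comparison_test')
  show "summable (\<lambda>k. 2 * (norm (f k))\<^sup>2 + 2 * (norm (g k))\<^sup>2)"
    using assms by (intro summable_add summable_mult) (auto simp: square_summable_def)
  fix k
  have "(norm (f k - g k))\<^sup>2 \<le> (norm (f k) + norm (g k))\<^sup>2"
    by (intro power_mono norm_triangle_ineq4) auto
  also have "\<dots> \<le> 2 * (norm (f k))\<^sup>2 + 2 * (norm (g k))\<^sup>2"
    using sum_squares_bound[of "norm (f k)" "norm (g k)"] by (simp add: power2_sum)
  finally show "norm ((norm (f k - g k))\<^sup>2) \<le> 2 * (norm (f k))\<^sup>2 + 2 * (norm (g k))\<^sup>2"
    by simp
qed

lemma square_summable_shift: "square_summable f \<Longrightarrow> square_summable (shift m f)"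
proof -
  assume "square_summable f"
  then have "summable (\<lambda>k. (norm (shift m f (k + m)))\<^sup>2)"
    by (simp add: square_summable_def shift_def)
  then show ?thesis
    unfolding square_summable_def by (simp only: summable_iff_shift[of "\<lambda>k. (norm (shift m f k))\<^sup>2"])
qed

lemma seq_inner_scale:
  assumes "square_summable f" "square_summable g"
  shows "seq_inner (\<lambda>k. a *s f k) (\<lambda>k. b *s g k) = a * cnj b * seq_inner f g"
proof (rule sums_unique2[OF seq_inner_sums])
  show "(\<lambda>k. cinner (a *s f k) (b *s g k)) sums (a * cnj b * seq_inner f g)"
    unfolding cinner_scale_left unfolding cinner_scale_right mult.assoc
    by (intro sums_mult seq_inner_sums assms)
qed (intro square_summable_scale assms)+

lemma seq_inner_diff_left:
  assumes "square_summable f" "square_summable g" "square_summable h"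
  shows "seq_inner (\<lambda>k. f k - a *s g k) h = seq_inner f h - a * seq_inner g h"
proof (rule sums_unique2[OF seq_inner_sums])
  show "(\<lambda>k. cinner (f k - a *s g k) (h k)) sums (seq_inner f h - a * seq_inner g h)"
    unfolding cinner_diff_left cinner_scale_left
    by (intro sums_diff sums_mult seq_inner_sums assms)
qed (intro square_summable_diff square_summable_scale assms)+

lemma seq_inner_diff_right:
  assumes "square_summable f" "square_summable g" "square_summable h"
  shows "seq_inner h (\<lambda>k. f k - a *s g k) = seq_inner h f - cnj a * seq_inner h g"
proof (rule sums_unique2[OF seq_inner_sums])
  show "(\<lambda>k. cinner (h k) (f k - a *s g k)) sums (seq_inner h f - cnj a * seq_inner h g)"
    unfolding cinner_diff_right cinner_scale_right
    by (intro sums_diff sums_mult seq_inner_sums assms)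
qed (intro square_summable_diff square_summable_scale assms)+

lemma shift_diff_scale: "shift m (\<lambda>k. f k - a *s g k) = (\<lambda>k. shift m f k - a *s shift m g k)"
  by (auto simp: shift_def)

lemma seq_inner_self_sums:
  assumes "square_summable f"
  shows "(\<lambda>k. (norm (f k))\<^sup>2) sums Re (seq_inner f f)"
  using sums_Re[OF seq_inner_sums[OF assms assms]] by (simp add: cinner_self)

lemma norm_le_seq_inner:
  assumes "square_summable f"
  shows "(norm (f k))\<^sup>2 \<le> Re (seq_inner f f)"
  using sum_le_suminf[of "\<lambda>k. (norm (f k))\<^sup>2" "{k}"] seq_inner_self_sums[OF assms] assms
  by (simp add: square_summable_def sums_iff)

lemma seq_inner_self_eq_0:
  assumes "square_summable f" "seq_inner f f = 0"
  shows "f = (\<lambda>k. 0)"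
  using norm_le_seq_inner[OF assms(1)] assms(2) by (simp add: fun_eq_iff)

section \<open>Counting wandering vectors\<close>

text \<open>For orthogonal vectors \<open>F t\<close> of squared norms \<open>w t\<close>, let \<open>x\<close> be the projection of the
  unit vector at coordinate \<open>(k, j)\<close> to their span. The quantity on the left is both the squared
  norm of \<open>x\<close> and the entry of \<open>x\<close> at that coordinate, so its square is at most itself.\<close>

lemma bessel_coordinate:
  fixes F :: "'t \<Rightarrow> nat \<Rightarrow> complex ^ 'n"
  assumes "finite T" and l2: "\<And>t. t \<in> T \<Longrightarrow> square_summable (F t)" and pos: "\<And>t. t \<in> T \<Longrightarrow> w t > 0"
    and orth: "\<And>t u. t \<in> T \<Longrightarrow> u \<in> T \<Longrightarrow>
           seq_inner (F t) (F u) = (if t = u then of_real (w t) else 0)"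
  shows "(\<Sum>t\<in>T. (cmod (F t k $ j))\<^sup>2 / w t) \<le> 1"
proof -
  define S where "S = (\<Sum>t\<in>T. (cmod (F t k $ j))\<^sup>2 / w t)"
  define a where "a t = cnj (F t k $ j) / of_real (w t)" for t
  define x where "x i = (\<Sum>t\<in>T. a t *s F t i)" for i
  have x_sums: "(\<lambda>i. cinner (x i) (x i)) sums (\<Sum>t\<in>T. \<Sum>u\<in>T. a t * (cnj (a u) * seq_inner (F t) (F u)))"
    unfolding x_def cinner_sum_left cinner_scale_left
    unfolding cinner_sum_right cinner_scale_right sum_distrib_left
    by (intro sums_sum sums_mult seq_inner_sums l2)
  have "(\<Sum>t\<in>T. \<Sum>u\<in>T. a t * (cnj (a u) * seq_inner (F t) (F u)))
      = (\<Sum>t\<in>T. \<Sum>u\<in>T. if t = u then a t * (cnj (a u) * of_real (w t)) else 0)"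
    using orth by (intro sum.cong) auto
  also have "\<dots> = (\<Sum>t\<in>T. a t * (cnj (a t) * of_real (w t)))"
    using \<open>finite T\<close> by (simp add: sum.delta')
  also have "\<dots> = (\<Sum>t\<in>T. of_real ((cmod (F t k $ j))\<^sup>2 / w t))"
  proof (rule sum.cong)
    fix t assume "t \<in> T"
    with pos[of t] show "a t * (cnj (a t) * of_real (w t)) = of_real ((cmod (F t k $ j))\<^sup>2 / w t)"
      unfolding a_def by (simp add: field_simps flip: complex_norm_square)
  qed simp
  also have "\<dots> = of_real S"
    by (simp add: S_def)
  finally have "(\<lambda>i. of_real ((norm (x i))\<^sup>2)) sums (of_real S :: complex)"
    using x_sums by (simp only: cinner_self)
  then have sums: "(\<lambda>i. (norm (x i))\<^sup>2) sums S"
    by (simp only: sums_of_real_iff)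
  have "(norm (x k))\<^sup>2 \<le> S"
    using sum_le_suminf[of "\<lambda>k. (norm (x k))\<^sup>2" "{k}"] sums by (simp add: sums_iff)
  \<comment> \<open>the entry of the projection at the chosen coordinate is its squared norm\<close>
  moreover have "x k $ j = of_real S"
    unfolding x_def S_def a_def
    by (auto simp: vector_scalar_mult_def mult.commute simp flip: complex_norm_square intro!: sum.cong)
  then have "\<bar>S\<bar> \<le> norm (x k)"
    using Finite_Cartesian_Product.norm_nth_le[of "x k" j] by simp
  then have "S\<^sup>2 \<le> (norm (x k))\<^sup>2"
    by (metis abs_ge_zero power2_abs power_mono)
  ultimately have "S * S \<le> S"
    by (simp add: power2_eq_square)
  then show ?thesis
    unfolding S_def[symmetric] by (cases "S > 0") auto
qed

text \<open>A trace count. Among the shifts by \<open>m < N\<close>, Bessel's inequality at each of the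
  \<open>CARD('n) * (N + M)\<close> coordinates below \<open>N + M\<close> bounds the total mass there. Each of the
  \<open>N * card I\<close> shifted vectors has there at least the mass of the first \<open>M\<close> entries before the
  shift, which tends to 1 with \<open>M\<close> after normalisation. Dividing by \<open>N\<close> and letting first \<open>N\<close>
  and then \<open>M\<close> tend to infinity gives the bound.\<close>

theorem card_wandering_le:
  fixes E :: "'i \<Rightarrow> nat \<Rightarrow> complex ^ 'n"
  assumes fin: "finite I" and l2: "\<And>i. i \<in> I \<Longrightarrow> square_summable (E i)" and pos: "\<And>i. i \<in> I \<Longrightarrow> w i > 0"
    and orth: "\<And>i j m n. i \<in> I \<Longrightarrow> j \<in> I \<Longrightarrow>
           seq_inner (shift m (E i)) (shift n (E j)) = (if m = n \<and> i = j then of_real (w i) else 0)"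
  shows "card I \<le> CARD('n)"
proof -
  define S where "S M = (\<Sum>i\<in>I. \<Sum>k<M. (norm (E i k))\<^sup>2 / w i)" for M
  have "S M \<le> CARD('n)" for M
  proof -
    \<comment> \<open>the shifts by less than N move the first M entries to positions below N + M\<close>
    have key: "real N * S M \<le> CARD('n) * real (N + M)" for N
    proof -
      have "real N * S M = (\<Sum>m<N. \<Sum>i\<in>I. \<Sum>k<M. (norm (E i k))\<^sup>2 / w i)"
        by (simp add: S_def)
      also have "\<dots> \<le> (\<Sum>m<N. \<Sum>i\<in>I. \<Sum>k<N + M. (norm (shift m (E i) k))\<^sup>2 / w i)"
      proof (intro sum_mono)
        fix m i assume *: "m \<in> {..<N}" "i \<in> I"
        have "(\<Sum>k<M. (norm (E i k))\<^sup>2 / w i)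
            = (\<Sum>k\<in>(+) m ` {..<M}. (norm (shift m (E i) k))\<^sup>2 / w i)"
          by (subst sum.reindex) (auto simp: shift_def)
        also have "\<dots> \<le> (\<Sum>k<N + M. (norm (shift m (E i) k))\<^sup>2 / w i)"
          using * pos[of i] by (intro sum_mono2) auto
        finally show "(\<Sum>k<M. (norm (E i k))\<^sup>2 / w i)
            \<le> (\<Sum>k<N + M. (norm (shift m (E i) k))\<^sup>2 / w i)" .
      qed
      also have "\<dots> = (\<Sum>(m, i)\<in>{..<N} \<times> I. \<Sum>(k, j)\<in>{..<N + M} \<times> UNIV.
                         (cmod (shift m (E i) k $ j))\<^sup>2 / w i)"
        by (simp add: norm_square_vec sum_divide_distrib flip: sum.cartesian_product)
      also have "\<dots> = (\<Sum>(k, j)\<in>{..<N + M} \<times> UNIV. \<Sum>(m, i)\<in>{..<N} \<times> I.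
                         (cmod (shift m (E i) k $ j))\<^sup>2 / w i)"
        unfolding case_prod_beta by (rule sum.swap)
      also have "\<dots> \<le> (\<Sum>(k, j)\<in>{..<N + M} \<times> (UNIV :: 'n set). 1)"
      proof (intro sum_mono, clarify)
        fix k j
        show "(\<Sum>(m, i)\<in>{..<N} \<times> I. (cmod (shift m (E i) k $ j))\<^sup>2 / w i) \<le> 1"
          unfolding case_prod_beta
          by (rule bessel_coordinate[of "{..<N} \<times> I" "\<lambda>t. shift (fst t) (E (snd t))" "\<lambda>t. w (snd t)"])
             (use fin in \<open>auto simp: orth pos intro!: square_summable_shift l2 split: if_splits\<close>)
      qed
      also have "\<dots> = CARD('n) * real (N + M)"
        by (simp add: case_prod_beta card_cartesian_product)
      finally show ?thesis .
    qed
    show ?thesis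
    proof (rule ccontr)
      assume "\<not> S M \<le> CARD('n)"
      then have "S M - CARD('n) > 0" by simp
      then obtain N where "real N * (S M - CARD('n)) > CARD('n) * real M"
        using reals_Archimedean3 by blast
      with key[of N] show False
        by (simp add: algebra_simps)
    qed
  qed
  moreover have "S \<longlonglongrightarrow> (\<Sum>i\<in>I. Re (seq_inner (E i) (E i)) / w i)"
    unfolding S_def using seq_inner_self_sums[OF l2]
    by (auto simp: sums_def sum_divide_distrib[symmetric] intro!: tendsto_intros dest: pos)
  moreover have "(\<Sum>i\<in>I. Re (seq_inner (E i) (E i)) / w i) = card I"
  proof -
    have "shift 0 f = f" for f :: "nat \<Rightarrow> complex ^ 'n"
      by (auto simp: shift_def)
    then have "seq_inner (E i) (E i) = of_real (w i)" if "i \<in> I" for i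
      using orth[OF that that, of 0 0] by simp
    then show ?thesis
      using pos by (simp add: less_le)
  qed
  ultimately have "real (card I) \<le> CARD('n)"
    by (metis LIMSEQ_le_const2)
  then show ?thesis by simp
qed


section \<open>Indices as binary words\<close>

text \<open>Words are read with the most significant digit first (\<open>True\<close> is the digit 1), and a
  leading digit 1 is put in front, which makes the encoding a bijection onto the positive
  numbers.\<close>

fun word_num :: "bool list \<Rightarrow> nat" where
  "word_num [] = 1"
| "word_num (e # z) = word_num z + (if e then 2 else 1) * 2 ^ length z"

lemma word_num_bounds: "2 ^ length y \<le> word_num y" "word_num y < 2 ^ (length y + 1)"
  by (induction y) auto

lemma word_num_Cons_ge_2: "word_num (e # z) \<ge> 2"
proof -
  have "(2::nat) \<le> 2 ^ length (e # z)" by simp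
  also have "\<dots> \<le> word_num (e # z)" by (rule word_num_bounds)
  finally show ?thesis .
qed

lemma word_num_pos: "word_num y > 0"
  using word_num_bounds(1)[of y] by (rule order.strict_trans2[rotated]) simp

lemma floor_log_word_num [simp]: "floor_log (word_num y) = length y"
  using word_num_bounds[of y] by (intro floor_log_eqI word_num_pos) auto

lemma word_num_append: "word_num (u @ v) + 2 ^ length v = word_num u * 2 ^ length v + word_num v"
  by (induction u) (auto simp: algebra_simps power_add)

lemma word_num_replicate_False: "word_num (replicate k False) = 2 ^ k"
  by (induction k) auto

lemma word_num_replicate_True: "word_num (replicate n True) = 2 ^ (n + 1) - 1"
  by (induction n) auto

lemma word_num_append_div_mod:
  "word_num (u @ v) div 2 ^ length v = word_num u" "word_num (u @ v) mod 2 ^ length v = word_num v - 2 ^ length v"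
proof -
  have "word_num (u @ v) = word_num u * 2 ^ length v + (word_num v - 2 ^ length v)"
    using word_num_append[of u v] word_num_bounds(1)[of v] by simp
  moreover have "word_num v - 2 ^ length v < 2 ^ length v"
    using word_num_bounds[of v] by simp
  ultimately show "word_num (u @ v) div 2 ^ length v = word_num u"
    and "word_num (u @ v) mod 2 ^ length v = word_num v - 2 ^ length v"
    by simp_all
qed

lemma inj_word_num: "inj word_num"
proof
  fix y y' :: "bool list" assume "word_num y = word_num y'"
  then show "y = y'"
  proof (induction y arbitrary: y')
    case Nil
    then have "length y' = 0"
      by (metis floor_log_word_num list.size(3))
    then show ?case by simp
  next
    case (Cons e z)
    then have "length y' = Suc (length z)"
      by (metis floor_log_word_num length_Cons)
    then obtain e' z' where y': "y' = e' # z'" "length z' = length z"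
      by (cases y') auto
    with Cons.prems word_num_bounds[of z] word_num_bounds[of z'] have "e = e'"
      by (auto split: if_splits)
    with Cons y' show ?case by auto
  qed
qed

lemma word_num_eq_iff [simp]: "word_num y = word_num y' \<longleftrightarrow> y = y'"
  using inj_word_num by (auto dest: injD)

lemma word_num_surj: "l \<ge> 1 \<Longrightarrow> \<exists>y. l = word_num y"
proof (induction l rule: less_induct)
  case (less l)
  show ?case
  proof (cases "l = 1")
    case True
    then show ?thesis by (intro exI[of _ "[]"]) simp
  next
    case False
    with less obtain y where y: "l div 2 = word_num y"
      by fastforce
    have "word_num (y @ [odd l]) + 2 = word_num y * 2 + (if odd l then 3 else 2)"
      using word_num_append[of y "[odd l]"] by simp
    then have "word_num (y @ [odd l]) = l"
      using y[symmetric] by (cases "odd l") (simp_all, presburger)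
    then show ?thesis by metis
  qed
qed

lemma sum_digits: "(\<Sum>t<n. digit l t * 2 ^ t) = l mod 2 ^ n"
proof -
  have "(\<Sum>t<n. digit l t * 2 ^ t) = horner_sum of_bool 2 (map (bit l) [0..<n])"
    by (simp add: horner_sum_eq_sum digit_def atLeast0LessThan)
  then show ?thesis
    by (simp add: horner_sum_bit_eq_take_bit take_bit_eq_mod)
qed

text \<open>The indices of \<open>\<Psi>\<close> that occur in \<open>beta\<close> belong to the suffixes of a word, and the
  numbers compared by \<open>delta\<close> to its prefixes; hence a summand survives exactly for a common
  prefix.\<close>

lemma psi_index_word:
  assumes "j \<le> length y"
  shows "psi_index (word_num y) j = word_num (drop j y)"
proof -
  have "word_num y mod 2 ^ length (drop j y) = word_num (drop j y) - 2 ^ length (drop j y)"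
    using word_num_append_div_mod(2)[of "take j y" "drop j y"] by (simp only: append_take_drop_id)
  then show ?thesis
    using word_num_bounds(1)[of "drop j y"] by (simp add: psi_index_def sum_digits)
qed

lemma leading_word:
  assumes "j \<le> length y"
  shows "leading (word_num y) j = word_num (take j y)"
proof -
  have "leading (word_num y) j = (\<Sum>t<Suc j. digit (word_num y div 2 ^ (length y - j)) t * 2 ^ t)"
    by (simp add: leading_def digit_def lessThan_Suc_atMost flip: bit_drop_bit_eq drop_bit_eq_div)
       (simp add: bit_drop_bit_eq o_def)
  also have "\<dots> = word_num (take j y) mod 2 ^ Suc j"
    unfolding sum_digits
    using word_num_append_div_mod(1)[of "take j y" "drop j y"] by simp
  also have "\<dots> = word_num (take j y)"
    using word_num_bounds(2)[of "take j y"] assms by (simp add: min_absorb2)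
  finally show ?thesis .
qed

text \<open>The recursive form of \<open>beta\<close> at two positive indices: equal first letters contribute the
  kernel of the tails, and the inner product subtracted at each step belongs to one common
  prefix.\<close>

fun prefix_kernel :: "real \<Rightarrow> (bool list \<Rightarrow> complex ^ 2) \<Rightarrow> bool list \<Rightarrow> bool list \<Rightarrow> complex" where
  "prefix_kernel B P [] [] = of_real B - cinner (P []) (P [])"
| "prefix_kernel B P [] (e' # z') = - cinner (P (e' # z')) (P [])"
| "prefix_kernel B P (e # z) [] = - cinner (P []) (P (e # z))"
| "prefix_kernel B P (e # z) (e' # z') =
     (if e = e' then prefix_kernel B P z z' else 0) - cinner (P (e' # z')) (P (e # z))"

lemma prefix_kernel_eq_sum:
  "prefix_kernel B P y y' = of_real (if y = y' then B else 0)
     - (\<Sum>j\<le>min (length y) (length y').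
          if take j y = take j y' then cinner (P (drop j y')) (P (drop j y)) else 0)"
proof (induction B P y y' rule: prefix_kernel.induct)
  case (4 B P e z e' z')
  have "(\<Sum>j\<le>min (length (e # z)) (length (e' # z')).
          if take j (e # z) = take j (e' # z')
          then cinner (P (drop j (e' # z'))) (P (drop j (e # z))) else 0)
      = cinner (P (e' # z')) (P (e # z))
        + (\<Sum>j\<le>min (length z) (length z').
            if e = e' \<and> take j z = take j z' then cinner (P (drop j z')) (P (drop j z)) else 0)"
    by (simp only: list.size min_Suc_Suc add_Suc_right add_0_right sum.atMost_Suc_shift)
       (simp cong: if_cong)
  with 4 show ?case
    by auto
qed auto

lemma beta_word_num: "beta B \<Psi> (word_num y) (word_num y') = prefix_kernel B (\<Psi> \<circ> word_num) y y'"
proof -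
  have [simp]: "word_num y \<noteq> 0" for y
    using word_num_pos[of y] by simp
  show ?thesis
  proof (cases "y = y'")
    case True
    then show ?thesis
      by (simp add: beta_def prefix_kernel_eq_sum cinner_self psi_index_word)
  next
    case False
    then show ?thesis
      by (simp add: beta_def prefix_kernel_eq_sum delta_def psi_index_word leading_word cong: if_cong)
         (auto intro!: sum.cong)
  qed
qed


section \<open>Geometric sequences\<close>

text \<open>The coefficients of \<open>x + (\<Sum>k\<ge>1. \<omega>^k r^(k-1)) y\<close>.\<close>

definition geometric :: "complex ^ 'n \<Rightarrow> complex ^ 'n \<Rightarrow> complex \<Rightarrow> nat \<Rightarrow> complex ^ 'n" where
  "geometric x y r k = (case k of 0 \<Rightarrow> x | Suc i \<Rightarrow> r ^ i *s y)"

lemma geometric_simps [simp]: "geometric x y r 0 = x" "geometric x y r (Suc k) = r ^ k *s y"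
  by (simp_all add: geometric_def)

lemma scale_geometric: "a *s geometric x y r k = geometric (a *s x) (a *s y) r k"
  by (cases k) (simp_all add: mult.commute)

lemma summable_norm_geometric: "cmod r < 1 \<Longrightarrow> summable (\<lambda>k. norm (geometric x y r k))"
  by (subst summable_Suc_iff[symmetric]) (simp add: norm_scale norm_power summable_mult2)

lemma square_summable_geometric:
  assumes "cmod r < 1"
  shows "square_summable (geometric x y r)"
proof -
  have "(cmod r)\<^sup>2 < 1"
    using assms by (simp add: abs_square_less_1)
  then have "summable (\<lambda>k. ((cmod r)\<^sup>2) ^ k * (norm y)\<^sup>2)"
    by (intro summable_mult2) simp
  then show ?thesis
    unfolding square_summable_def
    by (subst summable_Suc_iff[symmetric])
       (simp add: norm_scale norm_power power_mult_distrib mult.commute flip: power_mult)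
qed

lemma seq_inner_shift_geometric_same:
  assumes "cmod r < 1"
  shows "seq_inner (shift m (geometric x y r)) (shift m (geometric x' y' r))
    = cinner x x' + cinner y y' / of_real (1 - (cmod r)\<^sup>2)"
proof -
  let ?f = "\<lambda>k. cinner (shift m (geometric x y r) k) (shift m (geometric x' y' r) k)"
  have "cmod (r * cnj r) < 1"
    using assms by (simp add: norm_mult abs_square_less_1 flip: power2_eq_square)
  then have "(\<lambda>k. (r * cnj r) ^ k * cinner y y') sums (1 / (1 - r * cnj r) * cinner y y')"
    by (intro sums_mult2 geometric_sums)
  then have "(\<lambda>k. ?f (Suc k + m)) sums (1 / (1 - r * cnj r) * cinner y y')"
    by (simp add: shift_def cinner_scale_left cinner_scale_right power_mult_distrib mult_ac)
  then have "(\<lambda>k. ?f (k + m)) sums (1 / (1 - r * cnj r) * cinner y y' + ?f (0 + m))"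
    by (rule sums_Suc)
  then have "?f sums (1 / (1 - r * cnj r) * cinner y y' + ?f (0 + m) + (\<Sum>k<m. ?f k))"
    by (subst (asm) sums_iff_shift) simp
  then have "?f sums (cinner x x' + cinner y y' / of_real (1 - (cmod r)\<^sup>2))"
    by (simp add: shift_def add.commute flip: complex_norm_square)
  then show ?thesis
    by (simp add: seq_inner_def sums_iff)
qed

lemma seq_inner_shift_geometric_less:
  assumes "cmod r < 1"
  shows "seq_inner (shift (Suc (n + d)) (geometric x y r)) (shift n (geometric x' y' r))
    = cnj r ^ d * (cinner x y' + cnj r * cinner y y' / of_real (1 - (cmod r)\<^sup>2))"
proof -
  let ?N = "Suc (n + d)"
  let ?f = "\<lambda>k. cinner (shift ?N (geometric x y r) k) (shift n (geometric x' y' r) k)"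
  have "cmod (r * cnj r) < 1"
    using assms by (simp add: norm_mult abs_square_less_1 flip: power2_eq_square)
  then have "(\<lambda>k. (r * cnj r) ^ k * (cnj r ^ Suc d * cinner y y'))
      sums (1 / (1 - r * cnj r) * (cnj r ^ Suc d * cinner y y'))"
    by (intro sums_mult2 geometric_sums)
  moreover have f: "?f (k + ?N) = cinner (geometric x y r k) (r ^ (k + d) *s y')" for k
    by (simp add: shift_def geometric_def split: nat.split)
  ultimately have "(\<lambda>k. ?f (Suc k + ?N)) sums (1 / (1 - r * cnj r) * (cnj r ^ Suc d * cinner y y'))"
    unfolding f by (simp add: cinner_scale_left cinner_scale_right power_mult_distrib power_add mult_ac)
  then have "(\<lambda>k. ?f (k + ?N)) sums (1 / (1 - r * cnj r) * (cnj r ^ Suc d * cinner y y') + ?f (0 + ?N))"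
    by (rule sums_Suc)
  then have "?f sums (1 / (1 - r * cnj r) * (cnj r ^ Suc d * cinner y y') + ?f (0 + ?N) + (\<Sum>k<?N. ?f k))"
    by (subst (asm) sums_iff_shift) simp
  moreover have "(\<Sum>k<?N. ?f k) = 0"
    by (intro sum.neutral) (simp add: shift_def)
  ultimately have "?f sums (cnj r ^ d * (cinner x y' + cnj r * cinner y y' / of_real (1 - (cmod r)\<^sup>2)))"
    unfolding f by (simp add: cinner_scale_right algebra_simps flip: complex_norm_square)
  then show ?thesis
    by (simp add: seq_inner_def sums_iff)
qed

text \<open>If the second terms are multiples of one vector \<open>b\<close> with the right norm, the geometric
  series cancels the factor \<open>1 - |r|\<^sup>2\<close>. All inner products with different shifts then contain
  the factor \<open>\<langle>x, b\<rangle> + cnj r t D\<close> of one of the sequences, which is the orthogonality of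
  \<open>(sqrt D t, x)\<close> and \<open>(sqrt D r, b)\<close> in \<open>\<complex>\<^sup>3\<close>.\<close>

lemma seq_inner_shift_geometric:
  assumes r: "cmod r < 1" and b: "cinner b b = D * of_real (1 - (cmod r)\<^sup>2)"
    and x: "cinner x b + cnj r * t * D = 0" and x': "cinner x' b + cnj r * t' * D = 0"
  shows "seq_inner (shift m (geometric x (t *s b) r)) (shift n (geometric x' (t' *s b) r))
    = (if m = n then cinner x x' + t * cnj t' * D else 0)"
proof -
  have nz: "of_real (1 - (cmod r)\<^sup>2) \<noteq> (0 :: complex)"
    using r abs_square_less_1[of "cmod r"] by (simp del: of_real_diff)
  have off: "seq_inner (shift (Suc (n + d)) (geometric x (t *s b) r)) (shift n (geometric x' (t' *s b) r)) = 0"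
    if "cinner x b + cnj r * t * D = 0" for x x' t t' n d
  proof -
    have "cinner x (t' *s b) + cnj r * cinner (t *s b) (t' *s b) / of_real (1 - (cmod r)\<^sup>2)
        = cnj t' * (cinner x b + cnj r * t * D)"
      using nz by (simp add: cinner_scale_left cinner_scale_right b field_simps del: of_real_diff of_real_power)
    then show ?thesis
      unfolding seq_inner_shift_geometric_less[OF r] that by simp
  qed
  consider (eq) "m = n" | (gt) d where "m = Suc (n + d)" | (lt) d where "n = Suc (m + d)"
    using less_iff_Suc_add by (cases m n rule: linorder_cases) blast+
  then show ?thesis
  proof cases
    case eq
    with nz show ?thesis
      by (simp add: seq_inner_shift_geometric_same[OF r] cinner_scale_left cinner_scale_right b)
  next
    case gt
    then show ?thesis
      using off[OF x] by simp
  next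
    case lt
    then show ?thesis
      using off[OF x', where n = m] seq_inner_commute[OF square_summable_shift square_summable_shift, OF square_summable_geometric square_summable_geometric, OF r r]
      by (metis complex_cnj_zero n_not_Suc_n not_add_less1 less_Suc_eq)
  qed
qed

section \<open>The orthogonality relations on binary words\<close>

text \<open>The words \<open>0^k w\<close> belong to indices with the same lower digits \<open>w\<close>. The fiber over the
  empty word is the coefficient sequence of \<open>\<hh> 0\<close>, and the fiber over \<open>1y\<close> is that of \<open>\<hh> l\<close> with
  \<open>l = 1y\<close>.\<close>

definition fiber :: "(bool list \<Rightarrow> 'a) \<Rightarrow> bool list \<Rightarrow> nat \<Rightarrow> 'a" where
  "fiber P w k = P (replicate k False @ w)"

definition word_orth :: "real \<Rightarrow> (bool list \<Rightarrow> complex ^ 2) \<Rightarrow> bool" where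
  "word_orth B P \<longleftrightarrow>
     (\<forall>m n. seq_inner (shift m (fiber P [])) (shift n (fiber P [])) = (if m = n then of_real B else 0)) \<and>
     (\<forall>y m n. seq_inner (shift m (fiber P (True # y))) (shift n (fiber P [])) = 0) \<and>
     (\<forall>y m n. seq_inner (shift m (fiber P [])) (shift n (fiber P (True # y))) = 0) \<and>
     (\<forall>y y' m n. seq_inner (shift m (fiber P (True # y'))) (shift n (fiber P (True # y)))
                   = (if m = n then prefix_kernel B P y y' else 0))"

definition weight :: "complex \<Rightarrow> complex \<Rightarrow> bool list \<Rightarrow> complex" where
  "weight r s y = prod_list (map (\<lambda>e. if e then s else r) y)"

lemma weight_simps [simp]:
  "weight r s [] = 1" "weight r s (e # z) = (if e then s else r) * weight r s z"
  "weight r s (u @ v) = weight r s u * weight r s v" "weight r s (replicate n e) = (if e then s else r) ^ n"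
  by (simp_all add: weight_def)

text \<open>Orthogonality of the vectors \<open>(sqrt D, a)\<close>, \<open>(sqrt D r, b)\<close>, \<open>(sqrt D s, c)\<close> of \<open>\<complex>\<^sup>3\<close>,
  where the last two have squared norm \<open>D\<close>. The bound \<open>|r| < 1\<close> makes the geometric sequences of
  ratio \<open>r\<close> square summable.\<close>

definition frame :: "real \<Rightarrow> complex ^ 2 \<Rightarrow> complex ^ 2 \<Rightarrow> complex ^ 2 \<Rightarrow> complex \<Rightarrow> complex \<Rightarrow> bool" where
  "frame D a b c r s \<longleftrightarrow> 
     cmod r < 1 \<and>
     of_real D * r + cinner b a = 0 \<and> of_real D * s + cinner c a = 0 \<and>
     of_real D * r * cnj s + cinner b c = 0 \<and>
     D * (cmod r)\<^sup>2 + (norm b)\<^sup>2 = D \<and> D * (cmod s)\<^sup>2 + (norm c)\<^sup>2 = D"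

lemma frame_cinner:
  assumes "frame D a b c r s"
  shows "cinner b a = - of_real D * r" "cinner a b = - of_real D * cnj r"
    "cinner c a = - of_real D * s" "cinner a c = - of_real D * cnj s"
    "cinner b c = - of_real D * r * cnj s" "cinner c b = - of_real D * cnj r * s"
    "cinner b b = of_real D * (1 - r * cnj r)" "cinner c c = of_real D * (1 - s * cnj s)"
proof -
  have D: "(norm b)\<^sup>2 = D - D * (cmod r)\<^sup>2" "(norm c)\<^sup>2 = D - D * (cmod s)\<^sup>2"
    using assms by (simp_all add: frame_def)
  show "cinner b a = - of_real D * r" "cinner c a = - of_real D * s" 
    "cinner b c = - of_real D * r * cnj s"
    using assms by (simp_all add: frame_def eq_neg_iff_add_eq_0 add.commute)
  then show "cinner a b = - of_real D * cnj r" "cinner a c = - of_real D * cnj s" 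
    "cinner c b = - of_real D * cnj r * s"
    by (subst cinner_commute, simp)+
  show "cinner b b = of_real D * (1 - r * cnj r)" "cinner c c = of_real D * (1 - s * cnj s)"
    unfolding cinner_self D complex_norm_square[symmetric] by (simp_all add: algebra_simps)
qed

lemma word_cases:
  obtains k where "z = replicate k False" | k z' where "z = replicate k False @ True # z'"
proof (induction z arbitrary: thesis)
  case Nil
  then show ?case by (metis replicate_0)
next
  case (Cons e z)
  show ?case
  proof (cases e)
    case True
    then show ?thesis
      using Cons.prems(2)[of 0 z] by simp
  next
    case False
    then show ?thesis
      using Cons.IH Cons.prems by (metis (full_types) append_Cons replicate_Suc)
  qed
qed

text \<open>By \<open>word_cases\<close>, each word lies in the fiber over \<open>[]\<close> or over a word that begins with
  1, and a fiber records the values of \<open>P\<close> along it; so multiplicativity in the letters amounts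
  to geometric fibers.\<close>

lemma multiplicative_iff_fibers_geometric:
  "P [] = a \<and> (\<forall>z. P (False # z) = weight r s z *s b) \<and> (\<forall>z. P (True # z) = weight r s z *s c) \<longleftrightarrow>
   fiber P [] = geometric a b r \<and> (\<forall>z. fiber P (True # z) = (\<lambda>k. weight r s z *s geometric c (s *s b) r k))"
   (is "?L \<longleftrightarrow> ?R")
proof
  assume L: ?L
  have "fiber P [] k = geometric a b r k" for k
    using L by (cases k) (auto simp: fiber_def)
  moreover have "fiber P (True # z) k = weight r s z *s geometric c (s *s b) r k" for z k
    using L by (cases k) (auto simp: fiber_def mult_ac)
  ultimately show ?R by auto
next
  assume R: ?R
  have "P (False # z) = weight r s z *s b" for z
  proof (cases z rule: word_cases)
    case (1 k)
    with R have "fiber P [] (Suc k) = r ^ k *s b" by simp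
    with 1 show ?thesis by (simp add: fiber_def)
  next
    case (2 k z')
    with R have "fiber P (True # z') (Suc k) = weight r s z' *s (r ^ k *s (s *s b))" by simp
    with 2 show ?thesis by (simp add: fiber_def mult_ac)
  qed
  moreover have "P (True # z) = fiber P (True # z) 0" "P [] = fiber P [] 0" for z
    by (simp_all add: fiber_def)
  ultimately show ?L
    using R by simp
qed

lemma prefix_kernel_multiplicative:
  assumes fr: "frame D a b c r s" and D: "D = B - (norm a)\<^sup>2"
    and P: "P [] = a" "\<And>z. P (False # z) = weight r s z *s b" "\<And>z. P (True # z) = weight r s z *s c"
  shows "prefix_kernel B P y y' = weight r s y' * cnj (weight r s y) * of_real D"
proof -
  note [simp] = frame_cinner[OF fr] cinner_scale_left cinner_scale_right
  show ?thesis
    using P D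
  proof (induction B P y y' rule: prefix_kernel.induct)
    case (1 B P)
    then show ?case by (simp add: cinner_self)
  qed (auto simp: algebra_simps)
qed

text \<open>Both sides of the conditions are evaluated: the inner products by
  \<open>seq_inner_shift_geometric\<close>, the kernel by induction along its recursion.\<close>

lemma word_orth_multiplicative:
  assumes fr: "frame (B - (norm a)\<^sup>2) a b c r s"
    and P: "P [] = a" "\<And>z. P (False # z) = weight r s z *s b" "\<And>z. P (True # z) = weight r s z *s c"
  shows "word_orth B P"
proof -
  define D where "D = B - (norm a)\<^sup>2"
  have fr: "frame D a b c r s"
    using fr by (simp add: D_def)
  have a: "cinner a a = of_real (B - D)"
    by (simp add: cinner_self D_def)
  have fib: "fiber P [] = geometric a b r" "fiber P (True # z) = (\<lambda>k. weight r s z *s geometric c (s *s b) r k)" for z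
    using multiplicative_iff_fibers_geometric[of P a r s b c] P by auto
  have A: "fiber P [] = geometric a (1 *s b) r"
    unfolding fib by simp
  have G: "fiber P (True # z) = geometric (weight r s z *s c) ((weight r s z * s) *s b) r" for z
    unfolding fib scale_geometric by simp
  have r: "cmod r < 1"
    using fr by (simp add: frame_def)
  have b: "cinner b b = of_real D * of_real (1 - (cmod r)\<^sup>2)"
    by (simp add: frame_cinner[OF fr] flip: complex_norm_square)
  have a0: "cinner a b + cnj r * 1 * of_real D = 0"
    by (simp add: frame_cinner[OF fr])
  have c0: "cinner (weight r s z *s c) b + cnj r * (weight r s z * s) * of_real D = 0" for z
    by (simp add: frame_cinner[OF fr] cinner_scale_left)
  show ?thesis
    unfolding word_orth_def A G seq_inner_shift_geometric[OF r b a0 a0] seq_inner_shift_geometric[OF r b a0 c0] 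
      seq_inner_shift_geometric[OF r b c0 a0] seq_inner_shift_geometric[OF r b c0 c0]
      prefix_kernel_multiplicative[OF fr D_def P]
    by (auto simp: a frame_cinner[OF fr] cinner_scale_left cinner_scale_right algebra_simps)
qed

text \<open>The part \<open>f\<close> of a fiber orthogonal to the fiber over \<open>1\<close> has orthogonal shifts and is
  orthogonal to all shifts of the fibers over \<open>[]\<close> and over \<open>1\<close>. If it were nonzero, there would
  be three wandering vectors for sequences in \<open>\<complex>\<^sup>2\<close>.\<close>

lemma fiber_proportional:
  assumes "B > 0" and D: "D > 0" "D = B - (norm (P []))\<^sup>2"
    and l2: "\<And>w. square_summable (fiber P w)" and orth: "word_orth B P"
  shows "fiber P (True # y) = (\<lambda>k. (prefix_kernel B P [] y / of_real D) *s fiber P [True] k)"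
proof -
  define A where "A = fiber P []"
  define E where "E = fiber P [True]"
  define F where "F = fiber P (True # y)"
  define \<gamma> where "\<gamma> = prefix_kernel B P [] y / of_real D"
  define f where "f = (\<lambda>k. F k - \<gamma> *s E k)"
  have [simp]: "square_summable A" "square_summable E" "square_summable F" "square_summable f"
    unfolding f_def A_def E_def F_def by (intro square_summable_diff square_summable_scale l2)+
  note shift_l2 = square_summable_shift[of A] square_summable_shift[of E] square_summable_shift[of F]
    square_summable_shift[of f]
  have [simp]: "of_real B - cinner (P []) (P []) = of_real D"
    by (simp add: D cinner_self)
  have f_left: "seq_inner (shift m f) (shift n h)
      = seq_inner (shift m F) (shift n h) - \<gamma> * seq_inner (shift m E) (shift n h)"
    if "square_summable h" for m n h
    unfolding f_def shift_diff_scale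
    using that by (intro seq_inner_diff_left square_summable_shift) auto
  have AA: "seq_inner (shift m A) (shift n A) = (if m = n then of_real B else 0)"
    and EA: "seq_inner (shift m E) (shift n A) = 0" and FA: "seq_inner (shift m F) (shift n A) = 0"
    and EE: "seq_inner (shift m E) (shift n E) = (if m = n then of_real D else 0)" 
    and FE: "seq_inner (shift m F) (shift n E) = (if m = n then prefix_kernel B P [] y else 0)"
    and EF: "seq_inner (shift m E) (shift n F) = (if m = n then prefix_kernel B P y [] else 0)"
    and FF: "seq_inner (shift m F) (shift n F) = (if m = n then prefix_kernel B P y y else 0)" for m n
    using orth by (simp_all add: word_orth_def A_def E_def F_def)
  have fA: "seq_inner (shift m f) (shift n A) = 0" for m n
    by (simp add: f_left EA FA)
  have fE: "seq_inner (shift m f) (shift n E) = 0" for m n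
    using D(1) by (simp add: f_left FE EE \<gamma>_def)
  have fF: "seq_inner (shift m f) (shift n F) = (if m = n then prefix_kernel B P y y - \<gamma> * prefix_kernel B P y [] else 0)" for m n
    by (simp add: f_left FF EF)
  have "seq_inner (shift m f) (shift n f) = seq_inner (shift m f) (shift n F) - cnj \<gamma> * seq_inner (shift m f) (shift n E)" for m n
    by (subst (2) f_def, unfold shift_diff_scale) (intro seq_inner_diff_right square_summable_shift; simp)
  then obtain w where ff: "seq_inner (shift m f) (shift n f) = (if m = n then w else 0)" for m n
    unfolding fE fF by auto
  have "shift 0 f = f"
    by (auto simp: shift_def)
  then have w: "seq_inner f f = w"
    using ff[of 0 0] by simp
  have "w = of_real (Re w)"
    using seq_inner_commute[of f f] w by (simp add: complex_eq_iff)
  moreover have "Re w \<ge> 0"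
    using norm_le_seq_inner[of f 0] w by (simp add: order_trans[OF zero_le_power2])
  moreover have "\<not> Re w > 0"
  proof
    assume "Re w > 0"
    have EA': "seq_inner (shift m A) (shift n E) = 0" and fA': "seq_inner (shift m A) (shift n f) = 0" 
      and fE': "seq_inner (shift m E) (shift n f) = 0" for m n
      using seq_inner_commute[of "shift n E" "shift m A"] seq_inner_commute[of "shift n f" "shift m A"]
        seq_inner_commute[of "shift n f" "shift m E"] by (simp_all add: shift_l2 EA fA fE)
    \<comment> \<open>three wandering vectors in dimension two\<close>
    define Ws where "Ws = (\<lambda>i::nat. if i = 0 then A else if i = 1 then E else f)"
    define wgt where "wgt = (\<lambda>i::nat. if i = 0 then B else if i = 1 then D else Re w)"
    have "card {..<3::nat} \<le> CARD(2)"
    proof (rule card_wandering_le[of _ Ws wgt])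
      show "seq_inner (shift m (Ws i)) (shift n (Ws j)) = (if m = n \<and> i = j then of_real (wgt i) else 0)"
        if "i \<in> {..<3}" "j \<in> {..<3}" for i j m n
      proof -
        have "i = 0 \<or> i = 1 \<or> i = 2" "j = 0 \<or> j = 1 \<or> j = 2"
          using that by auto
        then show ?thesis
          using \<open>w = of_real (Re w)\<close>
          by (elim disjE) (simp_all add: Ws_def wgt_def AA EA EE fA fE ff EA' fA' fE')
      qed
    qed (use \<open>B > 0\<close> \<open>D > 0\<close> \<open>Re w > 0\<close> in \<open>auto simp: Ws_def wgt_def\<close>)
    then show False by simp
  qed
  ultimately have "seq_inner f f = 0"
    using w by simp
  then have "f k = 0" for k
    using seq_inner_self_eq_0[of f] by (simp add: fun_eq_iff)
  then show ?thesis
    by (simp add: fun_eq_iff f_def F_def E_def \<gamma>_def)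
qed

text \<open>The identity \<open>step\<close> gives the Gram matrix of the vectors \<open>(sqrt D \<gamma> (e z), P (e z))\<close>,
  which has rank one; expanding the squared norm of
  \<open>(sqrt D \<gamma> (e z), P (e z)) - \<gamma> z (sqrt D \<gamma> [e], P [e])\<close> with it gives 0.\<close>

lemma word_orth_imp_multiplicative:
  assumes "B > 0" and D: "D > 0" "D = B - (norm (P []))\<^sup>2"
    and l2: "\<And>w. square_summable (fiber P w)" and orth: "word_orth B P"
  obtains b c r s where "frame D (P []) b c r s"
    "\<And>z. P (False # z) = weight r s z *s b" "\<And>z. P (True # z) = weight r s z *s c"
proof -
  define \<gamma> where "\<gamma> y = prefix_kernel B P [] y / of_real D" for y
  have [simp]: "of_real B - cinner (P []) (P []) = of_real D"
    by (simp add: D cinner_self)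
  have \<gamma>_Nil: "\<gamma> [] = 1"
    using D(1) by (simp add: \<gamma>_def)
  have proportional: "fiber P (True # y) = (\<lambda>k. \<gamma> y *s fiber P [True] k)" for y
    unfolding \<gamma>_def by (intro fiber_proportional assms)
  have gram: "seq_inner (fiber P (True # y')) (fiber P (True # y)) = prefix_kernel B P y y'" for y y'
  proof -
    have "shift 0 f = f" for f :: "nat \<Rightarrow> complex ^ 2"
      by (auto simp: shift_def)
    then show ?thesis
      using orth unfolding word_orth_def by metis
  qed
  have prefix_kernel: "prefix_kernel B P y y' = \<gamma> y' * cnj (\<gamma> y) * of_real D" for y y'
    unfolding gram[symmetric, of y y'] unfolding proportional[of y] proportional[of y'] seq_inner_scale[OF l2 l2]
    unfolding gram by simp
  \<comment> \<open>the recursion of the kernel, with both kernels in rank-one form\<close>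
  have step: "of_real D * (\<gamma> (e # z') * cnj (\<gamma> (e # z))) + cinner (P (e # z')) (P (e # z))
      = of_real D * (\<gamma> z' * cnj (\<gamma> z))" for e z z'
    using prefix_kernel.simps(4)[of B P e z e z'] unfolding prefix_kernel by (simp add: algebra_simps)
  have split: "\<gamma> (e # z) = \<gamma> z * \<gamma> [e] \<and> P (e # z) = \<gamma> z *s P [e]" for e z
  proof -
    define x where "x = P (e # z) - \<gamma> z *s P [e]"
    define u where "u = \<gamma> (e # z) - \<gamma> z * \<gamma> [e]"
    have "of_real (D * (cmod u)\<^sup>2 + (norm x)\<^sup>2) = of_real D * (u * cnj u) + cinner x x"
      by (simp add: cinner_self flip: complex_norm_square)
    also have "\<dots> = (of_real D * (\<gamma> (e # z) * cnj (\<gamma> (e # z))) + cinner (P (e # z)) (P (e # z)))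
        - cnj (\<gamma> z) * (of_real D * (\<gamma> (e # z) * cnj (\<gamma> [e])) + cinner (P (e # z)) (P [e]))
        - \<gamma> z * (of_real D * (\<gamma> [e] * cnj (\<gamma> (e # z))) + cinner (P [e]) (P (e # z)))
        + \<gamma> z * cnj (\<gamma> z) * (of_real D * (\<gamma> [e] * cnj (\<gamma> [e])) + cinner (P [e]) (P [e]))"
      by (simp add: u_def x_def cinner_diff_left cinner_diff_right cinner_scale_left cinner_scale_right
          algebra_simps)
    also have "\<dots> = 0"
      unfolding step by (simp add: \<gamma>_Nil)
    finally have "D * (cmod u)\<^sup>2 + (norm x)\<^sup>2 = 0"
      by (simp only: of_real_eq_0_iff)
    then have "D * (cmod u)\<^sup>2 = 0 \<and> (norm x)\<^sup>2 = 0"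
      using D by (smt (verit) mult_nonneg_nonneg zero_le_power2)
    then show ?thesis
      using D by (simp add: u_def x_def)
  qed
  define r where "r = \<gamma> [False]"
  define s where "s = \<gamma> [True]"
  have weight: "\<gamma> y = weight r s y" for y
  proof (induction y)
    case (Cons e z)
    then show ?case
      using split[of e z] by (cases e) (simp_all add: r_def s_def)
  qed (simp add: \<gamma>_Nil)
  have e0: "of_real D * \<gamma> [e] + cinner (P [e]) (P []) = 0" for e
    using prefix_kernel[of "[]" "[e]"] by (simp add: \<gamma>_Nil algebra_simps add_eq_0_iff)
  have ee: "D * (cmod (\<gamma> [e]))\<^sup>2 + (norm (P [e]))\<^sup>2 = D" for e
  proof -
    have "of_real (D * (cmod (\<gamma> [e]))\<^sup>2 + (norm (P [e]))\<^sup>2) = (of_real D :: complex)"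
      using step[of e "[]" "[]"] by (simp add: \<gamma>_Nil cinner_self flip: complex_norm_square)
    then show ?thesis by (simp only: of_real_eq_iff)
  qed
  have FT: "of_real D * r * cnj s + cinner (P [False]) (P [True]) = 0"
    using prefix_kernel[of "[True]" "[False]"] by (simp add: r_def s_def algebra_simps add_eq_0_iff)
  have r: "cmod r < 1"
  proof (rule ccontr)
    assume "\<not> cmod r < 1"
    then have "D * 1 \<le> D * (cmod r)\<^sup>2"
      using D by (intro mult_left_mono) auto
    then have "(norm (P [False]))\<^sup>2 \<le> 0"
      using ee[of False] unfolding r_def by linarith
    then have "P [False] = 0" by simp
    then have "r = 0"
      using e0[of False] D(1) by (simp add: r_def)
    with \<open>\<not> cmod r < 1\<close> show False by simp
  qed
  show ?thesis
  proof
    show "frame D (P []) (P [False]) (P [True]) r s"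
      using e0[of False] e0[of True] ee[of False] ee[of True] FT r
      by (simp add: frame_def r_def s_def)
    show "P (False # z) = weight r s z *s P [False]" "P (True # z) = weight r s z *s P [True]" for z
      using split[of False z] split[of True z] by (simp_all add: weight)
  qed
qed

text \<open>The squared norm \<open>B\<close> of the fiber over \<open>[]\<close> is already exhausted by its first entry, and
  the squared norm of any other fiber, a diagonal value of the kernel, cannot be positive.\<close>

lemma word_orth_degenerate:
  assumes "B > 0" and a: "(norm (P []))\<^sup>2 \<ge> B"
    and l2: "\<And>w. square_summable (fiber P w)" and orth: "word_orth B P"
  shows "(norm (P []))\<^sup>2 = B \<and> (\<forall>e z. P (e # z) = 0)"
proof -
  have id: "shift 0 f = f" for f :: "nat \<Rightarrow> complex ^ 2"
    by (auto simp: shift_def)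
  have "seq_inner (fiber P []) (fiber P []) = of_real B"
    using orth unfolding word_orth_def by (metis id)
  then have sums: "(\<lambda>k. (norm (fiber P [] k))\<^sup>2) sums B"
    using seq_inner_self_sums[OF l2] by (metis Re_complex_of_real)
  have "(\<Sum>k\<in>{0, Suc k}. (norm (fiber P [] k))\<^sup>2) \<le> B" for k
    using sum_le_suminf[of "\<lambda>k. (norm (fiber P [] k))\<^sup>2" "{0, Suc k}"] sums by (simp add: sums_iff)
  then have le: "(norm (P []))\<^sup>2 + (norm (fiber P [] (Suc k)))\<^sup>2 \<le> B" for k
    by (simp add: fiber_def)
  then have B: "(norm (P []))\<^sup>2 = B" and "(norm (fiber P [] (Suc k)))\<^sup>2 \<le> 0" for k
    using a by (smt (verit) zero_le_power2)+
  then have A: "fiber P [] (Suc k) = 0" for k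
    by simp
  have prefix_kernel_le: "Re (prefix_kernel B P y y) \<le> 0" for y
    using B by (induction y) (auto simp: cinner_self intro: order_trans[OF _ zero_le_power2])
  have G: "fiber P (True # y) k = 0" for y k
  proof -
    have "seq_inner (fiber P (True # y)) (fiber P (True # y)) = prefix_kernel B P y y"
      using orth unfolding word_orth_def by (metis id)
    then have "(norm (fiber P (True # y) k))\<^sup>2 \<le> Re (prefix_kernel B P y y)"
      using norm_le_seq_inner[OF l2, of "True # y" k] by (simp only:)
    then have "(norm (fiber P (True # y) k))\<^sup>2 \<le> 0"
      using prefix_kernel_le[of y] by (rule order_trans)
    then show ?thesis by simp
  qed
  have "P (e # z) = 0" for e z
  proof (cases "e # z" rule: word_cases)
    case (1 k)
    then show ?thesis
      using A[of "k - 1"] by (cases k) (auto simp: fiber_def)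
  next
    case (2 k z')
    then show ?thesis
      using G[of z' k] by (simp add: fiber_def)
  qed
  with B show ?thesis by blast
qed

text \<open>The degenerate solution \<open>\<parallel>a\<parallel>\<^sup>2 = B\<close> is included as the frame with \<open>D = 0\<close>, which forces
  \<open>b = c = 0\<close>.\<close>

theorem word_orth_iff_frame:
  assumes "B > 0" and l2: "\<And>w. square_summable (fiber P w)"
  shows "word_orth B P \<longleftrightarrow>
    (\<exists>a b c r s. (norm a)\<^sup>2 \<le> B \<and> frame (B - (norm a)\<^sup>2) a b c r s \<and>
       fiber P [] = geometric a b r \<and> (\<forall>z. fiber P (True # z) = (\<lambda>k. weight r s z *s geometric c (s *s b) r k)))"
    (is "_ \<longleftrightarrow> ?R")
proof
  assume orth: "word_orth B P"
  have "\<exists>a b c r s. (norm a)\<^sup>2 \<le> B \<and> frame (B - (norm a)\<^sup>2) a b c r s \<and>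
      P [] = a \<and> (\<forall>z. P (False # z) = weight r s z *s b) \<and> (\<forall>z. P (True # z) = weight r s z *s c)"
  proof (cases "(norm (P []))\<^sup>2 \<ge> B")
    case True
    with word_orth_degenerate[OF assms(1) True l2 orth] show ?thesis
      by (intro exI[of _ "P []"] exI[of _ 0]) (simp add: frame_def)
  next
    case False
    then show ?thesis
      using word_orth_imp_multiplicative[OF \<open>B > 0\<close> _ refl l2 orth]
      by (metis diff_gt_0_iff_gt less_eq_real_def linorder_not_le)
  qed
  then show ?R
    unfolding multiplicative_iff_fibers_geometric .
next
  assume ?R
  then show "word_orth B P"
    unfolding multiplicative_iff_fibers_geometric[symmetric]
    by (metis word_orth_multiplicative)
qed


section \<open>From functions on the circle to coefficients\<close>

lemma borel_measurable_scale:
  fixes a :: "'a \<Rightarrow> complex" and f :: "'a \<Rightarrow> complex ^ 2"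
  assumes "a \<in> borel_measurable M" "f \<in> borel_measurable M"
  shows "(\<lambda>x. a x *s f x) \<in> borel_measurable M"
proof (rule borel_measurable_continuous_Pair[OF assms])
  show "continuous_on UNIV (\<lambda>x::complex \<times> (complex ^ 2). fst x *s snd x)"
    unfolding vector_scalar_mult_def by (intro continuous_intros)
qed

lemma borel_measurable_power_circle: "(\<lambda>\<omega>::complex. \<omega> ^ k) \<in> borel_measurable circle"
  by (intro borel_measurable_circleI borel_measurable_continuous_onI continuous_intros)

lemma borel_measurable_partial_sum:
  fixes c :: "nat \<Rightarrow> complex ^ 2"
  shows "(\<lambda>\<omega>. \<Sum>k<n. \<omega> ^ k *s c k) \<in> borel_measurable circle"
  by (intro borel_measurable_sum borel_measurable_scale borel_measurable_power_circle
      borel_measurable_const)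

lemma nn_integral_circle_const: "(\<integral>\<^sup>+ \<omega>. c \<partial>circle) = c"
  by (simp add: emeasure_circle_space)

lemma hardy_series_shift:
  assumes "hardy_series f c"
  shows "hardy_series (\<lambda>\<omega>. \<omega> ^ m *s f \<omega>) (shift m c)"
proof -
  let ?I = "\<lambda>f c n. \<integral>\<^sup>+ \<omega>. ennreal ((norm (f \<omega> - (\<Sum>k<n. \<omega> ^ k *s c k)))\<^sup>2) \<partial>circle"
  have "?I (\<lambda>\<omega>. \<omega> ^ m *s f \<omega>) (shift m c) (n + m) = ?I f c n" for n
  proof (rule nn_integral_cong)
    fix \<omega> assume "\<omega> \<in> space circle"
    then have "cmod \<omega> = 1"
      by (simp add: space_circle)
    have "(\<Sum>k<n + m. \<omega> ^ k *s shift m c k) = (\<Sum>k\<in>(+) m ` {..<n}. \<omega> ^ k *s shift m c k)"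
    proof (rule sum.mono_neutral_right)
      have "k \<in> (+) m ` {..<n}" if "k < n + m" "m \<le> k" for k
        using that by (intro image_eqI[of _ _ "k - m"]) auto
      then show "\<forall>k\<in>{..<n + m} - (+) m ` {..<n}. \<omega> ^ k *s shift m c k = 0"
        by (force simp: shift_def)
    qed auto
    also have "\<dots> = \<omega> ^ m *s (\<Sum>k<n. \<omega> ^ k *s c k)"
      by (subst sum.reindex) (auto simp: shift_def vec.scale_sum_right power_add)
    finally have "\<omega> ^ m *s f \<omega> - (\<Sum>k<n + m. \<omega> ^ k *s shift m c k) = \<omega> ^ m *s (f \<omega> - (\<Sum>k<n. \<omega> ^ k *s c k))"
      by (simp add: vec.scale_right_diff_distrib)
    then show "ennreal ((norm (\<omega> ^ m *s f \<omega> - (\<Sum>k<n + m. \<omega> ^ k *s shift m c k)))\<^sup>2)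
        = ennreal ((norm (f \<omega> - (\<Sum>k<n. \<omega> ^ k *s c k)))\<^sup>2)"
      using \<open>cmod \<omega> = 1\<close> by (simp only: norm_scale norm_power) simp
  qed
  then have "(\<lambda>n. ?I (\<lambda>\<omega>. \<omega> ^ m *s f \<omega>) (shift m c) (n + m)) \<longlonglongrightarrow> 0"
    using assms by (simp add: hardy_series_def)
  then have "?I (\<lambda>\<omega>. \<omega> ^ m *s f \<omega>) (shift m c) \<longlonglongrightarrow> 0"
    by (rule LIMSEQ_offset)
  moreover have "summable (\<lambda>k. (norm (shift m c k))\<^sup>2)"
    using assms square_summable_shift[of c m] by (simp add: hardy_series_def square_summable_def)
  ultimately show ?thesis
    using assms by (simp add: hardy_series_def borel_measurable_scale borel_measurable_power_circle)
qed

lemma hardy_series_scale: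
  assumes "hardy_series f c"
  shows "hardy_series (\<lambda>\<omega>. a *s f \<omega>) (\<lambda>k. a *s c k)"
proof -
  have f: "f \<in> borel_measurable circle"
    using assms by (simp add: hardy_series_def)
  let ?I = "\<lambda>f c n. \<integral>\<^sup>+ \<omega>. ennreal ((norm (f \<omega> - (\<Sum>k<n. \<omega> ^ k *s c k)))\<^sup>2) \<partial>circle"
  have "?I (\<lambda>\<omega>. a *s f \<omega>) (\<lambda>k. a *s c k) n = ennreal ((cmod a)\<^sup>2) * ?I f c n" for n
  proof -
    have "a *s f \<omega> - (\<Sum>k<n. \<omega> ^ k *s (a *s c k)) = a *s (f \<omega> - (\<Sum>k<n. \<omega> ^ k *s c k))" for \<omega>
      by (simp add: vec.scale_right_diff_distrib vec.scale_sum_right mult.commute)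
    then show ?thesis
      using f borel_measurable_partial_sum[of c n]
      by (subst nn_integral_cmult[symmetric])
         (auto simp only: norm_scale power_mult_distrib ennreal_mult zero_le_power2, measurable)
  qed
  moreover have "(\<lambda>n. ennreal ((cmod a)\<^sup>2) * ?I f c n) \<longlonglongrightarrow> ennreal ((cmod a)\<^sup>2) * 0"
    using assms by (intro ennreal_tendsto_cmult) (auto simp: hardy_series_def)
  ultimately have "?I (\<lambda>\<omega>. a *s f \<omega>) (\<lambda>k. a *s c k) \<longlonglongrightarrow> 0"
    by simp
  moreover have "summable (\<lambda>k. (norm (a *s c k))\<^sup>2)"
    using assms square_summable_scale[of c a] by (simp add: hardy_series_def square_summable_def)
  ultimately show ?thesis
    using f by (simp add: hardy_series_def borel_measurable_scale)
qed

text \<open>The partial sums converge uniformly on the circle, hence in \<open>L\<^sup>2\<close>. This covers the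
  polynomials and the geometric series in the types.\<close>

lemma hardy_series_absolutely_convergent:
  fixes d :: "nat \<Rightarrow> complex ^ 2"
  assumes d: "summable (\<lambda>k. norm (d k))"
    and g: "\<And>\<omega>. cmod \<omega> = 1 \<Longrightarrow> (\<lambda>k. \<omega> ^ k *s d k) sums g \<omega>"
  shows "hardy_series g d"
proof -
  have meas: "g \<in> borel_measurable circle"
    using g by (intro borel_measurable_LIMSEQ_metric[OF borel_measurable_partial_sum[of d]])
      (auto simp: space_circle sums_def)
  have "eventually (\<lambda>k. norm (d k) < 1) sequentially"
    using summable_LIMSEQ_zero[OF d] by (rule order_tendstoD) simp
  then have "eventually (\<lambda>k. norm ((norm (d k))\<^sup>2) \<le> norm (d k)) sequentially"
    by eventually_elim (simp add: power2_eq_square mult_left_le)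
  then have sq: "summable (\<lambda>k. (norm (d k))\<^sup>2)"
    using d by (rule summable_comparison_test_ev)
  define t where "t n = (\<Sum>k. norm (d (k + n)))" for n
  have "t = (\<lambda>n. (\<Sum>k. norm (d k)) - (\<Sum>k<n. norm (d k)))"
    using suminf_minus_initial_segment[OF d] by (auto simp: t_def fun_eq_iff)
  moreover have "(\<lambda>n. (\<Sum>k. norm (d k)) - (\<Sum>k<n. norm (d k))) \<longlonglongrightarrow> (\<Sum>k. norm (d k)) - (\<Sum>k. norm (d k))"
    by (intro tendsto_intros summable_LIMSEQ d)
  ultimately have "t \<longlonglongrightarrow> 0" by simp
  then have "(\<lambda>n. ennreal ((t n)\<^sup>2)) \<longlonglongrightarrow> ennreal (0\<^sup>2)"
    by (intro tendsto_ennrealI tendsto_power)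
  then have t: "(\<lambda>n. ennreal ((t n)\<^sup>2)) \<longlonglongrightarrow> 0" by simp
  have le: "(\<integral>\<^sup>+ \<omega>. ennreal ((norm (g \<omega> - (\<Sum>k<n. \<omega> ^ k *s d k)))\<^sup>2) \<partial>circle) \<le> ennreal ((t n)\<^sup>2)" for n
  proof -
    have "norm (g \<omega> - (\<Sum>k<n. \<omega> ^ k *s d k)) \<le> t n" if "\<omega> \<in> space circle" for \<omega>
    proof -
      have \<omega>: "cmod \<omega> = 1"
        using that by (simp add: space_circle)
      have "g \<omega> - (\<Sum>k<n. \<omega> ^ k *s d k) = (\<Sum>k. \<omega> ^ (k + n) *s d (k + n))"
        using suminf_minus_initial_segment[of "\<lambda>k. \<omega> ^ k *s d k" n] g[OF \<omega>] by (simp add: sums_iff)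
      moreover have "norm (\<Sum>k. \<omega> ^ (k + n) *s d (k + n)) \<le> (\<Sum>k. norm (\<omega> ^ (k + n) *s d (k + n)))"
        using d by (intro summable_norm) (simp add: norm_scale norm_power \<omega> summable_iff_shift[of "\<lambda>k. norm (d k)"])
      ultimately show ?thesis
        by (simp add: t_def norm_scale norm_power \<omega>)
    qed
    then have "(\<integral>\<^sup>+ \<omega>. ennreal ((norm (g \<omega> - (\<Sum>k<n. \<omega> ^ k *s d k)))\<^sup>2) \<partial>circle) \<le> (\<integral>\<^sup>+ \<omega>. ennreal ((t n)\<^sup>2) \<partial>circle)"
      by (intro nn_integral_mono ennreal_leI power_mono) auto
    then show ?thesis
      unfolding nn_integral_circle_const .
  qed
  have "(\<lambda>n. \<integral>\<^sup>+ \<omega>. ennreal ((norm (g \<omega> - (\<Sum>k<n. \<omega> ^ k *s d k)))\<^sup>2) \<partial>circle) \<longlonglongrightarrow> 0"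
    by (rule tendsto_sandwich[OF _ _ tendsto_const t]) (auto simp: le)
  with meas sq show ?thesis
    by (simp add: hardy_series_def)
qed

text \<open>The \<open>L\<^sup>2\<close> distance of two functions with the same coefficients is controlled by the
  distances to the common partial sums. The other direction is uniqueness of the coefficients.\<close>

lemma AE_eq_iff_coeff_eq:
  assumes f: "hardy_series f c" and g: "hardy_series g d"
  shows "(AE \<omega> in circle. f \<omega> = g \<omega>) \<longleftrightarrow> c = d"
proof
  assume "AE \<omega> in circle. f \<omega> = g \<omega>"
  then have "(\<integral>\<^sup>+ \<omega>. ennreal ((norm (f \<omega> - (\<Sum>k<n. \<omega> ^ k *s d k)))\<^sup>2) \<partial>circle)
      = (\<integral>\<^sup>+ \<omega>. ennreal ((norm (g \<omega> - (\<Sum>k<n. \<omega> ^ k *s d k)))\<^sup>2) \<partial>circle)" for n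
    by (intro nn_integral_cong_AE) (auto elim: eventually_mono)
  then have "hardy_series f d"
    using f g by (simp add: hardy_series_def)
  with f show "c = d"
    by (rule hardy_series_unique)
next
  assume "c = d"
  define p where "p n \<omega> = (\<Sum>k<n. \<omega> ^ k *s c k)" for n \<omega>
  have p: "p n \<in> borel_measurable circle" for n
    unfolding p_def by (rule borel_measurable_partial_sum)
  have meas: "f \<in> borel_measurable circle" "g \<in> borel_measurable circle"
    using f g by (simp_all add: hardy_series_def)
  define I where "I h n = (\<integral>\<^sup>+ \<omega>. ennreal ((norm (h \<omega> - p n \<omega>))\<^sup>2) \<partial>circle)" for h n
  have I: "I f \<longlonglongrightarrow> 0" "I g \<longlonglongrightarrow> 0"
    using f g \<open>c = d\<close> by (simp_all add: hardy_series_def I_def[abs_def] p_def)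
  have "(\<integral>\<^sup>+ \<omega>. ennreal ((norm (f \<omega> - g \<omega>))\<^sup>2) \<partial>circle) \<le> 2 * I f n + 2 * I g n" for n
  proof -
    have "ennreal ((norm (f \<omega> - g \<omega>))\<^sup>2)
        \<le> 2 * ennreal ((norm (f \<omega> - p n \<omega>))\<^sup>2) + 2 * ennreal ((norm (g \<omega> - p n \<omega>))\<^sup>2)" for \<omega>
    proof -
      have "norm (f \<omega> - g \<omega>) \<le> norm (f \<omega> - p n \<omega>) + norm (g \<omega> - p n \<omega>)"
        using norm_triangle_ineq4[of "f \<omega> - p n \<omega>" "g \<omega> - p n \<omega>"] by simp
      then have "(norm (f \<omega> - g \<omega>))\<^sup>2 \<le> (norm (f \<omega> - p n \<omega>) + norm (g \<omega> - p n \<omega>))\<^sup>2"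
        by (intro power_mono) auto
      also have "\<dots> \<le> 2 * (norm (f \<omega> - p n \<omega>))\<^sup>2 + 2 * (norm (g \<omega> - p n \<omega>))\<^sup>2"
        using sum_squares_bound[of "norm (f \<omega> - p n \<omega>)" "norm (g \<omega> - p n \<omega>)"]
        by (simp add: power2_sum)
      finally show ?thesis
        by (subst (1 2) ennreal_numeral[symmetric], subst (1 2) ennreal_mult[symmetric])
           (simp_all only: ennreal_plus[symmetric] ennreal_leI zero_le_numeral zero_le_power2 mult_nonneg_nonneg)
    qed
    then have "(\<integral>\<^sup>+ \<omega>. ennreal ((norm (f \<omega> - g \<omega>))\<^sup>2) \<partial>circle)
        \<le> (\<integral>\<^sup>+ \<omega>. 2 * ennreal ((norm (f \<omega> - p n \<omega>))\<^sup>2) + 2 * ennreal ((norm (g \<omega> - p n \<omega>))\<^sup>2) \<partial>circle)"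
      by (rule nn_integral_mono)
    also have "\<dots> = 2 * I f n + 2 * I g n"
      unfolding I_def using meas p[of n] by (simp add: nn_integral_add nn_integral_cmult)
    finally show ?thesis .
  qed
  moreover have "(\<lambda>n. 2 * I f n + 2 * I g n) \<longlonglongrightarrow> 2 * 0 + 2 * 0"
    using I by (intro tendsto_add ennreal_tendsto_cmult) auto
  ultimately have "(\<integral>\<^sup>+ \<omega>. ennreal ((norm (f \<omega> - g \<omega>))\<^sup>2) \<partial>circle) \<le> 2 * 0 + 2 * 0"
    by (intro LIMSEQ_le_const) auto
  then have "(\<integral>\<^sup>+ \<omega>. ennreal ((norm (f \<omega> - g \<omega>))\<^sup>2) \<partial>circle) = 0"
    by simp
  then have "AE \<omega> in circle. ennreal ((norm (f \<omega> - g \<omega>))\<^sup>2) = 0"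
    using meas by (subst (asm) nn_integral_0_iff_AE) auto
  then show "AE \<omega> in circle. f \<omega> = g \<omega>"
    by eventually_elim (simp add: ennreal_eq_0_iff)
qed

lemma geometric_sums:
  fixes x y :: "complex ^ 2"
  assumes "cmod r < 1" "cmod \<omega> = 1"
  shows "(\<lambda>k. \<omega> ^ k *s geometric x y r k) sums (x + (\<Sum>k. \<omega> ^ (k + 1) * r ^ k) *s y)"
proof -
  have "summable (\<lambda>k. \<omega> * (\<omega> * r) ^ k)"
    using assms by (intro summable_mult summable_geometric) (simp add: norm_mult)
  then have "(\<lambda>k. \<omega> ^ (k + 1) * r ^ k) sums (\<Sum>k. \<omega> ^ (k + 1) * r ^ k)"
    by (intro summable_sums) (simp add: power_mult_distrib mult_ac)
  then have sums: "(\<lambda>k. \<omega> ^ (k + 1) * r ^ k) sums (\<Sum>k. \<omega> ^ (k + 1) * r ^ k)" .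
  have lin: "bounded_linear (\<lambda>a. a *s y)"
  proof (rule bounded_linear_intro[of _ "norm y"])
    show "norm (a *s y) \<le> norm a * norm y" for a :: complex
      by (simp add: norm_scale)
  qed (auto simp: vec.scale_left_distrib vec_eq_iff)
  have "(\<lambda>k. (\<omega> ^ (k + 1) * r ^ k) *s y) sums ((\<Sum>k. \<omega> ^ (k + 1) * r ^ k) *s y)"
    by (rule bounded_linear.sums[OF lin sums])
  then have "(\<lambda>k. \<omega> ^ Suc k *s geometric x y r (Suc k)) sums ((\<Sum>k. \<omega> ^ (k + 1) * r ^ k) *s y)"
    by simp
  from sums_Suc[OF this] show ?thesis
    by (simp add: add.commute)
qed

lemma AE_eq_geometric_iff:
  assumes "hardy_series f c" "cmod r < 1"
  shows "(AE \<omega> in circle. f \<omega> = x + (\<Sum>k. \<omega> ^ (k + 1) * r ^ k) *s y) \<longleftrightarrow> c = geometric x y r"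
  by (intro AE_eq_iff_coeff_eq assms hardy_series_absolutely_convergent summable_norm_geometric geometric_sums)

lemma hardy_inner_shift:
  assumes "hardy_series f c" "hardy_series g d"
  shows "hardy_inner (\<lambda>\<omega>. \<omega> ^ m *s f \<omega>) (\<lambda>\<omega>. \<omega> ^ n *s g \<omega>) = seq_inner (shift m c) (shift n d)"
  unfolding hardy_inner_def seq_inner_def
  using assms by (simp add: hardy_coeff_eq[OF hardy_series_shift])

text \<open>Multiplication by \<open>\<omega>^m\<close> shifts the coefficients, so the conditions on functions are
  conditions on fibers.\<close>

lemma orthogonality_conditions_iff_word_orth:
  assumes h0: "hardy_series (\<hh> 0) (fiber (\<Psi> \<circ> word_num) [])"
    and h: "\<And>y. hardy_series (\<hh> (word_num y)) (fiber (\<Psi> \<circ> word_num) (True # y))"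
  shows "orthogonality_conditions B \<hh> \<Psi> \<longleftrightarrow> word_orth B (\<Psi> \<circ> word_num)"
proof -
  have split: "(\<forall>l. Q l) \<longleftrightarrow> Q 0 \<and> (\<forall>y. Q (word_num y))" for Q :: "nat \<Rightarrow> bool"
    using word_num_surj by (metis One_nat_def Suc_leI neq0_conv)
  have [simp]: "word_num y \<noteq> 0" for y
    using word_num_pos[of y] by simp
  have beta0: "beta B \<Psi> 0 0 = of_real B" "beta B \<Psi> (word_num y) 0 = 0" "beta B \<Psi> 0 (word_num y) = 0" for y
    by (simp_all add: beta_def)
  have delta: "delta (int m - int n) * x = (if m = n then x else 0)" for m n x
    by (simp add: delta_def)
  show ?thesis
    unfolding orthogonality_conditions_def word_orth_def split 
      hardy_inner_shift[OF h0 h0] hardy_inner_shift[OF h0 h] hardy_inner_shift[OF h h0] hardy_inner_shift[OF h h]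
      beta0 beta_word_num delta if_cancel
    by (auto simp del: comp_apply)
qed


lemma suminf_ratio_0: "(\<Sum>k. \<omega> ^ (k + 1) * 0 ^ k) = \<omega>" for \<omega> :: complex
  using sums_unique[OF powser_sums_zero[of "\<lambda>k. \<omega> ^ (k + 1)"]] by simp

section \<open>The product rule\<close>

text \<open>For \<open>l \<ge> 1\<close> this is the factor between \<open>\<hh> 1\<close> and \<open>\<hh> l\<close> in a family given by a frame.\<close>

definition weight_at :: "complex \<Rightarrow> complex \<Rightarrow> nat \<Rightarrow> complex" where
  "weight_at r s l = weight r s (inv word_num l)"

lemma weight_at_word_num [simp]: "weight_at r s (word_num y) = weight r s y"
  by (simp add: weight_at_def inv_f_f[OF inj_word_num])

lemma weight_at_power: "weight_at r s (2 ^ p) = r ^ p"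
  using weight_at_word_num[of r s "replicate p False"] by (simp add: word_num_replicate_False)

lemma weight_at_1: "weight_at r s 1 = 1"
  using weight_at_power[of r s 0] by simp

lemma word_num_gap: "word_num (replicate k False @ True # y) = 2 ^ (length y + k + 1) + word_num y"
  using word_num_append[of "replicate k False" "True # y"] by (simp add: word_num_replicate_False power_add)

lemma weight_at_power_plus_1:
  assumes "p > 0"
  shows "weight_at r s (2 ^ p + 1) = s * r ^ (p - 1)"
proof -
  have "2 ^ p + 1 = word_num (replicate (p - 1) False @ [True])"
    using assms word_num_gap[of "p - 1" "[]"] by simp
  then show ?thesis
    by (simp only: weight_at_word_num) simp
qed

text \<open>A gap of length \<open>g\<close> between two neighbouring digits 1 corresponds to the subword
  \<open>0^(g-1) 1\<close>, whose weight \<open>s r^(g-1)\<close> is that of the number \<open>2^g + 1\<close>; the digits 0 below the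
  last digit 1 contribute the weight of a power of 2.\<close>

lemma weight_at_exponents:
  fixes q :: "nat \<Rightarrow> nat"
  assumes "\<forall>i<n. q (i + 1) < q i"
  shows "weight_at r s (\<Sum>i\<le>n. 2 ^ q i) = (\<Prod>i=1..n. weight_at r s (2 ^ (q (i - 1) - q i) + 1)) * weight_at r s (2 ^ q n)"
proof -
  have "\<exists>y. length y = q 0 \<and> word_num y = (\<Sum>i\<le>n. 2 ^ q i) \<and>
      weight r s y = (\<Prod>i=1..n. s * r ^ (q (i - 1) - q i - 1)) * r ^ q n"
    using assms
  proof (induction n arbitrary: q)
    case 0
    show ?case
      by (intro exI[of _ "replicate (q 0) False"]) (simp add: word_num_replicate_False)
  next
    case (Suc n)
    from Suc.IH[of "\<lambda>i. q (Suc i)"] Suc.prems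
    obtain y where y: "length y = q 1" "word_num y = (\<Sum>i\<le>n. 2 ^ q (Suc i))"
      "weight r s y = (\<Prod>i=1..n. s * r ^ (q (Suc (i - 1)) - q (Suc i) - 1)) * r ^ q (Suc n)"
      by auto
    \<comment> \<open>the digits 0 strictly between the two highest digits 1\<close>
    let ?k = "q 0 - q 1 - 1"
    let ?y = "replicate ?k False @ True # y"
    have gap: "q 1 < q 0"
      using Suc.prems by auto
    have word_num: "word_num ?y = (\<Sum>i\<le>Suc n. 2 ^ q i)"
      unfolding word_num_gap sum.atMost_Suc_shift y using gap by simp
    have prod: "(\<Prod>i=1..Suc n. s * r ^ (q (i - 1) - q i - 1))
        = s * r ^ ?k * (\<Prod>i=1..n. s * r ^ (q (Suc (i - 1)) - q (Suc i) - 1))"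
    proof -
      have "(\<Prod>i=1..Suc n. s * r ^ (q (i - 1) - q i - 1)) = (\<Prod>i=0..n. s * r ^ (q i - q (Suc i) - 1))"
        using prod.atLeast_Suc_atMost_Suc_shift[of "\<lambda>i. s * r ^ (q (i - 1) - q i - 1)" 0 n] by simp
      also have "\<dots> = s * r ^ ?k * (\<Prod>i=1..n. s * r ^ (q i - q (Suc i) - 1))"
        by (subst prod.atLeast_Suc_atMost) simp_all
      also have "(\<Prod>i=1..n. s * r ^ (q i - q (Suc i) - 1)) = (\<Prod>i=1..n. s * r ^ (q (Suc (i - 1)) - q (Suc i) - 1))"
        by (intro prod.cong) auto
      finally show ?thesis .
    qed
    have "weight r s ?y = (\<Prod>i=1..Suc n. s * r ^ (q (i - 1) - q i - 1)) * r ^ q (Suc n)"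
      unfolding prod weight_simps y(3) by simp
    with word_num gap y(1) show ?case
      by (intro exI[of _ ?y]) simp
  qed
  then obtain y where y: "word_num y = (\<Sum>i\<le>n. 2 ^ q i)"
      "weight r s y = (\<Prod>i=1..n. s * r ^ (q (i - 1) - q i - 1)) * r ^ q n"
    by auto
  have "weight_at r s (2 ^ (q (i - 1) - q i) + 1) = s * r ^ (q (i - 1) - q i - 1)" if "i \<in> {1..n}" for i
  proof (rule weight_at_power_plus_1)
    from that have "i - 1 < n" "i - 1 + 1 = i" by auto
    then have "q i < q (i - 1)" using assms by metis
    then show "0 < q (i - 1) - q i" by simp
  qed
  then show ?thesis
    unfolding y(1)[symmetric] weight_at_word_num y(2) weight_at_power by simp
qed

lemma product_rule_weight_at:
  assumes "C1 \<noteq> 0"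
  shows "product_rule (\<lambda>l. C1 * weight_at r s l)"
  unfolding product_rule_def
proof (intro allI impI conjI; elim conjE)
  fix l n :: nat and q :: "nat \<Rightarrow> nat"
  assume dec: "\<forall>i<n. q (i + 1) < q i" and l: "l = (\<Sum>i\<le>n. 2 ^ q i)" and "l \<ge> 2"
  note weight_at = weight_at_exponents[OF dec, of r s, folded l]
  show "C1 * weight_at r s l = (C1 * weight_at r s 1) powi - (int n - 1)
      * (\<Prod>i=1..n - 1. C1 * weight_at r s (2 ^ (q (i - 1) - q i) + 1)) * (C1 * weight_at r s (2 ^ q (n - 1) + 1))"
    if "q n = 0"
  proof -
    from \<open>l \<ge> 2\<close> l that obtain n' where n: "n = Suc n'"
      by (cases n) auto
    show ?thesis
      using assms \<open>q n = 0\<close> weight_at weight_at_power[of r s 0]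
      by (simp add: n prod.distrib weight_at_1[unfolded One_nat_def] power_int_minus field_simps)
  qed
  show "C1 * weight_at r s l = (C1 * weight_at r s 1) powi - int n
      * (\<Prod>i=1..n. C1 * weight_at r s (2 ^ (q (i - 1) - q i) + 1)) * (C1 * weight_at r s (2 ^ q n))"
    using assms weight_at by (simp add: prod.distrib weight_at_1[unfolded One_nat_def] power_int_minus field_simps)
qed

lemma binary_exponents:
  fixes l :: nat
  assumes "l \<ge> 1"
  obtains n and q :: "nat \<Rightarrow> nat" where "\<forall>i<n. q (i + 1) < q i" "l = (\<Sum>i\<le>n. 2 ^ q i)"
  using assms
proof (induction l arbitrary: thesis rule: less_induct)
  case (less l)
  define p where "p = floor_log l"
  have p: "2 ^ p \<le> l" "l < 2 * 2 ^ p"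
    using floor_log_exp2_le[of l] floor_log_exp2_gt[of l] less.prems by (simp_all add: p_def)
  show ?case
  proof (cases "l = 2 ^ p")
    case True
    then show ?thesis
      using less.prems(1)[of 0 "\<lambda>_. p"] by simp
  next
    case False
    with p have "l - 2 ^ p < l" "l - 2 ^ p \<ge> 1"
      by auto
    from less.IH[OF this(1) _ this(2)] obtain n and q :: "nat \<Rightarrow> nat" where q: "\<forall>i<n. q (i + 1) < q i" "l - 2 ^ p = (\<Sum>i\<le>n. 2 ^ q i)"
      by blast
    have "2 ^ q 0 \<le> (\<Sum>i\<le>n. 2 ^ q i :: nat)"
      by (rule member_le_sum[of 0 "{..n}" "\<lambda>i. 2 ^ q i :: nat"]) auto
    then have "(2 :: nat) ^ q 0 < 2 ^ p"
      using p q(2) by linarith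
    then have "q 0 < p" by simp
    then have "\<forall>i<Suc n. case_nat p q (i + 1) < case_nat p q i"
      using q(1) by (auto simp: less_Suc_eq_0_disj)
    moreover have "l = (\<Sum>i\<le>Suc n. 2 ^ case_nat p q i)"
      unfolding sum.atMost_Suc_shift using q(2) p by simp
    ultimately show ?thesis
      by (rule less.prems(1))
  qed
qed

text \<open>The product rule expresses \<open>C l\<close> through the values at \<open>1\<close>, at powers \<open>2^p\<close> and at
  \<open>2^p + 1\<close>, since the gaps between binary exponents are positive.\<close>

lemma product_rule_unique:
  assumes "product_rule C" "product_rule C'"
    and "C 1 = C' 1" "\<And>p. p > 0 \<Longrightarrow> C (2 ^ p) = C' (2 ^ p)" "\<And>p. p > 0 \<Longrightarrow> C (2 ^ p + 1) = C' (2 ^ p + 1)"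
    and "l \<ge> 1"
  shows "C l = C' l"
proof (cases "\<exists>k. l = 2 ^ k \<or> l = 2 ^ k + 1")
  case True
  then obtain k where "l = 2 ^ k \<or> l = 2 ^ k + 1" by blast
  then show ?thesis
    using assms(3) assms(4,5)[of k] assms(4)[of 1] by (cases "k = 0") (auto simp: numeral_2_eq_2)
next
  case False
  from \<open>l \<ge> 1\<close> obtain n and q :: "nat \<Rightarrow> nat"
    where q: "\<forall>i<n. q (i + 1) < q i" "l = (\<Sum>i\<le>n. 2 ^ q i)"
    by (rule binary_exponents)
  have "l \<noteq> 2 ^ 0" using False by blast
  with \<open>l \<ge> 1\<close> have "l \<ge> 2" by simp
  have gap: "q (i - 1) - q i > 0" if "i \<in> {1..n}" for i
  proof -
    from that have "i - 1 < n" "i - 1 + 1 = i" by auto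
    then have "q i < q (i - 1)" using q(1) by metis
    then show ?thesis by simp
  qed
  have prods: "(\<Prod>i=1..m. C (2 ^ (q (i - 1) - q i) + 1)) = (\<Prod>i=1..m. C' (2 ^ (q (i - 1) - q i) + 1))" if "m \<le> n" for m
    using that by (intro prod.cong refl assms(5) gap) auto
  show ?thesis
  proof (cases "q n = 0")
    case True
    have "n \<noteq> 0"
    proof
      assume "n = 0"
      then have "l = 2 ^ q 0" using q by simp
      with False show False by blast
    qed
    with gap[of n] have "q (n - 1) > 0" by simp
    then have last: "C (2 ^ q (n - 1) + 1) = C' (2 ^ q (n - 1) + 1)" by (rule assms(5))
    have rule: "X l = X 1 powi - (int n - 1)
        * (\<Prod>i=1..n - 1. X (2 ^ (q (i - 1) - q i) + 1)) * X (2 ^ q (n - 1) + 1)" if "product_rule X" for X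
      using that False \<open>l \<ge> 2\<close> q True unfolding product_rule_def by blast
    with rule[OF assms(1)] rule[OF assms(2)] assms(3) prods[of "n - 1"] last show ?thesis
      by simp
  next
    case nz: False
    then have last: "C (2 ^ q n) = C' (2 ^ q n)" by (intro assms(4)) simp
    have rule: "X l = X 1 powi - int n
        * (\<Prod>i=1..n. X (2 ^ (q (i - 1) - q i) + 1)) * X (2 ^ q n)" if "product_rule X" for X
      using that False \<open>l \<ge> 2\<close> q nz unfolding product_rule_def by blast
    with rule[OF assms(1)] rule[OF assms(2)] assms(3) prods[of n] last show ?thesis
      by simp
  qed
qed


section \<open>Orthonormal bases\<close>

text \<open>Two orthonormal vectors are independent, and \<open>\<complex>\<^sup>2\<close> has dimension 2.\<close>

lemma orthonormal_basis2_iff: "orthonormal_basis2 u v \<longleftrightarrow> norm u = 1 \<and> norm v = 1 \<and> cinner u v = 0"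
proof -
  have "vec.span {u, v} = UNIV" if uv: "norm u = 1" "norm v = 1" "cinner u v = 0"
  proof -
    have "u \<noteq> v"
      using uv by (metis cinner_self_eq_0 norm_zero zero_neq_one)
    have uu: "cinner u u = 1"
      using uv by (simp add: cinner_self)
    have "v \<notin> vec.span {u}"
    proof
      assume "v \<in> vec.span {u}"
      then obtain k where k: "v = k *s u"
        by (auto simp: vec.span_singleton)
      then have "k = 0"
        using uv uu by (simp add: cinner_scale_right)
      with k uv show False by simp
    qed
    moreover have "u \<noteq> 0"
      using uv by auto
    ultimately have "vec.independent {v, u}"
      using \<open>u \<noteq> v\<close> by (simp add: vec.independent_insert)
    then have ind: "vec.independent {u, v}"
      by (simp add: insert_commute)
    have "UNIV \<subseteq> vec.span {u, v}"
    proof (rule vec.card_ge_dim_independent[OF _ ind])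
      show "vec.dim (UNIV :: (complex ^ 2) set) \<le> card {u, v}"
        using \<open>u \<noteq> v\<close> by (simp add: card_cart_basis)
    qed simp
    then show ?thesis by blast
  qed
  then show ?thesis
    by (auto simp: orthonormal_basis2_def)
qed

lemma proportional_if_orthogonal:
  fixes x :: "complex ^ 2"
  assumes "norm u = 1" "norm v = 1" "cinner u v = 0" "cinner x v = 0"
  obtains k where "x = k *s u" "cmod k = norm x"
proof -
  have "x \<in> vec.span {u, v}"
    using assms orthonormal_basis2_iff[of u v] by (simp add: orthonormal_basis2_def)
  then obtain k m where x: "x = k *s u + m *s v"
    by (auto simp: vec.span_insert vec.span_singleton) (metis add.commute diff_add_cancel)
  with assms have "m = 0"
    by (simp add: cinner_add_left cinner_scale_left cinner_self)
  with x assms that[of k] show thesis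
    by (simp add: norm_scale)
qed

lemma polar: "k = of_real (cmod k) * cis (Arg k)"
  by (metis rcis_cmod_Arg rcis_def)

section \<open>Families given by frames\<close>

locale hardy_family =
  fixes B :: real and \<hh> :: "nat \<Rightarrow> complex \<Rightarrow> complex ^ 2" and \<Psi> :: "nat \<Rightarrow> complex ^ 2"
  assumes B_pos: "B > 0"
    and h0: "hardy_series (\<hh> 0) (fiber (\<Psi> \<circ> word_num) [])"
    and h: "\<And>y. hardy_series (\<hh> (word_num y)) (fiber (\<Psi> \<circ> word_num) (True # y))"
begin

text \<open>By \<open>word_orth_iff_frame\<close> these are exactly the families that satisfy the orthogonality
  conditions; a family is of one of the five types if and only if it is of this form.\<close>

definition solution :: "complex ^ 2 \<Rightarrow> complex ^ 2 \<Rightarrow> complex ^ 2 \<Rightarrow> complex \<Rightarrow> complex \<Rightarrow> bool" where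
  "solution a b c r s \<longleftrightarrow> (norm a)\<^sup>2 \<le> B \<and> frame (B - (norm a)\<^sup>2) a b c r s \<and>
     fiber (\<Psi> \<circ> word_num) [] = geometric a b r \<and>
     (\<forall>z. fiber (\<Psi> \<circ> word_num) (True # z) = (\<lambda>k. weight r s z *s geometric c (s *s b) r k))"

lemma orthogonality_conditions_iff_solution:
  "orthogonality_conditions B \<hh> \<Psi> \<longleftrightarrow> (\<exists>a b c r s. solution a b c r s)"
proof -
  have l2: "square_summable (fiber (\<Psi> \<circ> word_num) w)" for w
  proof (cases w rule: word_cases)
    case (1 k)
    have "square_summable (fiber (\<Psi> \<circ> word_num) [])"
      using h0 by (simp add: hardy_series_def square_summable_def)
    then have "summable (\<lambda>i. (norm (fiber (\<Psi> \<circ> word_num) [] (i + k)))\<^sup>2)"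
      unfolding square_summable_def by (rule summable_ignore_initial_segment)
    then show ?thesis
      by (simp add: 1 square_summable_def fiber_def replicate_add)
  next
    case (2 k z)
    have "square_summable (fiber (\<Psi> \<circ> word_num) (True # z))"
      using h by (simp add: hardy_series_def square_summable_def)
    then have "summable (\<lambda>i. (norm (fiber (\<Psi> \<circ> word_num) (True # z) (i + k)))\<^sup>2)"
      unfolding square_summable_def by (rule summable_ignore_initial_segment)
    then show ?thesis
      by (simp add: 2 square_summable_def fiber_def replicate_add)
  qed
  show ?thesis
    unfolding orthogonality_conditions_iff_word_orth[OF h0 h] word_orth_iff_frame[OF B_pos l2] solution_def ..
qed

lemma all_positive_iff: "(\<forall>l\<ge>1. Q l) \<longleftrightarrow> (\<forall>y. Q (word_num y))"
  using word_num_surj word_num_pos by (metis One_nat_def Suc_leI)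

lemma solution_values:
  assumes "solution a b c r s"
  shows "\<Psi> 1 = a" "\<Psi> (word_num (False # z)) = weight r s z *s b" "\<Psi> (word_num (True # z)) = weight r s z *s c"
  using assms multiplicative_iff_fibers_geometric[of "\<Psi> \<circ> word_num" a r s b c] by (auto simp: solution_def)

lemma solution_AE:
  assumes "solution a b c r s"
  shows "AE \<omega> in circle. \<hh> 0 \<omega> = a + (\<Sum>k. \<omega> ^ (k + 1) * r ^ k) *s b"
    and "AE \<omega> in circle. \<hh> (word_num z) \<omega> = weight r s z *s (c + (\<Sum>k. \<omega> ^ (k + 1) * r ^ k) *s (s *s b))"
proof -
  have r: "cmod r < 1"
    using assms by (simp add: solution_def frame_def)
  show "AE \<omega> in circle. \<hh> 0 \<omega> = a + (\<Sum>k. \<omega> ^ (k + 1) * r ^ k) *s b"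
    using assms AE_eq_geometric_iff[OF h0 r] by (simp add: solution_def)
  have "AE \<omega> in circle. \<hh> (word_num z) \<omega> = weight r s z *s c + (\<Sum>k. \<omega> ^ (k + 1) * r ^ k) *s (weight r s z *s (s *s b))"
    using assms by (subst AE_eq_geometric_iff[OF h r]) (auto simp: solution_def scale_geometric)
  then show "AE \<omega> in circle. \<hh> (word_num z) \<omega> = weight r s z *s (c + (\<Sum>k. \<omega> ^ (k + 1) * r ^ k) *s (s *s b))"
    by eventually_elim (simp add: vec.scale_right_distrib mult_ac)
qed

lemma solution_AE_affine:
  assumes "solution a b c 0 s"
  shows "AE \<omega> in circle. \<hh> 0 \<omega> = a + \<omega> *s b"
    and "AE \<omega> in circle. \<hh> (word_num z) \<omega> = weight 0 s z *s (c + \<omega> *s (s *s b))"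
proof -
  from solution_AE[OF assms] show "AE \<omega> in circle. \<hh> 0 \<omega> = a + \<omega> *s b"
    and "AE \<omega> in circle. \<hh> (word_num z) \<omega> = weight 0 s z *s (c + \<omega> *s (s *s b))"
    by (simp_all only: suminf_ratio_0)
qed

text \<open>The converse of \<open>solution_AE\<close>, in the form in which the types present a family: \<open>\<hh> 0\<close>
  and \<open>\<hh> 1\<close> explicitly, and the other functions as multiples of \<open>\<hh> 1\<close>.\<close>

lemma solution_if_proportional:
  assumes "(norm a)\<^sup>2 \<le> B" "frame (B - (norm a)\<^sup>2) a b c r s"
    and A: "AE \<omega> in circle. \<hh> 0 \<omega> = a + (\<Sum>k. \<omega> ^ (k + 1) * r ^ k) *s b"
    and G: "AE \<omega> in circle. \<hh> 1 \<omega> = c + (\<Sum>k. \<omega> ^ (k + 1) * r ^ k) *s (s *s b)"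
    and multiple: "\<And>z. AE \<omega> in circle. \<hh> (word_num z) \<omega> = weight r s z *s \<hh> 1 \<omega>"
  shows "solution a b c r s"
proof -
  have r: "cmod r < 1"
    using assms by (simp add: frame_def)
  have h1: "hardy_series (\<hh> 1) (fiber (\<Psi> \<circ> word_num) [True])"
    using h[of "[]"] by simp
  have F1: "fiber (\<Psi> \<circ> word_num) [True] = geometric c (s *s b) r"
    by (rule iffD1[OF AE_eq_geometric_iff[OF h1 r] G])
  have "fiber (\<Psi> \<circ> word_num) (True # z) = (\<lambda>k. weight r s z *s geometric c (s *s b) r k)" for z
    using iffD1[OF AE_eq_iff_coeff_eq[OF h hardy_series_scale[OF h1]] multiple] unfolding F1 .
  moreover have "fiber (\<Psi> \<circ> word_num) [] = geometric a b r"
    by (rule iffD1[OF AE_eq_geometric_iff[OF h0 r] A])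
  ultimately show ?thesis
    using assms(1,2) by (simp add: solution_def)
qed

lemma solution_if_affine:
  assumes "(norm a)\<^sup>2 \<le> B" "frame (B - (norm a)\<^sup>2) a b c 0 s"
    and A: "AE \<omega> in circle. \<hh> 0 \<omega> = a + \<omega> *s b"
    and G: "AE \<omega> in circle. \<hh> 1 \<omega> = c + \<omega> *s (s *s b)"
    and multiple: "\<And>z. AE \<omega> in circle. \<hh> (word_num z) \<omega> = weight 0 s z *s \<hh> 1 \<omega>"
  shows "solution a b c 0 s"
proof -
  show ?thesis
    using assms by (intro solution_if_proportional) (simp_all only: suminf_ratio_0)
qed

text \<open>With \<open>r = 0\<close> only the positive indices \<open>2^p - 1\<close> carry a nonzero function, with \<open>s = 0\<close>
  only the powers of 2. This is the support condition of types 3 and 4.\<close>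

lemma weight_0_left: "weight 0 s z = (if z = replicate (length z) True then s ^ length z else 0)"
  by (induction z) auto

lemma weight_0_right: "weight r 0 z = (if z = replicate (length z) False then r ^ length z else 0)"
  by (induction z) auto

section \<open>The degenerate types 1 and 2\<close>

lemma type1_imp_solution:
  assumes "type1 B \<hh> \<Psi>"
  shows "\<exists>a b c r s. solution a b c r s"
proof -
  from assms obtain u0 B0 where u0: "norm u0 = 1" "(cmod B0)\<^sup>2 = B"
    and A: "AE \<omega> in circle. \<hh> 0 \<omega> = \<Psi> 1 \<and> \<Psi> 1 = B0 *s u0"
    and G: "\<forall>l\<ge>1. AE \<omega> in circle. \<hh> l \<omega> = 0"
    unfolding type1_def by blast
  have "solution (B0 *s u0) 0 0 0 0"
  proof (rule solution_if_affine)
    show "AE \<omega> in circle. \<hh> 0 \<omega> = B0 *s u0 + \<omega> *s 0"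
      using A by eventually_elim simp
    show "AE \<omega> in circle. \<hh> 1 \<omega> = 0 + \<omega> *s (0 *s 0)"
      using G by simp
    show "AE \<omega> in circle. \<hh> (word_num z) \<omega> = weight 0 0 z *s \<hh> 1 \<omega>" for z
    proof -
      have "AE \<omega> in circle. \<hh> (word_num z) \<omega> = 0" "AE \<omega> in circle. \<hh> 1 \<omega> = 0"
        using G word_num_pos[of z] by (auto simp: Suc_le_eq)
      then show ?thesis by eventually_elim simp
    qed
  qed (use u0 in \<open>auto simp: norm_scale frame_def\<close>)
  then show ?thesis by blast
qed

lemma solution_imp_type1:
  assumes "solution a b c r s" "(norm a)\<^sup>2 = B"
  shows "type1 B \<hh> \<Psi>"
proof -
  have [simp]: "b = 0" "c = 0"
    using assms by (auto simp: solution_def frame_def)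
  have "norm a > 0"
    using assms(2) B_pos by auto
  have "AE \<omega> in circle. \<hh> 0 \<omega> = \<Psi> 1 \<and> \<Psi> 1 = of_real (norm a) *s ((1 / of_real (norm a)) *s a)"
    using solution_AE(1)[OF assms(1)] \<open>norm a > 0\<close> by (simp add: solution_values[OF assms(1), simplified])
  moreover have "\<forall>l\<ge>1. AE \<omega> in circle. \<hh> l \<omega> = 0"
    unfolding all_positive_iff using solution_AE(2)[OF assms(1)] by simp
  ultimately show ?thesis
    using \<open>norm a > 0\<close> assms(2) unfolding type1_def
    by (intro exI[of _ "(1 / of_real (norm a)) *s a"] exI[of _ "of_real (norm a)"])
       (simp add: norm_scale norm_divide)
qed

lemma type2_imp_solution:
  assumes "type2 B \<hh> \<Psi>"
  shows "\<exists>a b c r s. solution a b c r s"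
proof -
  from assms obtain u0 u1 B0 C1 where u: "norm u0 = 1" "norm u1 = 1" "cinner u0 u1 = 0"
    and BC: "(cmod B0)\<^sup>2 = B" "(cmod C1)\<^sup>2 = B"
    and A: "AE \<omega> in circle. \<hh> 0 \<omega> = \<omega> *s \<Psi> 2 \<and> \<omega> *s \<Psi> 2 = \<omega> *s (B0 *s u0)"
    and G1: "AE \<omega> in circle. \<hh> 1 \<omega> = \<Psi> 3 \<and> \<Psi> 3 = C1 *s u1"
    and G: "\<forall>l\<ge>2. AE \<omega> in circle. \<hh> l \<omega> = 0"
    unfolding type2_def orthonormal_basis2_iff by blast
  have "solution 0 (B0 *s u0) (C1 *s u1) 0 0"
  proof (rule solution_if_affine)
    show "AE \<omega> in circle. \<hh> 0 \<omega> = 0 + \<omega> *s (B0 *s u0)"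
      using A by eventually_elim simp
    show "AE \<omega> in circle. \<hh> 1 \<omega> = C1 *s u1 + \<omega> *s (0 *s (B0 *s u0))"
      using G1 by eventually_elim simp
    show "AE \<omega> in circle. \<hh> (word_num z) \<omega> = weight 0 0 z *s \<hh> 1 \<omega>" for z
    proof (cases z)
      case (Cons e z')
then have "word_num z \<ge> 2"
      using word_num_Cons_ge_2 by simp
      with G Cons show ?thesis by simp
    qed simp
  qed (use u BC B_pos in \<open>auto simp: norm_scale power_mult_distrib frame_def cinner_scale_left cinner_scale_right\<close>)
  then show ?thesis by blast
qed

text \<open>For \<open>a = 0\<close> the frame has \<open>D = B\<close> and first coordinates \<open>r = s = 0\<close>.\<close>

lemma solution_imp_type2:
  assumes sol: "solution a b c r s" and a: "a = 0"
  shows "type2 B \<hh> \<Psi>"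
proof -
  have [simp]: "r = 0" "s = 0"
    using sol B_pos by (auto simp: solution_def frame_def a)
  have n: "(norm b)\<^sup>2 = B" "(norm c)\<^sup>2 = B" and bc: "cinner b c = 0"
    using sol by (auto simp: solution_def frame_def a)
  then have pos: "norm b > 0" "norm c > 0"
    using B_pos by auto
  have \<Psi>: "\<Psi> 2 = b" "\<Psi> 3 = c"
    using solution_values(2,3)[OF sol, of "[]"] by (simp_all add: numeral_2_eq_2 numeral_3_eq_3)
  let ?u0 = "(1 / of_real (norm b)) *s b" and ?u1 = "(1 / of_real (norm c)) *s c"
  have scale: "of_real (norm b) *s ?u0 = b" "of_real (norm c) *s ?u1 = c"
    using pos by simp_all
  have "orthonormal_basis2 ?u0 ?u1"
    using pos by (simp add: orthonormal_basis2_iff norm_scale norm_divide cinner_scale_left cinner_scale_right bc)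
  moreover have "AE \<omega> in circle. \<hh> 0 \<omega> = \<omega> *s \<Psi> 2 \<and> \<omega> *s \<Psi> 2 = \<omega> *s (of_real (norm b) *s ?u0)"
    using solution_AE_affine(1)[of a b c s] sol unfolding scale by (simp add: \<Psi> a)
  moreover have "AE \<omega> in circle. \<hh> 1 \<omega> = \<Psi> 3 \<and> \<Psi> 3 = of_real (norm c) *s ?u1"
    using solution_AE_affine(2)[of a b c s "[]"] sol unfolding scale by (simp add: \<Psi>)
  moreover have "AE \<omega> in circle. \<hh> l \<omega> = 0" if "l \<ge> 2" for l
  proof -
    have "l \<ge> 1" using that by simp
    then obtain z where z: "l = word_num z" using word_num_surj by blast
    with that obtain e z' where "z = e # z'" by (cases z) auto
    then show ?thesis
      using solution_AE_affine(2)[of a b c s z] sol z by (simp add: weight_0_left)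
  qed
  ultimately show ?thesis
    using n unfolding type2_def
    by (intro exI[of _ ?u0] exI[of _ ?u1] exI[of _ "of_real (norm b)"] exI[of _ "of_real (norm c)"]) simp
qed

section \<open>Types 3 and 4\<close>

lemma type3_imp_solution:
  assumes "type3 B \<hh> \<Psi>"
  shows "\<exists>a b c r s. solution a b c r s"
proof -
  from assms obtain u0 u1 \<rho> B0 C1 \<theta> where u: "norm u0 = 1" "norm u1 = 1" "cinner u0 u1 = 0"
    and \<rho>: "0 < \<rho>" "\<rho> < 1"
    and BC: "(cmod B0)\<^sup>2 = B" "(cmod C1)\<^sup>2 = B * (1 - \<rho>\<^sup>2)"
    and A: "AE \<omega> in circle. \<hh> 0 \<omega> = \<Psi> 1 + \<omega> *s \<Psi> 2 \<and>
          \<Psi> 1 + \<omega> *s \<Psi> 2 = B0 *s (of_real \<rho> *s u0 + (\<omega> * of_real (sqrt (1 - \<rho>\<^sup>2))) *s u1)"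
    and G1: "AE \<omega> in circle. \<hh> 1 \<omega> = \<Psi> 3 + \<omega> *s \<Psi> 5 \<and>
          \<Psi> 3 + \<omega> *s \<Psi> 5
            = (C1 * cis \<theta>) *s (of_real (sqrt (1 - \<rho>\<^sup>2)) *s u0 - (\<omega> * of_real \<rho>) *s u1)"
    and Gp: "\<forall>p>1. AE \<omega> in circle.
          \<hh> (2 ^ p - 1) \<omega> = \<Psi> (2 ^ p + 2 ^ p - 1) + \<omega> *s \<Psi> (2 ^ (p + 1) + 2 ^ p - 1) \<and>
          \<Psi> (2 ^ p + 2 ^ p - 1) + \<omega> *s \<Psi> (2 ^ (p + 1) + 2 ^ p - 1)
            = ((- (cnj B0 * of_real \<rho> * of_real (sqrt (1 - \<rho>\<^sup>2)) * cis \<theta> / cnj C1)) ^ (p - 1)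
                 * C1 * cis \<theta>)
              *s (of_real (sqrt (1 - \<rho>\<^sup>2)) *s u0 - (\<omega> * of_real \<rho>) *s u1)"
    and G0: "\<forall>l. l \<noteq> 0 \<and> l \<noteq> 1 \<and> (\<forall>p>1. l \<noteq> 2 ^ p - 1) \<longrightarrow> (AE \<omega> in circle. \<hh> l \<omega> = 0)"
    unfolding type3_def orthonormal_basis2_iff by blast
  define q where "q = sqrt (1 - \<rho>\<^sup>2)"
  have "\<rho>\<^sup>2 < 1"
    using \<rho> by (simp add: abs_square_less_1)
  then have q: "q > 0" "q\<^sup>2 = 1 - \<rho>\<^sup>2"
    by (simp_all add: q_def)
  have C1_norm: "(cmod C1)\<^sup>2 = B * q\<^sup>2"
    using BC(2) q(2) by simp
  then have "C1 \<noteq> 0"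
    using q(1) B_pos by auto
  have C1: "C1 * cnj C1 = of_real B * (of_real q)\<^sup>2"
    unfolding complex_norm_square[symmetric] C1_norm by simp
  have B0: "B0 * cnj B0 = of_real B"
    using BC(1) by (simp flip: complex_norm_square)
  define s where "s = - (cnj B0 * of_real \<rho> * of_real q * cis \<theta> / cnj C1)"
  have cmod_s: "(cmod s)\<^sup>2 = \<rho>\<^sup>2"
    using BC(1) C1_norm q(1) B_pos by (simp add: s_def norm_mult norm_divide power_mult_distrib power_divide)
  have sb: "s * (B0 * of_real q) = - (C1 * cis \<theta> * of_real \<rho>)"
  proof -
    have "s * (B0 * of_real q) = - (B0 * cnj B0 * (of_real q)\<^sup>2 * of_real \<rho> * cis \<theta> / cnj C1)"
      by (simp add: s_def power2_eq_square)
    also have "\<dots> = - (C1 * cis \<theta> * of_real \<rho>)"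
      unfolding B0 C1[symmetric] using \<open>C1 \<noteq> 0\<close> by simp
    finally show ?thesis .
  qed
  let ?a = "(B0 * of_real \<rho>) *s u0" and ?b = "(B0 * of_real q) *s u1"
    and ?c = "(C1 * cis \<theta> * of_real q) *s u0"
  have sb': "s *s ?b = (- (C1 * cis \<theta> * of_real \<rho>)) *s u1"
    using sb by (simp add: mult.assoc)
  have norms: "(norm ?a)\<^sup>2 = B * \<rho>\<^sup>2" "(norm ?b)\<^sup>2 = B * q\<^sup>2" "(norm ?c)\<^sup>2 = B * q\<^sup>2 * q\<^sup>2"
    using u BC q \<rho> by (simp_all add: norm_scale norm_mult power_mult_distrib)
  have D: "B - (norm ?a)\<^sup>2 = B * q\<^sup>2"
    unfolding norms q by (simp add: algebra_simps)
  have u10: "cinner u1 u0 = 0"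
    using u(3) cinner_commute[of u0 u1] by simp
  have "solution ?a ?b ?c 0 s"
  proof (rule solution_if_affine)
    show "(norm ?a)\<^sup>2 \<le> B"
      using D q B_pos by (smt (verit) mult_nonneg_nonneg zero_le_power2)
    have "of_real (B * q\<^sup>2) * s + cinner ?c ?a = 0"
    proof -
      have "of_real (B * q\<^sup>2) * s = - (C1 * cnj C1 * (cnj B0 * of_real \<rho> * of_real q * cis \<theta>) / cnj C1)"
        unfolding C1 by (simp add: s_def)
      also have "\<dots> = - (C1 * cnj B0 * of_real \<rho> * of_real q * cis \<theta>)"
        using \<open>C1 \<noteq> 0\<close> by simp
      finally show ?thesis
        by (simp add: cinner_scale_left cinner_scale_right cinner_self u mult_ac)
    qed
    moreover have "B * q\<^sup>2 * (cmod s)\<^sup>2 + (norm ?c)\<^sup>2 = B * q\<^sup>2"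
      unfolding norms cmod_s q(2) by (simp add: algebra_simps power2_eq_square)
    ultimately show "frame (B - (norm ?a)\<^sup>2) ?a ?b ?c 0 s"
      unfolding D using norms(2) by (simp add: frame_def cinner_scale_left cinner_scale_right u10)
    show "AE \<omega> in circle. \<hh> 0 \<omega> = ?a + \<omega> *s ?b"
      using A unfolding q_def[symmetric]
      by eventually_elim (simp add: vec.scale_right_distrib mult_ac)
    show "AE \<omega> in circle. \<hh> 1 \<omega> = ?c + \<omega> *s (s *s ?b)"
      using G1 unfolding q_def[symmetric] sb'
      by eventually_elim (simp add: vec_eq_iff algebra_simps)
    show "AE \<omega> in circle. \<hh> (word_num z) \<omega> = weight 0 s z *s \<hh> 1 \<omega>" for z
    proof (cases "z = replicate (length z) True")
      case True
      define n where "n = length z"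
      have z: "z = replicate n True"
        using True by (simp only: n_def)
      show ?thesis
      proof (cases "n = 0")
        case False
        then have "n + 1 > 1" by simp
        from Gp[rule_format, OF this]
        have "AE \<omega> in circle. \<hh> (2 ^ (n + 1) - 1) \<omega>
            = (s ^ n * C1 * cis \<theta>) *s (of_real q *s u0 - (\<omega> * of_real \<rho>) *s u1)"
          unfolding q_def[symmetric] s_def[symmetric] by eventually_elim simp
        with G1 show ?thesis
          unfolding q_def[symmetric] z word_num_replicate_True weight_simps
          by eventually_elim (simp add: mult_ac)
      qed (simp add: z)
    next
      case False
      have "word_num z \<noteq> 1"
        using False word_num_eq_iff[of z "[]"] by auto
      moreover have "word_num z \<noteq> 2 ^ p - 1" if "p > 1" for p
      proof
        assume "word_num z = 2 ^ p - 1"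
        then have "z = replicate (p - 1) True"
          using that word_num_replicate_True[of "p - 1"] word_num_eq_iff[of z "replicate (p - 1) True"] by simp
        with False show False by simp
      qed
      ultimately have "AE \<omega> in circle. \<hh> (word_num z) \<omega> = 0"
        using G0 word_num_pos[of z] by simp
      with False show ?thesis
        by (simp add: weight_0_left)
    qed
  qed
  then show ?thesis by blast
qed

text \<open>For \<open>r = 0\<close> both \<open>a\<close> and \<open>c\<close> are orthogonal to \<open>b\<close>, hence proportional in \<open>\<complex>\<^sup>2\<close>; the
  phase of the factor is the angle \<open>\<theta>\<close>.\<close>

lemma solution_imp_type3:
  assumes sol: "solution a b c 0 s" and a: "a \<noteq> 0" "(norm a)\<^sup>2 < B"
  shows "type3 B \<hh> \<Psi>"
proof -
  define D where "D = B - (norm a)\<^sup>2"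
  have fr: "frame D a b c 0 s"
    using sol by (simp add: solution_def D_def)
  define \<beta> where "\<beta> = sqrt B"
  define d where "d = sqrt D"
  have \<beta>: "\<beta> > 0" "\<beta>\<^sup>2 = B" and d: "d > 0" "d\<^sup>2 = D"
    using B_pos a by (simp_all add: \<beta>_def d_def D_def)
  have D_pos: "D > 0"
    using a by (simp add: D_def)
  have na: "norm a > 0"
    using a by simp
  have nb: "norm b = d"
    using fr real_sqrt_unique[of "norm b" D] by (simp add: frame_def d_def)
  define \<rho> where "\<rho> = norm a / \<beta>"
  define q where "q = d / \<beta>"
  have \<rho>: "0 < \<rho>" "1 - \<rho>\<^sup>2 = q\<^sup>2" and q: "q > 0"
    using na \<beta> d by (auto simp: \<rho>_def q_def power_divide D_def field_simps)
  then have "\<rho>\<^sup>2 < 1"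
    by (smt (verit) zero_less_power)
  then have "\<rho> < 1"
    using \<rho> by (simp add: abs_square_less_1)
  have q_sqrt: "sqrt (1 - \<rho>\<^sup>2) = q"
    using q by (simp add: \<rho>)
  define u0 where "u0 = (1 / of_real (norm a)) *s a"
  define u1 where "u1 = (1 / of_real d) *s b"
  have u: "norm u0 = 1" "norm u1 = 1" "cinner u0 u1 = 0"
    using na d nb frame_cinner[OF fr]
    by (simp_all add: u0_def u1_def norm_scale norm_divide cinner_scale_left cinner_scale_right)
  have cu1: "cinner c u1 = 0"
    using frame_cinner[OF fr] by (simp add: u1_def cinner_scale_right)
  obtain k where k: "c = k *s u0" "cmod k = norm c"
    using proportional_if_orthogonal[OF u cu1] by blast
  define \<theta> where "\<theta> = Arg k"
  have Ds: "of_real D * s = - (k * of_real (norm a))"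
    using fr na by (simp add: frame_def k u0_def cinner_scale_left cinner_self eq_neg_iff_add_eq_0 power2_eq_square)
  have nc: "norm c = d * q"
  proof -
    have "D * cmod s = norm c * norm a"
      using arg_cong[OF Ds, of cmod] D_pos by (simp add: norm_mult k(2))
    then have "D\<^sup>2 * (cmod s)\<^sup>2 = (norm c)\<^sup>2 * (norm a)\<^sup>2"
      by (metis power_mult_distrib)
    moreover have "D * (D * (cmod s)\<^sup>2 + (norm c)\<^sup>2) = D * D"
      using fr by (simp add: frame_def)
    ultimately have "(norm c)\<^sup>2 * ((norm a)\<^sup>2 + D) = D\<^sup>2"
      by (simp add: algebra_simps power2_eq_square)
    then have "(norm c * \<beta>)\<^sup>2 = (d\<^sup>2)\<^sup>2"
      using \<beta> d by (simp add: D_def power_mult_distrib)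
    then have "norm c * \<beta> = d\<^sup>2"
      using \<beta> by (subst (asm) power2_eq_iff_nonneg) auto
    then show ?thesis
      using \<beta> by (simp add: q_def field_simps power2_eq_square)
  qed
  have k_eq: "k = of_real d * cis \<theta> * of_real q"
    using polar[of k] by (simp add: k(2) nc \<theta>_def mult_ac)
  have s: "s = - (of_real \<beta> * of_real \<rho> * of_real q * cis \<theta> / of_real d)"
  proof -
    have "of_real D * s = of_real D * (- (of_real \<beta> * of_real \<rho> * of_real q * cis \<theta> / of_real d))"
      unfolding Ds unfolding k_eq \<rho>_def d(2)[symmetric] using \<beta>(1) d(1) by (simp add: field_simps power2_eq_square)
    then show ?thesis
      using D_pos by (simp only: mult_cancel_left) simp
  qed
  have a_eq: "a = (of_real \<beta> * of_real \<rho>) *s u0"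
    using \<beta> na by (simp add: \<rho>_def u0_def)
  have b_eq: "b = (of_real \<beta> * of_real q) *s u1"
    using \<beta> d by (simp add: q_def u1_def)
  have sb: "s *s b = (- (of_real d * cis \<theta> * of_real \<rho>)) *s u1"
  proof -
    have "s * (of_real \<beta> * of_real q) = - (of_real d * cis \<theta> * of_real \<rho>)"
      unfolding s using \<beta> d by (simp add: q_def)
    then show ?thesis
      by (simp add: b_eq)
  qed
  have h0_eq: "a + \<omega> *s b = of_real \<beta> *s (of_real \<rho> *s u0 + (\<omega> * of_real q) *s u1)" for \<omega>
    unfolding a_eq b_eq by (simp add: vec_eq_iff algebra_simps)
  have h1_eq: "c + \<omega> *s (s *s b)
      = (of_real d * cis \<theta>) *s (of_real q *s u0 - (\<omega> * of_real \<rho>) *s u1)" for \<omega>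
    unfolding sb k(1) k_eq by (simp add: vec_eq_iff algebra_simps)
  note \<Psi> = solution_values[OF sol]
  have \<Psi>1: "\<Psi> 1 = a" "\<Psi> 2 = b" "\<Psi> 3 = c" "\<Psi> 5 = s *s b"
    using \<Psi>(1) \<Psi>(2,3)[of "[]"] \<Psi>(2)[of "[True]"] by (simp_all add: numeral_eq_Suc)
  have \<Psi>p: "\<Psi> (2 ^ p + 2 ^ p - 1) = s ^ (p - 1) *s c" "\<Psi> (2 ^ (p + 1) + 2 ^ p - 1) = s ^ (p - 1) *s (s *s b)"
    if "p > 1" for p
  proof -
    have eq: "2 ^ p + 2 ^ p - 1 = word_num (True # replicate (p - 1) True)"
      using that word_num_replicate_True[of p] by (cases p) auto
    show "\<Psi> (2 ^ p + 2 ^ p - 1) = s ^ (p - 1) *s c"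
      unfolding eq \<Psi>(3) by simp
    have eq: "2 ^ (p + 1) + 2 ^ p - 1 = word_num (False # replicate p True)"
      by (simp only: word_num.simps word_num_replicate_True) simp
    have "\<Psi> (2 ^ (p + 1) + 2 ^ p - 1) = s ^ p *s b"
      unfolding eq \<Psi>(2) by simp
    also have "s ^ p = s ^ (p - 1) * s"
      using that by (cases p) auto
    finally show "\<Psi> (2 ^ (p + 1) + 2 ^ p - 1) = s ^ (p - 1) *s (s *s b)"
      by simp
  qed
  show ?thesis
    unfolding type3_def
  proof (intro exI conjI allI impI)
    show "orthonormal_basis2 u0 u1"
      using u by (simp add: orthonormal_basis2_iff)
    show "0 < \<rho>" "\<rho> < 1" by fact+
    show "(cmod (of_real \<beta>))\<^sup>2 = B" "(cmod (of_real d))\<^sup>2 = B * (1 - \<rho>\<^sup>2)"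
      using \<beta> d B_pos by (simp_all add: \<rho> q_def power_divide)
    show "AE \<omega> in circle. \<hh> 0 \<omega> = \<Psi> 1 + \<omega> *s \<Psi> 2 \<and>
        \<Psi> 1 + \<omega> *s \<Psi> 2 = of_real \<beta> *s (of_real \<rho> *s u0 + (\<omega> * of_real (sqrt (1 - \<rho>\<^sup>2))) *s u1)"
      using solution_AE_affine(1)[OF sol] unfolding q_sqrt h0_eq[symmetric] \<Psi>1 by simp
    show "AE \<omega> in circle. \<hh> 1 \<omega> = \<Psi> 3 + \<omega> *s \<Psi> 5 \<and>
        \<Psi> 3 + \<omega> *s \<Psi> 5 = (of_real d * cis \<theta>) *s (of_real (sqrt (1 - \<rho>\<^sup>2)) *s u0 - (\<omega> * of_real \<rho>) *s u1)"
      using solution_AE_affine(2)[OF sol, of "[]"] unfolding q_sqrt h1_eq[symmetric] \<Psi>1 by simp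
    have s': "- (cnj (of_real \<beta>) * of_real \<rho> * of_real q * cis \<theta> / cnj (of_real d)) = s"
      by (simp add: s)
    show "AE \<omega> in circle.
          \<hh> (2 ^ p - 1) \<omega> = \<Psi> (2 ^ p + 2 ^ p - 1) + \<omega> *s \<Psi> (2 ^ (p + 1) + 2 ^ p - 1) \<and>
          \<Psi> (2 ^ p + 2 ^ p - 1) + \<omega> *s \<Psi> (2 ^ (p + 1) + 2 ^ p - 1)
            = ((- (cnj (of_real \<beta>) * of_real \<rho> * of_real (sqrt (1 - \<rho>\<^sup>2)) * cis \<theta> / cnj (of_real d))) ^ (p - 1)
                 * of_real d * cis \<theta>)
              *s (of_real (sqrt (1 - \<rho>\<^sup>2)) *s u0 - (\<omega> * of_real \<rho>) *s u1)" if "1 < p" for p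
    proof -
      have eq: "s ^ (p - 1) *s c + \<omega> *s (s ^ (p - 1) *s (s *s b))
          = (s ^ (p - 1) * of_real d * cis \<theta>) *s (of_real q *s u0 - (\<omega> * of_real \<rho>) *s u1)" for \<omega>
      proof -
        have "s ^ (p - 1) *s c + \<omega> *s (s ^ (p - 1) *s (s *s b)) = s ^ (p - 1) *s (c + \<omega> *s (s *s b))"
          by (simp add: vec_eq_iff algebra_simps)
        then show ?thesis
          unfolding h1_eq by (simp add: mult.assoc)
      qed
      have "2 ^ p - 1 = word_num (replicate (p - 1) True)"
        using that by (simp add: word_num_replicate_True)
      then have "AE \<omega> in circle. \<hh> (2 ^ p - 1) \<omega> = s ^ (p - 1) *s (c + \<omega> *s (s *s b))"
        using solution_AE_affine(2)[OF sol, of "replicate (p - 1) True"] by simp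
      then show ?thesis
        unfolding q_sqrt s' \<Psi>p[OF that] eq[symmetric]
        by eventually_elim (simp add: vec_eq_iff algebra_simps)
    qed
    show "AE \<omega> in circle. \<hh> l \<omega> = 0" if "l \<noteq> 0 \<and> l \<noteq> 1 \<and> (\<forall>p>1. l \<noteq> 2 ^ p - 1)" for l
    proof -
      from that have "l \<ge> 1" by simp
      then obtain z where z: "l = word_num z" using word_num_surj by blast
      have "z \<noteq> replicate (length z) True"
      proof
        assume "z = replicate (length z) True"
        then have l: "l = 2 ^ (length z + 1) - 1"
          using z word_num_replicate_True by metis
        with that have "\<not> length z + 1 > 1" by blast
        with l that show False by simp
      qed
      then show ?thesis
        using solution_AE_affine(2)[OF sol, of z] z by (simp add: weight_0_left)
    qed
  qed
qed


lemma type4_imp_solution: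
  assumes "type4 B \<hh> \<Psi>"
  shows "\<exists>a b c r s. solution a b c r s"
proof -
  from assms obtain u0 u1 \<rho> B0 C1 \<theta> where u: "norm u0 = 1" "norm u1 = 1" "cinner u0 u1 = 0"
    and \<rho>: "0 < \<rho>" "\<rho> < 1"
    and BC: "(cmod B0)\<^sup>2 = B" "(cmod C1)\<^sup>2 = B * (1 - \<rho>\<^sup>2)"
    and A: "AE \<omega> in circle. \<hh> 0 \<omega>
          = (B0 * (1 + of_real ((1 - \<rho>\<^sup>2) / \<rho>) * cis \<theta>
                        * (\<Sum>k. \<omega> ^ (k + 1) * (- of_real \<rho> * cis \<theta>) ^ k)) * of_real \<rho>) *s u0"
    and G1: "AE \<omega> in circle. \<hh> 1 \<omega> = \<Psi> 3 \<and> \<Psi> 3 = C1 *s u1"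
    and Gp: "\<forall>p>0. AE \<omega> in circle.
          \<hh> (2 ^ p) \<omega> = \<Psi> (2 ^ (p + 1) + 2 ^ p) \<and>
          \<Psi> (2 ^ (p + 1) + 2 ^ p)
            = (of_real B / cnj C1 * (- of_real \<rho> * cis \<theta>) ^ p * of_real (1 - \<rho>\<^sup>2)) *s u1"
    and G0: "\<forall>l. l \<noteq> 0 \<and> l \<noteq> 1 \<and> (\<forall>p>0. l \<noteq> 2 ^ p) \<longrightarrow> (AE \<omega> in circle. \<hh> l \<omega> = 0)"
    unfolding type4_def orthonormal_basis2_iff by blast
  define x where "x = 1 - \<rho>\<^sup>2"
  have "\<rho>\<^sup>2 < 1"
    using \<rho> by (simp add: abs_square_less_1)
  then have x: "x > 0" by (simp add: x_def)
  have C1_norm: "(cmod C1)\<^sup>2 = B * x"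
    using BC(2) by (simp add: x_def)
  then have "C1 \<noteq> 0"
    using x B_pos by auto
  have C1: "C1 * cnj C1 = of_real B * of_real x"
    unfolding complex_norm_square[symmetric] C1_norm by simp
  have B0: "B0 * cnj B0 = of_real B"
    using BC(1) by (simp flip: complex_norm_square)
  define r where "r = - of_real \<rho> * cis \<theta>"
  have cmod_r: "cmod r = \<rho>"
    using \<rho> by (simp add: r_def norm_mult)
  let ?a = "(B0 * of_real \<rho>) *s u0" and ?b = "(B0 * of_real x * cis \<theta>) *s u0" and ?c = "C1 *s u1"
  have norms: "(norm ?a)\<^sup>2 = B * \<rho>\<^sup>2" "(norm ?b)\<^sup>2 = B * x * x" "(norm ?c)\<^sup>2 = B * x"
    using u BC(1) C1_norm \<rho> x by (simp_all add: norm_scale norm_mult power_mult_distrib power2_eq_square)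
  have D: "B - (norm ?a)\<^sup>2 = B * x"
    unfolding norms x_def by (simp add: algebra_simps)
  have u10: "cinner u1 u0 = 0"
    using u(3) cinner_commute[of u0 u1] by simp
  have "solution ?a ?b ?c r 0"
  proof (rule solution_if_proportional)
    show "(norm ?a)\<^sup>2 \<le> B"
      using D x B_pos by (smt (verit) mult_nonneg_nonneg)
    have "of_real (B * x) * r + cinner ?b ?a = 0"
    proof -
      have "cinner ?b ?a = B0 * cnj B0 * of_real x * of_real \<rho> * cis \<theta>"
        using u by (simp add: cinner_scale_left cinner_scale_right cinner_self mult_ac)
      then show ?thesis
        unfolding B0 by (simp add: r_def)
    qed
    moreover have "B * x * \<rho>\<^sup>2 + B * x * x = B * x"
      by (simp add: x_def algebra_simps)
    ultimately show "frame (B - (norm ?a)\<^sup>2) ?a ?b ?c r 0"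
      unfolding D unfolding frame_def norms cmod_r using \<rho>
      by (simp add: cinner_scale_left cinner_scale_right u10 u)
    show "AE \<omega> in circle. \<hh> 0 \<omega> = ?a + (\<Sum>k. \<omega> ^ (k + 1) * r ^ k) *s ?b"
      using A unfolding r_def[symmetric] x_def[symmetric]
    proof eventually_elim
      case (elim \<omega>)
      have "B0 * (1 + of_real (x / \<rho>) * cis \<theta> * S) * of_real \<rho> = B0 * of_real \<rho> + S * (B0 * of_real x * cis \<theta>)" for S
        using \<rho> by (simp add: field_simps)
      then show ?case
        unfolding elim by (simp add: vec.scale_left_distrib)
    qed
    show "AE \<omega> in circle. \<hh> 1 \<omega> = ?c + (\<Sum>k. \<omega> ^ (k + 1) * r ^ k) *s (0 *s ?b)"
      using G1 by eventually_elim simp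
    show "AE \<omega> in circle. \<hh> (word_num z) \<omega> = weight r 0 z *s \<hh> 1 \<omega>" for z
    proof (cases "z = replicate (length z) False")
      case True
      define n where "n = length z"
      have z: "z = replicate n False"
        using True by (simp only: n_def)
      show ?thesis
      proof (cases "n = 0")
        case False
        have eq: "of_real B / cnj C1 * r ^ n * of_real x = r ^ n * C1"
          using \<open>C1 \<noteq> 0\<close> C1 by (simp add: field_simps)
        from False have "n > 0" by simp
        from Gp[rule_format, OF this] G1 show ?thesis
          unfolding r_def[symmetric] x_def[symmetric] eq z word_num_replicate_False weight_simps
          by eventually_elim simp
      qed (simp add: z)
    next
      case False
      have "word_num z \<noteq> 1"
        using False word_num_eq_iff[of z "[]"] by auto
      moreover have "word_num z \<noteq> 2 ^ p" for p
        using False word_num_replicate_False[of p] word_num_eq_iff[of z "replicate p False"] by auto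
      ultimately have "AE \<omega> in circle. \<hh> (word_num z) \<omega> = 0"
        using G0 word_num_pos[of z] by simp
      with False show ?thesis
        by (simp add: weight_0_right)
    qed
  qed
  then show ?thesis by blast
qed

text \<open>For \<open>s = 0\<close> both \<open>a\<close> and \<open>b\<close> are orthogonal to \<open>c\<close>, hence proportional in \<open>\<complex>\<^sup>2\<close>; the
  phase of the factor is the angle \<open>\<theta>\<close>.\<close>

lemma solution_imp_type4:
  assumes sol: "solution a b c r 0" and a: "a \<noteq> 0" "(norm a)\<^sup>2 < B"
  shows "type4 B \<hh> \<Psi>"
proof -
  define D where "D = B - (norm a)\<^sup>2"
  have fr: "frame D a b c r 0"
    using sol by (simp add: solution_def D_def)
  define \<beta> where "\<beta> = sqrt B"
  define d where "d = sqrt D"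
  have \<beta>: "\<beta> > 0" "\<beta>\<^sup>2 = B" and d: "d > 0" "d\<^sup>2 = D"
    using B_pos a by (simp_all add: \<beta>_def d_def D_def)
  have D_pos: "D > 0"
    using a by (simp add: D_def)
  have na: "norm a > 0"
    using a by simp
  have nc: "norm c = d"
    using fr real_sqrt_unique[of "norm c" D] by (simp add: frame_def d_def)
  define \<rho> where "\<rho> = norm a / \<beta>"
  have \<rho>: "0 < \<rho>" "1 - \<rho>\<^sup>2 = D / B"
    using na \<beta> B_pos by (auto simp: \<rho>_def power_divide D_def field_simps)
  have "D / B > 0"
    using D_pos B_pos by simp
  then have "\<rho>\<^sup>2 < 1"
    using \<rho>(2) by linarith
  then have "\<rho> < 1"
    using \<rho> by (simp add: abs_square_less_1)
  define u0 where "u0 = (1 / of_real (norm a)) *s a"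
  define u1 where "u1 = (1 / of_real d) *s c"
  have u: "norm u0 = 1" "norm u1 = 1" "cinner u0 u1 = 0"
    using na d nc frame_cinner[OF fr]
    by (simp_all add: u0_def u1_def norm_scale norm_divide cinner_scale_left cinner_scale_right)
  have bu1: "cinner b u1 = 0"
    using frame_cinner[OF fr] by (simp add: u1_def cinner_scale_right)
  obtain k where k: "b = k *s u0" "cmod k = norm b"
    using proportional_if_orthogonal[OF u bu1] by blast
  define \<theta> where "\<theta> = Arg k"
  have Dr: "of_real D * r = - (k * of_real (norm a))"
    using fr na by (simp add: frame_def k u0_def cinner_scale_left cinner_self eq_neg_iff_add_eq_0 power2_eq_square)
  have nb: "norm b = D / \<beta>"
  proof -
    have "D * cmod r = norm b * norm a"
      using arg_cong[OF Dr, of cmod] D_pos by (simp add: norm_mult k(2))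
    then have "D\<^sup>2 * (cmod r)\<^sup>2 = (norm b)\<^sup>2 * (norm a)\<^sup>2"
      by (metis power_mult_distrib)
    moreover have "D * (D * (cmod r)\<^sup>2 + (norm b)\<^sup>2) = D * D"
      using fr by (simp add: frame_def)
    ultimately have "(norm b)\<^sup>2 * ((norm a)\<^sup>2 + D) = D\<^sup>2"
      by (simp add: algebra_simps power2_eq_square)
    then have "(norm b * \<beta>)\<^sup>2 = D\<^sup>2"
      using \<beta> by (simp add: D_def power_mult_distrib)
    then have "norm b * \<beta> = D"
      using \<beta> D_pos by (subst (asm) power2_eq_iff_nonneg) auto
    then show ?thesis
      using \<beta> by (simp add: field_simps)
  qed
  have k_eq: "k = of_real (D / \<beta>) * cis \<theta>"
    using polar[of k] by (simp only: k(2) nb \<theta>_def)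
  have r: "r = - of_real \<rho> * cis \<theta>"
  proof -
    have "of_real D * r = of_real D * (- of_real \<rho> * cis \<theta>)"
      unfolding Dr unfolding k_eq \<rho>_def using \<beta>(1) by (simp add: field_simps)
    then show ?thesis
      using D_pos by (simp only: mult_cancel_left) simp
  qed
  have a_eq: "a = (of_real \<beta> * of_real \<rho>) *s u0"
    using \<beta> na by (simp add: \<rho>_def u0_def)
  have c_eq: "c = of_real d *s u1"
    using d by (simp add: u1_def)
  have h0_eq: "a + S *s b = (of_real \<beta> * (1 + of_real ((1 - \<rho>\<^sup>2) / \<rho>) * cis \<theta> * S) * of_real \<rho>) *s u0" for S
  proof -
    have "of_real \<beta> * (1 + of_real ((1 - \<rho>\<^sup>2) / \<rho>) * cis \<theta> * S) * of_real \<rho>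
        = of_real \<beta> * of_real \<rho> + of_real (\<beta> * (D / B)) * cis \<theta> * S"
      unfolding \<rho>(2) using \<rho>(1) by (simp add: field_simps)
    also have "\<beta> * (D / B) = D / \<beta>"
      using \<beta>(1) unfolding \<beta>(2)[symmetric] by (simp add: field_simps power2_eq_square)
    finally show ?thesis
      unfolding k(1) k_eq by (subst a_eq) (simp add: vec_eq_iff algebra_simps)
  qed
  note \<Psi> = solution_values[OF sol]
  have h1_eq: "of_real B / cnj (of_real d) * (- of_real \<rho> * cis \<theta>) ^ p * of_real (1 - \<rho>\<^sup>2) = r ^ p * of_real d" for p
  proof -
    have "of_real B / cnj (of_real d) * r ^ p * of_real (D / B) = r ^ p * of_real d"
      using B_pos d(1) unfolding d(2)[symmetric] by (simp add: field_simps power2_eq_square)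
    then show ?thesis
      unfolding \<rho>(2) r .
  qed
  have \<Psi>p: "\<Psi> (2 ^ (p + 1) + 2 ^ p) = (r ^ p * of_real d) *s u1" for p
  proof -
    have eq: "2 ^ (p + 1) + 2 ^ p = word_num (True # replicate p False)"
      by (simp add: word_num_replicate_False)
    show ?thesis
      unfolding eq \<Psi>(3) by (simp add: c_eq)
  qed
  show ?thesis
    unfolding type4_def
  proof (intro exI conjI allI impI)
    show "orthonormal_basis2 u0 u1"
      using u by (simp add: orthonormal_basis2_iff)
    show "0 < \<rho>" "\<rho> < 1" by fact+
    show "(cmod (of_real \<beta>))\<^sup>2 = B" "(cmod (of_real d))\<^sup>2 = B * (1 - \<rho>\<^sup>2)"
      using \<beta> d B_pos by (simp_all add: \<rho>(2))
    have "fiber (\<Psi> \<circ> word_num) [] = (\<lambda>k. \<Psi> (2 ^ k))"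
      by (simp add: fun_eq_iff fiber_def word_num_replicate_False)
    with h0 show "hardy_series (\<hh> 0) (\<lambda>k. \<Psi> (2 ^ k))" by simp
    show "AE \<omega> in circle. \<hh> 0 \<omega>
          = (of_real \<beta> * (1 + of_real ((1 - \<rho>\<^sup>2) / \<rho>) * cis \<theta>
                        * (\<Sum>k. \<omega> ^ (k + 1) * (- of_real \<rho> * cis \<theta>) ^ k)) * of_real \<rho>) *s u0"
      using solution_AE(1)[OF sol] unfolding h0_eq r .
    have "\<Psi> 3 = c"
      using \<Psi>(3)[of "[]"] by (simp add: numeral_eq_Suc)
    then show "AE \<omega> in circle. \<hh> 1 \<omega> = \<Psi> 3 \<and> \<Psi> 3 = of_real d *s u1"
      using solution_AE(2)[OF sol, of "[]"] by (simp flip: c_eq)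
    show "AE \<omega> in circle. \<hh> (2 ^ p) \<omega> = \<Psi> (2 ^ (p + 1) + 2 ^ p) \<and>
          \<Psi> (2 ^ (p + 1) + 2 ^ p)
            = (of_real B / cnj (of_real d) * (- of_real \<rho> * cis \<theta>) ^ p * of_real (1 - \<rho>\<^sup>2)) *s u1"
      if "0 < p" for p
      using solution_AE(2)[OF sol, of "replicate p False"]
      unfolding word_num_replicate_False h1_eq \<Psi>p by eventually_elim (simp add: c_eq)
    show "AE \<omega> in circle. \<hh> l \<omega> = 0" if "l \<noteq> 0 \<and> l \<noteq> 1 \<and> (\<forall>p>0. l \<noteq> 2 ^ p)" for l
    proof -
      from that have "l \<ge> 1" by simp
      then obtain z where z: "l = word_num z" using word_num_surj by blast
      have "z \<noteq> replicate (length z) False"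
      proof
        assume "z = replicate (length z) False"
        then have l: "l = 2 ^ length z"
          using z word_num_replicate_False by metis
        with that have "\<not> length z > 0" by blast
        with l that show False by simp
      qed
      then show ?thesis
        using solution_AE(2)[OF sol, of z] z by (simp add: weight_0_right)
    qed
  qed
qed

section \<open>Type 5\<close>

text \<open>The norm conditions on \<open>\<rho>1\<close> and \<open>\<tau>0\<close> are the norm equations of the frame. The formula
  for \<open>r\<close> makes \<open>V [0]\<close> orthogonal to \<open>V []\<close>. By the relation between \<open>u0\<close>, \<open>u1\<close> and \<open>v\<close>, the
  formula for \<open>\<tau>1\<close> does the same for \<open>V [1]\<close>, and the relation itself is the orthogonality of
  \<open>V [0]\<close> and \<open>V [1]\<close>.\<close>

lemma type5_imp_solution:
  assumes "type5 B \<hh>"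
  shows "\<exists>a b c r s. solution a b c r s"
proof -
  obtain \<rho>0 u0 u1 v \<rho>1 \<tau>0 B0 C1 r \<tau>1 and C :: "nat \<Rightarrow> complex" and \<kappa>
    where \<rho>0: "0 < cmod \<rho>0" "cmod \<rho>0 < 1"
      and u: "norm u0 = 1" "norm u1 = 1" "norm v = 1" "cinner v u0 \<noteq> 0" "cinner u1 u0 \<noteq> 0"
      and \<kappa>: "\<kappa> = (cmod \<rho>0)\<^sup>2 / (1 - (cmod \<rho>0)\<^sup>2)"
      and orth: "of_real \<kappa> * cinner u0 u1 * cinner v u0 + cinner v u1 = 0"
      and \<rho>1: "(cmod \<rho>1)\<^sup>2 = (1 - (cmod \<rho>0)\<^sup>2) / (1 + \<kappa> * (cmod (cinner v u0))\<^sup>2)"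
      and \<tau>0: "(cmod \<tau>0)\<^sup>2 = 1 / (1 + \<kappa> * (cmod (cinner u1 u0))\<^sup>2)"
      and B0: "(cmod B0)\<^sup>2 = B" and C1: "(cmod C1)\<^sup>2 = B * (1 - (cmod \<rho>0)\<^sup>2)"
      and r: "r = - (cnj \<rho>0 / cnj \<rho>1)
             * (cinner v u0 / of_real (1 + \<kappa> * (cmod (cinner v u0))\<^sup>2))"
      and \<tau>1: "\<tau>1 = \<tau>0 * (\<rho>1 * cinner u1 v / (\<rho>0 * cinner u0 v))"
      and C: "C 1 = C1"
        "\<forall>p>0. C (2 ^ p) = of_real B / cnj C1 * of_real (1 - (cmod \<rho>0)\<^sup>2) * r ^ p"
        "\<forall>p>0. C (2 ^ p + 1) = C1 * cnj B0 / cnj C1 * (\<tau>1 / \<rho>1) * of_real (1 - (cmod \<rho>0)\<^sup>2) * r ^ (p - 1)"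
        "product_rule C"
      and A: "AE \<omega> in circle. \<hh> 0 \<omega> = B0 *s (\<rho>0 *s u0 + (\<rho>1 * (\<Sum>k. \<omega> ^ (k + 1) * r ^ k)) *s v)"
      and G1: "AE \<omega> in circle. \<hh> 1 \<omega> = C1 *s (\<tau>0 *s u1 + (\<tau>1 * (\<Sum>k. \<omega> ^ (k + 1) * r ^ k)) *s v)"
      and G: "\<forall>l\<ge>1. AE \<omega> in circle. \<hh> l \<omega> = (C l / C1) *s \<hh> 1 \<omega>"
  proof -
    show thesis
      using assms unfolding type5_def by (elim exE conjE) (rule that)
  qed
  define x where "x = 1 - (cmod \<rho>0)\<^sup>2"
  have x: "x > 0"
    using \<rho>0 by (simp add: x_def abs_square_less_1)
  define w where "w = cinner v u0"
  define y where "y = cinner u1 u0"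
  have inners: "cinner u0 v = cnj w" "cinner u0 u1 = cnj y"
    by (simp_all add: w_def y_def cinner_commute[of u0 v] cinner_commute[of u0 u1])
  have vu1: "cinner v u1 = - of_real \<kappa> * cnj y * w"
    using orth inners by (simp add: w_def add_eq_0_iff2 algebra_simps)
  have u1v: "cinner u1 v = - of_real \<kappa> * y * cnj w"
    unfolding cinner_commute[of u1 v] vu1 by simp
  \<comment> \<open>the weight of \<open>u0\<close> in the relation is \<open>\<parallel>a\<parallel>\<^sup>2 / D\<close>\<close>
  have \<kappa>_x: "of_real \<kappa> * of_real x = \<rho>0 * cnj \<rho>0"
    using x by (simp add: \<kappa> x_def[symmetric] complex_norm_square[symmetric])
  have \<kappa>: "\<kappa> \<ge> 0"
    using x by (simp add: \<kappa> x_def[symmetric])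
  define E where "E = 1 + \<kappa> * (cmod w)\<^sup>2"
  define F where "F = 1 + \<kappa> * (cmod y)\<^sup>2"
  have E: "E > 0" and F: "F > 0"
    using \<kappa> by (simp_all add: E_def F_def add_pos_nonneg)
  have \<rho>1E: "(cmod \<rho>1)\<^sup>2 * E = x" and \<tau>0F: "(cmod \<tau>0)\<^sup>2 * F = 1"
    using E F \<rho>1 \<tau>0 by (simp_all add: x_def w_def y_def E_def F_def)
  have nz: "\<rho>0 \<noteq> 0" "\<rho>1 \<noteq> 0" "C1 \<noteq> 0" "B0 \<noteq> 0" "w \<noteq> 0" "cnj w \<noteq> 0"
    using \<rho>0 \<rho>1E x C1 B0 B_pos u by (auto simp: x_def[symmetric] w_def)
  have B0': "B0 * cnj B0 = of_real B" and C1': "C1 * cnj C1 = of_real B * of_real x"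
    unfolding complex_norm_square[symmetric] B0 C1 x_def by simp_all
  have r_eq: "of_real x * r = - \<rho>1 * cnj \<rho>0 * w"
  proof -
    have "of_real x = \<rho>1 * cnj \<rho>1 * of_real E"
      unfolding \<rho>1E[symmetric] by (simp only: of_real_mult complex_norm_square)
    then show ?thesis
      using nz E unfolding r w_def[symmetric] E_def[symmetric] by (simp add: field_simps)
  qed
  have \<tau>1_eq: "of_real x * \<tau>1 = - \<tau>0 * \<rho>1 * cnj \<rho>0 * y"
  proof -
    have "of_real x * \<tau>1 = - \<tau>0 * \<rho>1 * (of_real \<kappa> * of_real x) * y / \<rho>0"
      unfolding \<tau>1 u1v inners using nz by simp
    then show ?thesis
      unfolding \<kappa>_x using nz by simp
  qed
  define s where "s = C1 * \<tau>1 / (B0 * \<rho>1)"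
  let ?a = "(B0 * \<rho>0) *s u0" and ?b = "(B0 * \<rho>1) *s v" and ?c = "(C1 * \<tau>0) *s u1"
  have sb: "s *s ?b = (C1 * \<tau>1) *s v"
    using nz by (simp add: s_def)
  have norms: "(norm ?a)\<^sup>2 = B * (cmod \<rho>0)\<^sup>2" "(norm ?b)\<^sup>2 = B * (cmod \<rho>1)\<^sup>2"
      "(norm ?c)\<^sup>2 = B * x * (cmod \<tau>0)\<^sup>2"
    using u B0 C1 by (simp_all add: norm_scale norm_mult power_mult_distrib x_def)
  have D: "B - (norm ?a)\<^sup>2 = B * x"
    unfolding norms x_def by (simp add: algebra_simps)
  have Ds: "of_real (B * x) * s = - (C1 * \<tau>0 * cnj B0 * cnj \<rho>0 * y)"
  proof -
    have "of_real (B * x) * s = B0 * cnj B0 * C1 * (of_real x * \<tau>1) / (B0 * \<rho>1)"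
      unfolding B0' s_def by simp
    then show ?thesis
      unfolding \<tau>1_eq using nz by simp
  qed
  have nr: "x * (cmod r)\<^sup>2 = (cmod \<rho>1)\<^sup>2 * \<kappa> * (cmod w)\<^sup>2"
  proof -
    have "x * cmod r = cmod \<rho>1 * cmod \<rho>0 * cmod w"
      using arg_cong[OF r_eq, of cmod] x by (simp add: norm_mult)
    then have "x * (x * (cmod r)\<^sup>2) = (cmod \<rho>1)\<^sup>2 * (cmod \<rho>0)\<^sup>2 * (cmod w)\<^sup>2"
      by (metis power2_eq_square power_mult_distrib mult.assoc)
    also have "(cmod \<rho>0)\<^sup>2 = \<kappa> * x"
      using x by (simp add: \<open>\<kappa> = _\<close> x_def[symmetric])
    finally have "x * (x * (cmod r)\<^sup>2) = x * ((cmod \<rho>1)\<^sup>2 * \<kappa> * (cmod w)\<^sup>2)"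
      by (simp add: mult_ac)
    then show ?thesis
      using x by simp
  qed
  have ns: "(cmod s)\<^sup>2 = (cmod \<tau>0)\<^sup>2 * \<kappa> * (cmod y)\<^sup>2"
  proof -
    have "B * x * cmod s = cmod C1 * cmod \<tau>0 * cmod B0 * cmod \<rho>0 * cmod y"
      using arg_cong[OF Ds, of cmod] x B_pos by (simp add: norm_mult)
    then have "(B * x)\<^sup>2 * (cmod s)\<^sup>2 = (cmod C1)\<^sup>2 * (cmod \<tau>0)\<^sup>2 * (cmod B0)\<^sup>2 * (cmod \<rho>0)\<^sup>2 * (cmod y)\<^sup>2"
      by (metis power_mult_distrib)
    also have "\<dots> = B * x * (cmod \<tau>0)\<^sup>2 * B * (cmod \<rho>0)\<^sup>2 * (cmod y)\<^sup>2"
      unfolding C1 B0 x_def ..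
    also have "(cmod \<rho>0)\<^sup>2 = \<kappa> * x"
      using x by (simp add: \<open>\<kappa> = _\<close> x_def[symmetric])
    finally have "(B * x)\<^sup>2 * (cmod s)\<^sup>2 = (B * x)\<^sup>2 * ((cmod \<tau>0)\<^sup>2 * \<kappa> * (cmod y)\<^sup>2)"
      by (simp add: mult_ac power2_eq_square)
    then show ?thesis
      using x B_pos by simp
  qed
  have frame: "frame (B * x) ?a ?b ?c r s"
    unfolding frame_def
  proof (intro conjI)
    have "of_real (B * x) * r = of_real B * (of_real x * r)" by simp
    also have "\<dots> = - cinner ?b ?a"
      unfolding r_eq B0'[symmetric] by (simp add: cinner_scale_left cinner_scale_right w_def mult_ac)
    finally show "of_real (B * x) * r + cinner ?b ?a = 0" by simp
    show "of_real (B * x) * s + cinner ?c ?a = 0"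
      unfolding Ds by (simp add: cinner_scale_left cinner_scale_right y_def mult_ac)
    show b: "B * x * (cmod r)\<^sup>2 + (norm ?b)\<^sup>2 = B * x"
    proof -
      have "B * x * (cmod r)\<^sup>2 + (norm ?b)\<^sup>2 = B * ((cmod \<rho>1)\<^sup>2 * E)"
        unfolding norms mult.assoc nr E_def by (simp add: algebra_simps)
      then show ?thesis
        unfolding \<rho>1E .
    qed
    show "B * x * (cmod s)\<^sup>2 + (norm ?c)\<^sup>2 = B * x"
    proof -
      have "B * x * (cmod s)\<^sup>2 + (norm ?c)\<^sup>2 = B * x * ((cmod \<tau>0)\<^sup>2 * F)"
        unfolding norms ns F_def by (simp add: algebra_simps)
      then show ?thesis
        unfolding \<tau>0F by simp
    qed
    show "of_real (B * x) * r * cnj s + cinner ?b ?c = 0"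
    proof -
      have "of_real (B * x) * (of_real (B * x) * r * cnj s)
          = of_real B * (of_real x * r) * cnj (of_real (B * x) * s)"
        by (simp add: mult_ac)
      also have "\<dots> = of_real B * (\<rho>1 * cnj \<rho>0 * w) * (cnj (C1 * \<tau>0) * B0 * \<rho>0 * cnj y)"
        unfolding r_eq Ds by simp
      also have "\<dots> = of_real (B * x) * (B0 * \<rho>1 * cnj (C1 * \<tau>0) * (of_real \<kappa> * cnj y * w))"
        using \<kappa>_x by (simp add: mult_ac)
      also have "\<dots> = of_real (B * x) * (- cinner ?b ?c)"
        by (simp add: cinner_scale_left cinner_scale_right vu1 mult_ac)
      finally have "of_real (B * x) * (of_real (B * x) * r * cnj s + cinner ?b ?c) = 0"
        by (simp add: algebra_simps)
      moreover have "of_real (B * x) \<noteq> (0 :: complex)"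
        using B_pos x by simp
      ultimately show ?thesis
        by (simp only: mult_eq_0_iff) blast
    qed
    have "(norm ?b)\<^sup>2 > 0"
      unfolding norms using B_pos nz by simp
    with b have "B * x * (cmod r)\<^sup>2 < B * x * 1" by linarith
    then have "(cmod r)\<^sup>2 < 1"
      using B_pos x by (subst (asm) mult_less_cancel_left_pos) auto
    then show "cmod r < 1"
      by (simp add: abs_square_less_1)
  qed
  have C_weight_at: "C l = C1 * weight_at r s l" if "l \<ge> 1" for l
  proof (rule product_rule_unique[OF C(4) product_rule_weight_at[OF \<open>C1 \<noteq> 0\<close>] _ _ _ that])
    show "C 1 = C1 * weight_at r s 1"
      by (simp add: C(1) weight_at_1[unfolded One_nat_def] del: One_nat_def) (simp add: weight_at_1 weight_at_1[unfolded One_nat_def])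
    fix p :: nat assume "p > 0"
    have "of_real B / cnj C1 * of_real x = C1"
      using nz C1' by (simp add: field_simps)
    then show "C (2 ^ p) = C1 * weight_at r s (2 ^ p)"
      using C(2) \<open>p > 0\<close> by (simp add: weight_at_power x_def)
    have "cnj B0 / cnj C1 * of_real x = C1 / B0"
    proof -
      have "cnj B0 * B0 * of_real x = C1 * cnj C1"
        unfolding C1' B0'[symmetric] by simp
      then show ?thesis
        using nz by (simp add: field_simps)
    qed
    moreover have "C (2 ^ p + 1) = C1 * (cnj B0 / cnj C1 * of_real x) * (\<tau>1 / \<rho>1) * r ^ (p - 1)"
      using C(3) \<open>p > 0\<close> by (simp add: x_def)
    ultimately have "C (2 ^ p + 1) = C1 * (C1 / B0) * (\<tau>1 / \<rho>1) * r ^ (p - 1)"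
      by simp
    then show "C (2 ^ p + 1) = C1 * weight_at r s (2 ^ p + 1)"
      unfolding weight_at_power_plus_1[OF \<open>p > 0\<close>] by (simp add: s_def)
  qed
  have "solution ?a ?b ?c r s"
  proof (rule solution_if_proportional)
    show "(norm ?a)\<^sup>2 \<le> B"
      using D x B_pos by (smt (verit) mult_nonneg_nonneg)
    show "frame (B - (norm ?a)\<^sup>2) ?a ?b ?c r s"
      unfolding D by (rule frame)
    show "AE \<omega> in circle. \<hh> 0 \<omega> = ?a + (\<Sum>k. \<omega> ^ (k + 1) * r ^ k) *s ?b"
      using A by eventually_elim (simp add: vec.scale_right_distrib mult_ac)
    show "AE \<omega> in circle. \<hh> 1 \<omega> = ?c + (\<Sum>k. \<omega> ^ (k + 1) * r ^ k) *s (s *s ?b)"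
      using G1 unfolding sb by eventually_elim (simp add: vec.scale_right_distrib mult_ac)
    show "AE \<omega> in circle. \<hh> (word_num z) \<omega> = weight r s z *s \<hh> 1 \<omega>" for z
    proof -
      have z: "word_num z \<ge> 1"
        using word_num_pos[of z] by simp
      have "C (word_num z) / C1 = weight r s z"
        using nz by (simp add: C_weight_at[OF z])
      then show ?thesis
        using G[rule_format, OF z] by simp
    qed
  qed
  then show ?thesis by blast
qed

text \<open>Since \<open>\<langle>b, a\<rangle> = - D r\<close> and \<open>\<langle>c, a\<rangle> = - D s\<close> are nonzero, \<open>a\<close>, \<open>b\<close>, \<open>c\<close> can be
  normalised. The scalars \<open>B0\<close>, \<open>C1\<close>, \<open>\<rho>0\<close>, \<open>\<rho>1\<close>, \<open>\<tau>0\<close> can all be chosen positive, the phases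
  being absorbed in the unit vectors.\<close>

lemma solution_imp_type5:
  assumes sol: "solution a b c r s" and rs: "r \<noteq> 0" "s \<noteq> 0" and a: "(norm a)\<^sup>2 < B"
  shows "type5 B \<hh>"
proof -
  define D where "D = B - (norm a)\<^sup>2"
  have fr: "frame D a b c r s"
    using sol by (simp add: solution_def D_def)
  define \<beta> where "\<beta> = sqrt B"
  define d where "d = sqrt D"
  have \<beta>: "\<beta> > 0" "\<beta>\<^sup>2 = B" and d: "d > 0" "d\<^sup>2 = D"
    using B_pos a by (simp_all add: \<beta>_def d_def D_def)
  have D_pos: "D > 0"
    using a by (simp add: D_def)
  note inner = frame_cinner[OF fr]
  have "cinner b a \<noteq> 0" "cinner c a \<noteq> 0"
    using inner(1,3) rs D_pos by simp_all
  then have n: "norm a > 0" "norm b > 0" "norm c > 0"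
    by auto
  have bn: "D * (cmod r)\<^sup>2 + (norm b)\<^sup>2 = D" and cn: "D * (cmod s)\<^sup>2 + (norm c)\<^sup>2 = D"
    using fr by (simp_all add: frame_def)
  define u0 where "u0 = (1 / of_real (norm a)) *s a"
  define v where "v = (1 / of_real (norm b)) *s b"
  define u1 where "u1 = (1 / of_real (norm c)) *s c"
  define \<rho>0 where "\<rho>0 = norm a / \<beta>"
  define \<rho>1 where "\<rho>1 = norm b / \<beta>"
  define \<tau>0 where "\<tau>0 = norm c / d"
  define \<kappa> where "\<kappa> = (norm a)\<^sup>2 / D"
  have x: "1 - \<rho>0\<^sup>2 = D / B"
    using \<beta> B_pos by (simp add: \<rho>0_def power_divide D_def field_simps)
  have "D / B > 0"
    using D_pos B_pos by simp
  then have "\<rho>0\<^sup>2 < 1"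
    using x by linarith
  have \<rho>0_pos: "\<rho>0 > 0"
    using n \<beta> by (simp add: \<rho>0_def)
  have unit: "norm u0 = 1" "norm u1 = 1" "norm v = 1"
    using n by (simp_all add: u0_def u1_def v_def norm_scale norm_divide)
  have vu0: "cinner v u0 = - of_real D * r / of_real (norm a * norm b)"
    and u0v: "cinner u0 v = - of_real D * cnj r / of_real (norm a * norm b)"
    and u1u0: "cinner u1 u0 = - of_real D * s / of_real (norm a * norm c)"
    and u0u1: "cinner u0 u1 = - of_real D * cnj s / of_real (norm a * norm c)"
    and vu1: "cinner v u1 = - of_real D * r * cnj s / of_real (norm b * norm c)"
    and u1v: "cinner u1 v = - of_real D * cnj r * s / of_real (norm b * norm c)"
    by (simp_all add: u0_def v_def u1_def cinner_scale_left cinner_scale_right inner)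
  \<comment> \<open>the norm equations of the frame determine the two denominators\<close>
  have E: "1 + \<kappa> * (cmod (cinner v u0))\<^sup>2 = D / (norm b)\<^sup>2"
  proof -
    have "\<kappa> * (cmod (cinner v u0))\<^sup>2 = D * (cmod r)\<^sup>2 / (norm b)\<^sup>2"
      unfolding vu0 \<kappa>_def using n D_pos by (simp add: norm_mult norm_divide power_divide power_mult_distrib field_simps power2_eq_square)
    then have "1 + \<kappa> * (cmod (cinner v u0))\<^sup>2 = (D * (cmod r)\<^sup>2 + (norm b)\<^sup>2) / (norm b)\<^sup>2"
      using n by (simp add: field_simps)
    then show ?thesis
      unfolding bn .
  qed
  have F: "1 + \<kappa> * (cmod (cinner u1 u0))\<^sup>2 = D / (norm c)\<^sup>2"
  proof -
    have "\<kappa> * (cmod (cinner u1 u0))\<^sup>2 = D * (cmod s)\<^sup>2 / (norm c)\<^sup>2"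
      unfolding u1u0 \<kappa>_def using n D_pos by (simp add: norm_mult norm_divide power_divide power_mult_distrib field_simps power2_eq_square)
    then have "1 + \<kappa> * (cmod (cinner u1 u0))\<^sup>2 = (D * (cmod s)\<^sup>2 + (norm c)\<^sup>2) / (norm c)\<^sup>2"
      using n by (simp add: field_simps)
    then show ?thesis
      unfolding cn .
  qed
  define \<tau>1 where "\<tau>1 = s * of_real (norm b / d)"
  have abc: "a = (of_real \<beta> * of_real \<rho>0) *s u0" "b = (of_real \<beta> * of_real \<rho>1) *s v"
      "c = (of_real d * of_real \<tau>0) *s u1"
    using n \<beta> d by (simp_all add: \<rho>0_def \<rho>1_def \<tau>0_def u0_def v_def u1_def)
  have sb: "s *s b = (of_real d * \<tau>1) *s v"
    using n d by (simp add: \<tau>1_def v_def)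
  define C where "C l = of_real d * weight_at r s l" for l
  have cnj_d: "of_real B / cnj (of_real d) * of_real (1 - (cmod (of_real \<rho>0))\<^sup>2) = (of_real d :: complex)"
  proof -
    have "B / d * (D / B) = d"
      using B_pos d(1) unfolding d(2)[symmetric] by (simp add: power2_eq_square)
    then have "complex_of_real (B / d * (D / B)) = of_real d" by (rule arg_cong)
    moreover have "complex_of_real (1 - (cmod (of_real \<rho>0))\<^sup>2) = of_real (D / B)"
      using x by (simp del: of_real_diff)
    ultimately show ?thesis
      by (simp only: complex_cnj_complex_of_real of_real_mult of_real_divide)
  qed
  show ?thesis
    unfolding type5_def
  proof (rule exI[of _ "of_real \<rho>0"], rule exI[of _ u0], rule exI[of _ u1], rule exI[of _ v],
      rule exI[of _ "of_real \<rho>1"], rule exI[of _ "of_real \<tau>0"], rule exI[of _ "of_real \<beta>"],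
      rule exI[of _ "of_real d"], rule exI[of _ r], rule exI[of _ \<tau>1], rule exI[of _ C],
      rule exI[of _ \<kappa>], intro conjI)
    show "0 < cmod (of_real \<rho>0)" "cmod (of_real \<rho>0) < 1"
      using \<rho>0_pos \<open>\<rho>0\<^sup>2 < 1\<close> by (simp_all add: abs_square_less_1)
    show "norm u0 = 1" "norm u1 = 1" "norm v = 1" by fact+
    show "cinner v u0 \<noteq> 0" "cinner u1 u0 \<noteq> 0"
      unfolding vu0 u1u0 using rs n D_pos by simp_all
    show "\<kappa> = (cmod (of_real \<rho>0))\<^sup>2 / (1 - (cmod (of_real \<rho>0))\<^sup>2)"
      using \<beta> D_pos B_pos by (simp add: x \<kappa>_def) (simp add: \<rho>0_def power_divide)
    show "of_real \<kappa> * cinner u0 u1 * cinner v u0 + cinner v u1 = 0"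
      unfolding \<kappa>_def u0u1 vu0 vu1 using n D_pos by (simp add: field_simps power2_eq_square)
    show "(cmod (of_real \<rho>1))\<^sup>2 = (1 - (cmod (of_real \<rho>0))\<^sup>2) / (1 + \<kappa> * (cmod (cinner v u0))\<^sup>2)"
      unfolding E using \<beta> D_pos B_pos by (simp add: x) (simp add: \<rho>1_def power_divide)
    show "(cmod (of_real \<tau>0))\<^sup>2 = 1 / (1 + \<kappa> * (cmod (cinner u1 u0))\<^sup>2)"
      unfolding F using d by (simp add: \<tau>0_def norm_divide power_divide)
    show "(cmod (of_real \<beta>))\<^sup>2 = B"
      using \<beta> by simp
    show "(cmod (of_real d))\<^sup>2 = B * (1 - (cmod (of_real \<rho>0))\<^sup>2)"
      using d B_pos by (simp add: x)
    show "r = - (cnj (of_real \<rho>0) / cnj (of_real \<rho>1)) * (cinner v u0 / of_real (1 + \<kappa> * (cmod (cinner v u0))\<^sup>2))"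
      unfolding E unfolding vu0 \<rho>0_def \<rho>1_def using n \<beta>(1) D_pos by (simp add: field_simps power2_eq_square)
    show "\<tau>1 = of_real \<tau>0 * (of_real \<rho>1 * cinner u1 v / (of_real \<rho>0 * cinner u0 v))"
      unfolding u1v u0v \<tau>1_def \<tau>0_def \<rho>0_def \<rho>1_def using n \<beta>(1) d(1) D_pos rs by (simp add: field_simps)
    show "C 1 = of_real d"
      by (simp add: C_def weight_at_1[unfolded One_nat_def])
    show "\<forall>p>0. C (2 ^ p) = of_real B / cnj (of_real d) * of_real (1 - (cmod (of_real \<rho>0))\<^sup>2) * r ^ p"
      unfolding cnj_d C_def weight_at_power by simp
    show "\<forall>p>0. C (2 ^ p + 1) = of_real d * cnj (of_real \<beta>) / cnj (of_real d) * (\<tau>1 / of_real \<rho>1)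
        * of_real (1 - (cmod (of_real \<rho>0))\<^sup>2) * r ^ (p - 1)"
    proof (intro allI impI)
      fix p :: nat assume "p > 0"
      have "of_real d * cnj (of_real \<beta>) / cnj (of_real d) * (\<tau>1 / of_real \<rho>1) * of_real (1 - (cmod (of_real \<rho>0))\<^sup>2)
          = of_real d * s"
      proof -
        have val: "complex_of_real (1 - (cmod (of_real \<rho>0))\<^sup>2) = of_real (d\<^sup>2 / \<beta>\<^sup>2)"
          using x \<beta>(2) d(2) by (simp del: of_real_diff)
        show ?thesis
          unfolding val \<tau>1_def \<rho>1_def using n \<beta>(1) d(1) by (simp add: field_simps power2_eq_square)
      qed
      then show "C (2 ^ p + 1) = of_real d * cnj (of_real \<beta>) / cnj (of_real d) * (\<tau>1 / of_real \<rho>1)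
        * of_real (1 - (cmod (of_real \<rho>0))\<^sup>2) * r ^ (p - 1)"
        unfolding C_def weight_at_power_plus_1[OF \<open>p > 0\<close>] by simp
    qed
    show "product_rule C"
      unfolding C_def[abs_def] using d by (intro product_rule_weight_at) simp
    show "AE \<omega> in circle. \<hh> 0 \<omega> = of_real \<beta> *s (of_real \<rho>0 *s u0 + (of_real \<rho>1 * (\<Sum>k. \<omega> ^ (k + 1) * r ^ k)) *s v)"
      using solution_AE(1)[OF sol]
      by eventually_elim (subst (asm) abc(1), subst (asm) abc(2), simp add: vec.scale_right_distrib mult_ac)
    have G: "AE \<omega> in circle. \<hh> (word_num z) \<omega> = weight r s z *s
        (of_real d *s (of_real \<tau>0 *s u1 + (\<tau>1 * (\<Sum>k. \<omega> ^ (k + 1) * r ^ k)) *s v))" for z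
      using solution_AE(2)[OF sol, of z] unfolding sb
      by eventually_elim (subst (asm) abc(3), simp add: vec.scale_right_distrib mult_ac)
    from G[of "[]"] show G1: "AE \<omega> in circle. \<hh> 1 \<omega> =
        of_real d *s (of_real \<tau>0 *s u1 + (\<tau>1 * (\<Sum>k. \<omega> ^ (k + 1) * r ^ k)) *s v)"
      by simp
    show "\<forall>l\<ge>1. AE \<omega> in circle. \<hh> l \<omega> = (C l / of_real d) *s \<hh> 1 \<omega>"
      unfolding all_positive_iff
    proof
      fix z
      have scalar: "C (word_num z) / of_real d = weight r s z"
        using d by (simp add: C_def)
      from G[of z] G1 show "AE \<omega> in circle. \<hh> (word_num z) \<omega> = (C (word_num z) / of_real d) *s \<hh> 1 \<omega>"
        by eventually_elim (simp add: scalar)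
    qed
  qed
qed

lemma solution_iff_types:
  "(\<exists>a b c r s. solution a b c r s) \<longleftrightarrow>
     type1 B \<hh> \<Psi> \<or> type2 B \<hh> \<Psi> \<or> type3 B \<hh> \<Psi> \<or> type4 B \<hh> \<Psi> \<or> type5 B \<hh>"
proof
  assume "\<exists>a b c r s. solution a b c r s"
  then obtain a b c r s where sol: "solution a b c r s" by blast
  consider "(norm a)\<^sup>2 = B" | "a = 0" | "a \<noteq> 0" "(norm a)\<^sup>2 < B" "r = 0"
    | "a \<noteq> 0" "(norm a)\<^sup>2 < B" "s = 0" | "(norm a)\<^sup>2 < B" "r \<noteq> 0" "s \<noteq> 0"
    using sol by (fastforce simp: solution_def)
  then show "type1 B \<hh> \<Psi> \<or> type2 B \<hh> \<Psi> \<or> type3 B \<hh> \<Psi> \<or> type4 B \<hh> \<Psi> \<or> type5 B \<hh>"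
  proof cases
    case 1
    then show ?thesis using solution_imp_type1[OF sol] by simp
  next
    case 2
    then show ?thesis using solution_imp_type2[OF sol] by simp
  next
    case 3
    then show ?thesis using solution_imp_type3[of a b c s] sol by simp
  next
    case 4
    then show ?thesis using solution_imp_type4[of a b c r] sol by simp
  next
    case 5
    then show ?thesis using solution_imp_type5[OF sol] by simp
  qed
next
  assume "type1 B \<hh> \<Psi> \<or> type2 B \<hh> \<Psi> \<or> type3 B \<hh> \<Psi> \<or> type4 B \<hh> \<Psi> \<or> type5 B \<hh>"
  then show "\<exists>a b c r s. solution a b c r s"
    using type1_imp_solution type2_imp_solution type3_imp_solution type4_imp_solution type5_imp_solution
    by blast
qed

end

theorem proposition3p12:
  fixes B :: real
    and \<hh> :: "nat \<Rightarrow> complex \<Rightarrow> complex ^ 2"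
    and \<Psi> :: "nat \<Rightarrow> complex ^ 2"
  assumes "B > 0"
    and "\<And>l. \<hh> l \<in> hardy_space"
    and "hardy_series (\<hh> 0) (\<lambda>k. \<Psi> (2 ^ k))"
    and "\<And>l p. l \<ge> 1 \<Longrightarrow> 2 ^ p \<le> l \<Longrightarrow> l < 2 ^ (p + 1) \<Longrightarrow>
           hardy_series (\<hh> l) (\<lambda>k. \<Psi> (2 ^ (p + k + 1) + l))"
  shows "orthogonality_conditions B \<hh> \<Psi> \<longleftrightarrow>
           type1 B \<hh> \<Psi> \<or> type2 B \<hh> \<Psi> \<or> type3 B \<hh> \<Psi> \<or> type4 B \<hh> \<Psi> \<or> type5 B \<hh>"
proof -
  interpret hardy_family B \<hh> \<Psi>
  proof
    show "B > 0" by fact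
    have "fiber (\<Psi> \<circ> word_num) [] = (\<lambda>k. \<Psi> (2 ^ k))"
      by (simp add: fun_eq_iff fiber_def word_num_replicate_False)
    with assms(3) show "hardy_series (\<hh> 0) (fiber (\<Psi> \<circ> word_num) [])" by simp
    fix y
    have "fiber (\<Psi> \<circ> word_num) (True # y) = (\<lambda>k. \<Psi> (2 ^ (length y + k + 1) + word_num y))"
      unfolding fiber_def comp_apply word_num_gap ..
    moreover have "word_num y \<ge> 1"
      using word_num_pos[of y] by simp
    ultimately show "hardy_series (\<hh> (word_num y)) (fiber (\<Psi> \<circ> word_num) (True # y))"
      using assms(4)[of "word_num y" "length y"] word_num_bounds[of y] by simp
  qed
  show ?thesis
    unfolding orthogonality_conditions_iff_solution by (rule solution_iff_types)
qed

end
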